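(* Let $d=2$ and $c(\cdot,\cdot)\equiv0$. Let $\tilde{\mathbb W}_\Gamma,\mathbb G_\Gamma,\mathbb Q_\Gamma$ satisfy: (A1) $\tilde{\mathbb W}\subset H^1(\Omega)$, $\mathbb G\subset H^1(\Omega)^2$ are finite-dimensional subspaces, $\tilde{\mathbb W}_\Gamma=\tilde{\mathbb W}\cap H^1_\Gamma(\Omega)$, $\mathbb G_\Gamma=\mathbb G\cap\mathbf G_\Gamma(\Omega)$; (A2) $\mathbb Q_\Gamma=\operatorname{Im}\boldsymbol\Xi_X$ with $\boldsymbol\Xi_X(\tilde v,\boldsymbol\psi)=\nabla\tilde v-\boldsymbol\psi$ on $\tilde{\mathbb W}_\Gamma\times\mathbb G_\Gamma$; (A3) with $\mathbb W_\Gamma=\{v\in\tilde{\mathbb W}_\Gamma:\nabla v\in\mathbb G_\Gamma\}$, $\inf_{0\ne u\in\mathbb W_\Gamma}\sup_{0\ne v\in\mathbb W_\Gamma}\frac{B(u,v)}{\|u\|_2\|v\|_2}>0$; (B1) for all $\vec\kappa\in\mathbb R^{N_f-1}$ there exists $\boldsymbol\psi\in\mathbb G_\Gamma$ with $\mathrm{curl}\,\boldsymbol\psi\equiv0$ and $(\mathbf t\cdot\boldsymbol\psi,1)_{\Gamma_f^{(i)}}=\kappa_i$, $1\le i\le N_f-1$; (B2) $\nabla\mathbb W_\Gamma=\{\boldsymbol\gamma\in\mathbb G_\Gamma:\mathrm{curl}\,\boldsymbol\gamma\equiv0\text{ and }(\mathbf t\cdot\boldsymbol\gamma,1)_{\Gamma_f^{(i)}}=0,\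 1\le i\le N_f-1\}$. For $F_1\in\mathbb G_\Gamma^*$ and $F_2\in\tilde{\mathbb W}_\Gamma^*$ consider the mixed problem (M): find $(\tilde w_X,\boldsymbol\gamma_X,\mathbf q_X)\in\tilde{\mathbb W}_\Gamma\times\mathbb G_\Gamma\times\mathbb Q_\Gamma$ with $$a(\boldsymbol\gamma_X,\boldsymbol\psi)+(\boldsymbol\Xi_X(\tilde v,\boldsymbol\psi),\mathbf q_X)_{\mathrm{curl}}=F_1(\boldsymbol\psi)+F_2(\tilde v)\ \ \forall(\tilde v,\boldsymbol\psi)\in\tilde{\mathbb W}_\Gamma\times\mathbb G_\Gamma,\qquad(\boldsymbol\Xi_X(\tilde w_X,\boldsymbol\gamma_X),\boldsymbol\eta)_{\mathrm{curl}}=0\ \ \forall\boldsymbol\eta\in\mathbb Q_\Gamma,$$ and the equations $$(\mathrm i)\quad(\nabla\tilde z_X,\nabla\tilde v)=F_2(\tilde v)\quad\forall\tilde v\in\tilde{\mathbb W}_\Gamma,$$ $$(\mathrm{ii})\quad a(\boldsymbol\gamma_X,\boldsymbol\psi)+\tilde b(\boldsymbol\psi;r_X,\vec\kappa)=(\nabla\tilde z_X,\boldsymbol\psi)+F_1(\boldsymbol\psi)\quad\forall\boldsymbol\psi\in\mathbb G_\Gamma,$$ $$(\mathrm{iii})\quad\tilde b(\boldsymbol\gamma_X;s,\vec\mu)=0\quad\forall(s,\vec\mu)\in\mathrm{curl}\,\mathbb G_\Gamma\times\mathbb R^{N_f-1},$$ $$(\mathrm{iv})\quad(\nabla\tilde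 w_X,\nabla\tilde u)=(\boldsymbol\gamma_X,\nabla\tilde u)\quad\forall\tilde u\in\tilde{\mathbb W}_\Gamma,$$ where $\tilde b(\boldsymbol\eta;r,\vec\kappa):=(r,\mathrm{curl}\,\boldsymbol\eta)+\sum_{i=1}^{N_f-1}(\mathbf t\cdot\boldsymbol\eta,\kappa_i)_{\Gamma_f^{(i)}}$. (a) If $(\tilde w_X,\boldsymbol\gamma_X,\mathbf q_X)$ is the solution of (M) and $\tilde z_X\in\tilde{\mathbb W}_\Gamma$ satisfies (i), then there exists a unique $(r_X,\vec\kappa)\in\mathrm{curl}\,\mathbb G_\Gamma\times\mathbb R^{N_f-1}$ such that (ii) and (iii) hold, and $\tilde w_X$ satisfies (iv). (b) Conversely, for all $F_1\in\mathbb G_\Gamma^*$ and $F_2\in\tilde{\mathbb W}_\Gamma^*$, the problem of finding $(\tilde z_X,\boldsymbol\gamma_X,r_X,\vec\kappa,\tilde w_X)\in\tilde{\mathbb W}_\Gamma\times\mathbb G_\Gamma\times\mathrm{curl}\,\mathbb G_\Gamma\times\mathbb R^{N_f-1}\times\tilde{\mathbb W}_\Gamma$ such that (i)–(iv) hold is uniquely solvable. Moreover, there exists a unique $$\boldsymbol\zeta_X\in(\nabla\tilde{\mathbb W}_\Gamma)^\perp:=\{\boldsymbol\phi\in\operatorname{Im}\boldsymbol\Xi_X:(\boldsymbol\phi,\nabla\tilde v)_{\mathrm{curl}}=0\ \forall\tilde v\in\tilde{\mathbb W}_\Gamma\}$$ such that $(\boldsymbol\zeta_X,\boldsymbol\eta)_{\mathrm{curl}}=-\tilde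 b(\boldsymbol\eta;r_X,\vec\kappa)$ for all $\boldsymbol\eta\in\mathbb Q_\Gamma$, and the triple $(\tilde w_X,\boldsymbol\gamma_X,\boldsymbol\zeta_X+\nabla\tilde z_X)$ is the unique solution of (M).
   Context: $\Omega\subset\mathbb R^2$ is a connected Lipschitz polygon $\Omega=\Omega_0\setminus\bigcup_{j=1}^{N_H}\bar\Omega_j$ with $\Omega_0,\dots,\Omega_{N_H}$ simply connected Lipschitz polygons, $\bar\Omega_j\subsetneq\Omega_0$ for $1\le j\le N_H$, $\bar\Omega_i\cap\bar\Omega_j=\emptyset$ for $1\le i\ne j\le N_H$. Its boundary $\Gamma$ is partitioned into disjoint sets $\Gamma_c,\Gamma_s,\Gamma_f$; $\Gamma_{cs}=\Gamma_c\cup\Gamma_s$; $\{\Gamma_f^{(i)}\}_{i=1}^{N_f}$ are the $N_f$ connected components of $\Gamma_f$ ($\mathbb R^{N_f-1}$ is trivial if $N_f\le1$); $\mathbf n$ and $\mathbf t$ are the unit normal and unit tangent. $(\cdot,\cdot)$ is the $L^2(\Omega)$ inner product, $(\cdot,\cdot)_{\Gamma_f^{(i)}}$ the $L^2(\Gamma_f^{(i)})$ inner product, understood as a duality pairing for tangential traces of $\mathbf H(\mathrm{curl})$ fields: for $\boldsymbol\eta\in\operatorname{Im}\boldsymbol\Xi_X$, $(\mathbf t\cdot\boldsymbol\eta,1)_{\Gamma_f^{(i)}}=\langle\mathbf t\cdot\boldsymbol\eta,\chi_i\rangle_\Gamma$ for any $\chi_i\in H^1(\Omega)$ with trace $1$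 on $\Gamma_f^{(i)}$ and $0$ on the other components of $\Gamma_f$. $\mathrm{curl}\,\boldsymbol\theta=\partial_x\theta_2-\partial_y\theta_1$, $(\boldsymbol\theta,\boldsymbol\eta)_{\mathrm{curl}}=(\boldsymbol\theta,\boldsymbol\eta)+(\mathrm{curl}\,\boldsymbol\theta,\mathrm{curl}\,\boldsymbol\eta)$. $\|\cdot\|_k$ is the $H^k(\Omega)$ norm (sum of component norms for vector fields). $H^2_\Gamma(\Omega)=\{v\in H^2(\Omega): v|_{\Gamma_{cs}}=0,\ \partial_n v|_{\Gamma_c}=0\}$; $H^1_\Gamma(\Omega)=\{v\in H^1(\Omega):v|_{\Gamma_{cs}}=0\}$; $\mathbf G_\Gamma(\Omega)=\{\boldsymbol\psi\in H^1(\Omega)^2:\boldsymbol\psi|_{\Gamma_c}=\mathbf 0,\ \boldsymbol\pi_T\boldsymbol\psi|_{\Gamma_s}=\mathbf 0\}$, $\boldsymbol\pi_T\boldsymbol\psi=\boldsymbol\psi-(\boldsymbol\psi\cdot\mathbf n)\mathbf n$. $B$ is a bilinear form on $H^2(\Omega)$ with $|B(u,v)|\le M_B\|u\|_2\|v\|_2$, $\inf_{0\ne u\in H^2_\Gamma(\Omega)}\sup_{0\ne v\in H^2_\Gamma(\Omega)}\frac{B(u,v)}{\|u\|_2\|v\|_2}\ge\alpha>0$, and $\sup_{u\in H^2_\Gamma(\Omega)}B(u,v)>0$ for every $0\ne v\in H^2_\Gamma(\Omega)$. Since $c\equiv0$, $B(w,v)=a(\nabla w,\nabla v)$ for all $w,v\in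 H^2(\Omega)$, where $a$ is a bilinear form on $H^1(\Omega)^2$ with $|a(\boldsymbol\theta,\boldsymbol\psi)|\le M\|\boldsymbol\theta\|_1\|\boldsymbol\psi\|_1$ for some $M>0$. *)

theory Defs
  imports "HOL-Analysis.Analysis" "HOL-Library.FuncSet"
begin

section \<open>Measurable functions on the plane modulo null sets\<close>

text \<open>
  Elements of Lebesgue and Sobolev spaces are classes of almost everywhere equal functions, so that
  equality (and hence uniqueness, linear independence, and so on) has its usual meaning. A class of
  functions on a domain \<open>\<Omega>\<close> is represented by its extension by zero to the whole plane; the domain is
  therefore not part of the type, and every space below is a subspace of one real vector space.
\<close>

definition ae_rel :: "(real^2 \<Rightarrow> real) \<Rightarrow> (real^2 \<Rightarrow> real) \<Rightarrow> bool" where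
  "ae_rel f g \<longleftrightarrow> f \<in> borel_measurable lborel \<and> g \<in> borel_measurable lborel \<and> (AE x in lborel. f x = g x)"

lemma ae_rel_part_equivp: "part_equivp ae_rel"
proof (rule part_equivpI)
  show "\<exists>x. ae_rel x x"
    by (rule exI[of _ "\<lambda>_. 0"]) (simp add: ae_rel_def)
  show "symp ae_rel"
    by (rule sympI) (auto simp: ae_rel_def elim: AE_mp)
  show "transp ae_rel"
    by (rule transpI) (auto simp: ae_rel_def elim: AE_mp)
qed

quotient_type ae_fun = "real^2 \<Rightarrow> real" / partial: ae_rel
  morphisms rep_ae_fun ae_class
  by (rule ae_rel_part_equivp)

instantiation ae_fun :: real_vector
begin

lift_definition zero_ae_fun :: ae_fun is "\<lambda>_. 0"
  by (simp add: ae_rel_def)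

lift_definition plus_ae_fun :: "ae_fun \<Rightarrow> ae_fun \<Rightarrow> ae_fun" is "\<lambda>f g x. f x + g x"
  unfolding ae_rel_def by (auto elim: AE_mp)

lift_definition minus_ae_fun :: "ae_fun \<Rightarrow> ae_fun \<Rightarrow> ae_fun" is "\<lambda>f g x. f x - g x"
  unfolding ae_rel_def by (auto elim: AE_mp)

lift_definition uminus_ae_fun :: "ae_fun \<Rightarrow> ae_fun" is "\<lambda>f x. - f x"
  unfolding ae_rel_def by auto

lift_definition scaleR_ae_fun :: "real \<Rightarrow> ae_fun \<Rightarrow> ae_fun" is "\<lambda>c f x. c * f x"
  unfolding ae_rel_def by (auto elim: AE_mp)

instance
  by standard (transfer; auto simp: ae_rel_def algebra_simps)+

end

lift_definition square_integrable :: "ae_fun \<Rightarrow> bool" is "\<lambda>f. integrable lborel (\<lambda>x. (f x)\<^sup>2)"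
  unfolding ae_rel_def by (intro integrable_cong_AE) auto

lift_definition vanishes_off :: "(real^2) set \<Rightarrow> ae_fun \<Rightarrow> bool" is
  "\<lambda>\<Omega> f. AE x in lborel. x \<notin> \<Omega> \<longrightarrow> f x = 0"
  unfolding ae_rel_def
  by (elim conjE, rule eventually_subst) (auto elim: AE_mp)

text \<open>As members of \<open>L2 \<Omega>\<close> vanish off \<open>\<Omega>\<close>, the integral over the plane is the one over \<open>\<Omega>\<close>.\<close>

definition L2 :: "(real^2) set \<Rightarrow> ae_fun set" where
  "L2 \<Omega> = {f. square_integrable f \<and> vanishes_off \<Omega> f}"

lift_definition ip :: "ae_fun \<Rightarrow> ae_fun \<Rightarrow> real" is "\<lambda>f g. \<integral>x. f x * g x \<partial>lborel"
  unfolding ae_rel_def by (intro integral_cong_AE) (auto elim: AE_mp)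

type_synonym ae_field = "ae_fun \<times> ae_fun"

definition ip_vec :: "ae_field \<Rightarrow> ae_field \<Rightarrow> real" where
  "ip_vec \<theta> \<eta> = ip (fst \<theta>) (fst \<eta>) + ip (snd \<theta>) (snd \<eta>)"

definition ae_restrict :: "(real^2) set \<Rightarrow> (real^2 \<Rightarrow> real) \<Rightarrow> ae_fun" where
  "ae_restrict \<Omega> u = ae_class (\<lambda>x. indicator \<Omega> x * u x)"


section \<open>Weak derivatives and Sobolev spaces\<close>

definition pderiv_at :: "2 \<Rightarrow> (real^2 \<Rightarrow> real) \<Rightarrow> real^2 \<Rightarrow> real" where
  "pderiv_at i f x = frechet_derivative f (at x) (axis i 1)"

primrec C_k :: "nat \<Rightarrow> (real^2 \<Rightarrow> real) \<Rightarrow> bool" where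
  "C_k 0 f \<longleftrightarrow> continuous_on UNIV f"
| "C_k (Suc k) f \<longleftrightarrow> (\<forall>x. f differentiable (at x)) \<and> (\<forall>i. C_k k (pderiv_at i f))"

definition smooth :: "(real^2 \<Rightarrow> real) \<Rightarrow> bool" where
  "smooth f \<longleftrightarrow> (\<forall>k. C_k k f)"

definition test_functions :: "(real^2) set \<Rightarrow> (real^2 \<Rightarrow> real) set" where
  "test_functions \<Omega> =
     {\<phi>. smooth \<phi> \<and> compact (closure {x. \<phi> x \<noteq> 0}) \<and> closure {x. \<phi> x \<noteq> 0} \<subseteq> \<Omega>}"

definition weak_partial :: "(real^2) set \<Rightarrow> 2 \<Rightarrow> ae_fun \<Rightarrow> ae_fun \<Rightarrow> bool" where
  "weak_partial \<Omega> i f g \<longleftrightarrow>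
     (\<forall>\<phi>\<in>test_functions \<Omega>. ip f (ae_class (pderiv_at i \<phi>)) = - ip g (ae_class \<phi>))"

definition wderiv :: "(real^2) set \<Rightarrow> 2 \<Rightarrow> ae_fun \<Rightarrow> ae_fun" where
  "wderiv \<Omega> i f = (THE g. g \<in> L2 \<Omega> \<and> weak_partial \<Omega> i f g)"

definition grad :: "(real^2) set \<Rightarrow> ae_fun \<Rightarrow> ae_field" where
  "grad \<Omega> v = (wderiv \<Omega> 1 v, wderiv \<Omega> 2 v)"

definition H1 :: "(real^2) set \<Rightarrow> ae_fun set" where
  "H1 \<Omega> = {f \<in> L2 \<Omega>. \<forall>i. \<exists>g\<in>L2 \<Omega>. weak_partial \<Omega> i f g}"

definition H2 :: "(real^2) set \<Rightarrow> ae_fun set" where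
  "H2 \<Omega> = {f \<in> H1 \<Omega>. \<forall>i. wderiv \<Omega> i f \<in> H1 \<Omega>}"

definition norm_H1 :: "(real^2) set \<Rightarrow> ae_fun \<Rightarrow> real" where
  "norm_H1 \<Omega> v = sqrt (ip v v + ip_vec (grad \<Omega> v) (grad \<Omega> v))"

definition norm_H1_vec :: "(real^2) set \<Rightarrow> ae_field \<Rightarrow> real" where
  "norm_H1_vec \<Omega> \<psi> = norm_H1 \<Omega> (fst \<psi>) + norm_H1 \<Omega> (snd \<psi>)"

definition norm_H2 :: "(real^2) set \<Rightarrow> ae_fun \<Rightarrow> real" where
  "norm_H2 \<Omega> v = sqrt (ip v v + ip_vec (grad \<Omega> v) (grad \<Omega> v)
     + (\<Sum>(i, j)\<in>{(1, 1), (1, 2), (2, 2)}.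
          ip (wderiv \<Omega> j (wderiv \<Omega> i v)) (wderiv \<Omega> j (wderiv \<Omega> i v))))"

text \<open>
  The scalar curl is the distributional one, so that it applies to all \<open>H(curl)\<close> fields, in particular
  to gradients of \<open>H1\<close> functions.
\<close>

definition weak_curl :: "(real^2) set \<Rightarrow> ae_field \<Rightarrow> ae_fun \<Rightarrow> bool" where
  "weak_curl \<Omega> \<eta> c \<longleftrightarrow> (\<forall>\<phi>\<in>test_functions \<Omega>.
     ip (snd \<eta>) (ae_class (pderiv_at 1 \<phi>)) - ip (fst \<eta>) (ae_class (pderiv_at 2 \<phi>))
       = - ip c (ae_class \<phi>))"

definition curl :: "(real^2) set \<Rightarrow> ae_field \<Rightarrow> ae_fun" where
  "curl \<Omega> \<eta> = (THE c. c \<in> L2 \<Omega> \<and> weak_curl \<Omega> \<eta> c)"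

definition ip_curl :: "(real^2) set \<Rightarrow> ae_field \<Rightarrow> ae_field \<Rightarrow> real" where
  "ip_curl \<Omega> \<theta> \<eta> = ip_vec \<theta> \<eta> + ip (curl \<Omega> \<theta>) (curl \<Omega> \<eta>)"


section \<open>Polygons\<close>

text \<open>Near every boundary point the domain is, in suitable orthonormal coordinates, a Lipschitz subgraph.\<close>

definition rot90 :: "real^2 \<Rightarrow> real^2" where
  "rot90 d = vector [- (d $ 2), d $ 1]"

definition lipschitz_domain :: "(real^2) set \<Rightarrow> bool" where
  "lipschitz_domain S \<longleftrightarrow> open S \<and> bounded S \<and> S \<noteq> {} \<and>
     (\<forall>x\<in>frontier S. \<exists>U d h L. open U \<and> x \<in> U \<and> norm d = 1 \<and> L-lipschitz_on UNIV h \<and>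
        S \<inter> U = {y \<in> U. y \<bullet> d < h (y \<bullet> rot90 d)})"

definition is_edge_set :: "(real^2) set \<Rightarrow> ((real^2) \<times> (real^2)) set \<Rightarrow> bool" where
  "is_edge_set \<Gamma> E \<longleftrightarrow> finite E \<and> (\<forall>(a, b)\<in>E. a \<noteq> b) \<and>
     pairwise (\<lambda>(a, b) (c, d). open_segment a b \<inter> open_segment c d = {}) E \<and>
     (\<Union>(a, b)\<in>E. closed_segment a b) = \<Gamma>"

definition lipschitz_polygon :: "(real^2) set \<Rightarrow> bool" where
  "lipschitz_polygon S \<longleftrightarrow> lipschitz_domain S \<and> (\<exists>E. is_edge_set (frontier S) E)"

text \<open>Arc length on a finite union of segments; it does not depend on the decomposition into edges.\<close>

definition edges_of :: "(real^2) set \<Rightarrow> ((real^2) \<times> (real^2)) set" where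
  "edges_of \<Gamma> = (SOME E. is_edge_set \<Gamma> E)"

definition arc_length_on :: "(real^2) set \<Rightarrow> (real^2) set \<Rightarrow> ennreal" where
  "arc_length_on \<Gamma> A = (\<Sum>(a, b)\<in>edges_of \<Gamma>.
     ennreal (norm (b - a)) * emeasure lborel {t \<in> {0..1::real}. linepath a b t \<in> A})"

definition arc_measure :: "(real^2) set \<Rightarrow> (real^2) measure" where
  "arc_measure \<Gamma> = measure_of UNIV (sets borel) (arc_length_on \<Gamma>)"

lemma sets_arc_measure [simp, measurable_cong]: "sets (arc_measure \<Gamma>) = sets borel"
  and space_arc_measure [simp]: "space (arc_measure \<Gamma>) = UNIV"
  using sets.sigma_sets_eq[of "borel :: (real^2) measure"]
  by (auto simp: arc_measure_def)

lemma emeasure_arc_measure: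
  assumes "A \<in> sets borel"
  shows "emeasure (arc_measure \<Gamma>) A = arc_length_on \<Gamma> A"
proof -
  have meas: "{t \<in> {0..1::real}. linepath a b t \<in> X} \<in> sets lborel"
    if "X \<in> sets borel" for X and a b :: "real^2"
  proof -
    have "linepath a b \<in> borel_measurable borel"
      unfolding linepath_def by measurable
    from measurable_sets[OF this that] have "linepath a b -` X \<in> sets borel"
      by simp
    then have "{0..1} \<inter> linepath a b -` X \<in> sets borel"
      by (intro sets.Int) auto
    moreover have "{0..1} \<inter> linepath a b -` X = {t \<in> {0..1}. linepath a b t \<in> X}"
      by auto
    ultimately show ?thesis by simp
  qed
  have "countably_additive (sets borel) (arc_length_on \<Gamma>)"
  proof (rule countably_additiveI)
    fix X :: "nat \<Rightarrow> (real^2) set"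
    assume X: "range X \<subseteq> sets borel" "disjoint_family X"
    have one: "(\<Sum>i. emeasure lborel {t \<in> {0..1::real}. linepath a b t \<in> X i}) =
      emeasure lborel {t \<in> {0..1::real}. linepath a b t \<in> (\<Union>i. X i)}" for a b
    proof -
      have "(\<Sum>i. emeasure lborel {t \<in> {0..1::real}. linepath a b t \<in> X i}) =
        emeasure lborel (\<Union>i. {t \<in> {0..1::real}. linepath a b t \<in> X i})"
        using X meas by (intro suminf_emeasure) (auto simp: disjoint_family_on_def)
      also have "(\<Union>i. {t \<in> {0..1::real}. linepath a b t \<in> X i}) =
        {t \<in> {0..1::real}. linepath a b t \<in> (\<Union>i. X i)}"
        by auto
      finally show ?thesis .
    qed
    have "(\<Sum>i. arc_length_on \<Gamma> (X i)) = (\<Sum>e\<in>edges_of \<Gamma>. \<Sum>i. (case e of (a, b) \<Rightarrow>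
      ennreal (norm (b - a)) * emeasure lborel {t \<in> {0..1::real}. linepath a b t \<in> X i}))"
      unfolding arc_length_on_def by (intro suminf_sum) auto
    also have "\<dots> = arc_length_on \<Gamma> (\<Union>i. X i)"
      unfolding arc_length_on_def
      by (intro sum.cong refl) (auto simp: ennreal_suminf_cmult one[simplified])
    finally show "(\<Sum>i. arc_length_on \<Gamma> (X i)) = arc_length_on \<Gamma> (\<Union>i. X i)" .
  qed
  moreover have "positive (sets borel) (arc_length_on \<Gamma>)"
    by (auto simp: positive_def arc_length_on_def intro!: sum.neutral)
  moreover have "sigma_algebra UNIV (sets (borel :: (real^2) measure))"
    using sets.sigma_algebra_axioms[of "borel :: (real^2) measure"] by simp
  ultimately show ?thesis
    unfolding arc_measure_def using assms by (intro emeasure_measure_of_sigma) auto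
qed

text \<open>The outward unit normal is well defined except at the finitely many corners.\<close>

definition unit_normal :: "(real^2) set \<Rightarrow> real^2 \<Rightarrow> real^2" where
  "unit_normal \<Omega> x = (THE n. norm n = 1 \<and>
     (\<exists>r>0. \<Omega> \<inter> ball x r = {y \<in> ball x r. (y - x) \<bullet> n < 0}))"


section \<open>Traces and boundary conditions\<close>

text \<open>
  \<open>has_trace \<Omega> v g\<close>: the boundary function \<open>g\<close> represents the trace of \<open>v\<close>. The relation is the
  closure, in \<open>H1 \<Omega>\<close> times the space of square integrable functions on the boundary, of the graph of
  the restriction map on functions smooth up to the boundary; that is, the trace operator is the
  continuous extension of restriction.
\<close>

definition has_trace :: "(real^2) set \<Rightarrow> ae_fun \<Rightarrow> (real^2 \<Rightarrow> real) \<Rightarrow> bool" where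
  "has_trace \<Omega> v g \<longleftrightarrow> v \<in> H1 \<Omega> \<and> g \<in> borel_measurable borel \<and>
     (\<exists>u :: nat \<Rightarrow> real^2 \<Rightarrow> real. (\<forall>n. smooth (u n)) \<and>
        (\<lambda>n. norm_H1 \<Omega> (ae_restrict \<Omega> (u n) - v)) \<longlonglongrightarrow> 0 \<and>
        (\<lambda>n. \<integral>\<^sup>+x. ennreal ((u n x - g x)\<^sup>2) \<partial>arc_measure (frontier \<Omega>)) \<longlonglongrightarrow> 0)"

definition has_trace_vec :: "(real^2) set \<Rightarrow> ae_field \<Rightarrow> (real^2 \<Rightarrow> real^2) \<Rightarrow> bool" where
  "has_trace_vec \<Omega> \<psi> g \<longleftrightarrow>
     has_trace \<Omega> (fst \<psi>) (\<lambda>x. g x $ 1) \<and> has_trace \<Omega> (snd \<psi>) (\<lambda>x. g x $ 2)"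

definition H1_bc :: "(real^2) set \<Rightarrow> (real^2) set \<Rightarrow> (real^2) set \<Rightarrow> ae_fun set" where
  "H1_bc \<Omega> \<Gamma>c \<Gamma>s = {v \<in> H1 \<Omega>. \<exists>g. has_trace \<Omega> v g \<and>
     (AE x in arc_measure (frontier \<Omega>). x \<in> \<Gamma>c \<union> \<Gamma>s \<longrightarrow> g x = 0)}"

definition H2_bc :: "(real^2) set \<Rightarrow> (real^2) set \<Rightarrow> (real^2) set \<Rightarrow> ae_fun set" where
  "H2_bc \<Omega> \<Gamma>c \<Gamma>s = {v \<in> H2 \<Omega>.
     (\<exists>g. has_trace \<Omega> v g \<and>
       (AE x in arc_measure (frontier \<Omega>). x \<in> \<Gamma>c \<union> \<Gamma>s \<longrightarrow> g x = 0)) \<and>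
     (\<exists>g. has_trace_vec \<Omega> (grad \<Omega> v) g \<and>
       (AE x in arc_measure (frontier \<Omega>). x \<in> \<Gamma>c \<longrightarrow> g x \<bullet> unit_normal \<Omega> x = 0))}"

definition tangential_proj :: "real^2 \<Rightarrow> real^2 \<Rightarrow> real^2" where
  "tangential_proj n p = p - (p \<bullet> n) *\<^sub>R n"

definition G_bc :: "(real^2) set \<Rightarrow> (real^2) set \<Rightarrow> (real^2) set \<Rightarrow> ae_field set" where
  "G_bc \<Omega> \<Gamma>c \<Gamma>s = {\<psi> \<in> H1 \<Omega> \<times> H1 \<Omega>. \<exists>g. has_trace_vec \<Omega> \<psi> g \<and>
     (AE x in arc_measure (frontier \<Omega>).
        (x \<in> \<Gamma>c \<longrightarrow> g x = 0) \<and> (x \<in> \<Gamma>s \<longrightarrow> tangential_proj (unit_normal \<Omega> x) (g x) = 0))}"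

text \<open>
  The duality pairing of the tangential trace of an \<open>H(curl)\<close> field with the trace of an \<open>H1\<close> function,
  defined by Green's formula. It belongs to the counterclockwise tangent, that is
  \<open>t = (- n $ 2, n $ 1)\<close> with the outward normal \<open>n\<close>.
\<close>

definition tangential_pairing :: "(real^2) set \<Rightarrow> ae_field \<Rightarrow> ae_fun \<Rightarrow> real" where
  "tangential_pairing \<Omega> \<eta> \<rho> =
     ip (curl \<Omega> \<eta>) \<rho> + ip (snd \<eta>) (wderiv \<Omega> 1 \<rho>) - ip (fst \<eta>) (wderiv \<Omega> 2 \<rho>)"

text \<open>
  \<open>\<rho>\<close> has trace 1 on the \<open>i\<close>-th set and 0 on the others. The \<open>L2\<close> product of \<open>t \<bullet> \<eta>\<close> with the constant 1
  on the \<open>i\<close>-th component of the free boundary is \<open>tangential_pairing \<Omega> \<eta> \<rho>\<close> for any such \<open>\<rho>\<close>.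
\<close>

definition component_cutoff ::
    "(real^2) set \<Rightarrow> nat \<Rightarrow> (nat \<Rightarrow> (real^2) set) \<Rightarrow> nat \<Rightarrow> ae_fun \<Rightarrow> bool" where
  "component_cutoff \<Omega> N \<Gamma>f i \<rho> \<longleftrightarrow> \<rho> \<in> H1 \<Omega> \<and> (\<exists>g. has_trace \<Omega> \<rho> g \<and>
     (AE x in arc_measure (frontier \<Omega>).
        (x \<in> \<Gamma>f i \<longrightarrow> g x = 1) \<and> (\<forall>j\<in>{1..N} - {i}. x \<in> \<Gamma>f j \<longrightarrow> g x = 0)))"


section \<open>Forms and variational problems\<close>

definition fin_dim_subspace :: "'a::real_vector set \<Rightarrow> bool" where
  "fin_dim_subspace V \<longleftrightarrow> (\<exists>S. finite S \<and> V = span S)"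

text \<open>For a finite-dimensional \<open>V\<close> this is the dual space; values outside \<open>V\<close> are irrelevant.\<close>

definition linear_functionals :: "'a::real_vector set \<Rightarrow> ('a \<Rightarrow> real) set" where
  "linear_functionals V = {F. (\<forall>u\<in>V. \<forall>v\<in>V. F (u + v) = F u + F v) \<and>
     (\<forall>c. \<forall>u\<in>V. F (c *\<^sub>R u) = c * F u)}"

definition bilinear_form_on :: "'a::real_vector set \<Rightarrow> ('a \<Rightarrow> 'a \<Rightarrow> real) \<Rightarrow> bool" where
  "bilinear_form_on V B \<longleftrightarrow>
     (\<forall>u\<in>V. B u \<in> linear_functionals V \<and> (\<lambda>w. B w u) \<in> linear_functionals V)"

definition inf_sup :: "'a::real_vector set \<Rightarrow> ('a \<Rightarrow> real) \<Rightarrow> ('a \<Rightarrow> 'a \<Rightarrow> real) \<Rightarrow> ereal" where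
  "inf_sup V nrm B = (INF u\<in>V - {0}. SUP v\<in>V - {0}. ereal (B u v / (nrm u * nrm v)))"

definition Xi :: "(real^2) set \<Rightarrow> ae_fun \<Rightarrow> ae_field \<Rightarrow> ae_field" where
  "Xi \<Omega> v \<psi> = grad \<Omega> v - \<psi>"

definition mixed_solution ::
    "(real^2) set \<Rightarrow> (ae_field \<Rightarrow> ae_field \<Rightarrow> real) \<Rightarrow> ae_fun set \<Rightarrow> ae_field set \<Rightarrow> ae_field set \<Rightarrow>
     (ae_field \<Rightarrow> real) \<Rightarrow> (ae_fun \<Rightarrow> real) \<Rightarrow> ae_fun \<times> ae_field \<times> ae_field \<Rightarrow> bool" where
  "mixed_solution \<Omega> a W G Q F1 F2 = (\<lambda>(w, \<gamma>, q). w \<in> W \<and> \<gamma> \<in> G \<and> q \<in> Q \<and>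
     (\<forall>v\<in>W. \<forall>\<psi>\<in>G. a \<gamma> \<psi> + ip_curl \<Omega> (Xi \<Omega> v \<psi>) q = F1 \<psi> + F2 v) \<and>
     (\<forall>\<eta>\<in>Q. ip_curl \<Omega> (Xi \<Omega> w \<gamma>) \<eta> = 0))"

text \<open>Vectors in the space of dimension \<open>N - 1\<close> are extensional functions on \<open>{1..N - 1}\<close>.\<close>

definition vecs :: "nat \<Rightarrow> (nat \<Rightarrow> real) set" where
  "vecs N = {1..N - 1} \<rightarrow>\<^sub>E UNIV"

definition b_tilde ::
    "(real^2) set \<Rightarrow> nat \<Rightarrow> (nat \<Rightarrow> ae_fun) \<Rightarrow> ae_field \<Rightarrow> ae_fun \<Rightarrow> (nat \<Rightarrow> real) \<Rightarrow> real" where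
  "b_tilde \<Omega> N \<rho> \<eta> r \<kappa> =
     ip r (curl \<Omega> \<eta>) + (\<Sum>i=1..N - 1. \<kappa> i * tangential_pairing \<Omega> \<eta> (\<rho> i))"

definition eq_i :: "(real^2) set \<Rightarrow> ae_fun set \<Rightarrow> (ae_fun \<Rightarrow> real) \<Rightarrow> ae_fun \<Rightarrow> bool" where
  "eq_i \<Omega> W F2 z \<longleftrightarrow> (\<forall>v\<in>W. ip_vec (grad \<Omega> z) (grad \<Omega> v) = F2 v)"

definition eq_ii ::
    "(real^2) set \<Rightarrow> nat \<Rightarrow> (nat \<Rightarrow> ae_fun) \<Rightarrow> (ae_field \<Rightarrow> ae_field \<Rightarrow> real) \<Rightarrow> ae_field set \<Rightarrow>
     (ae_field \<Rightarrow> real) \<Rightarrow> ae_fun \<Rightarrow> ae_field \<Rightarrow> ae_fun \<Rightarrow> (nat \<Rightarrow> real) \<Rightarrow> bool" where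
  "eq_ii \<Omega> N \<rho> a G F1 z \<gamma> r \<kappa> \<longleftrightarrow>
     (\<forall>\<psi>\<in>G. a \<gamma> \<psi> + b_tilde \<Omega> N \<rho> \<psi> r \<kappa> = ip_vec (grad \<Omega> z) \<psi> + F1 \<psi>)"

definition eq_iii ::
    "(real^2) set \<Rightarrow> nat \<Rightarrow> (nat \<Rightarrow> ae_fun) \<Rightarrow> ae_field set \<Rightarrow> ae_field \<Rightarrow> bool" where
  "eq_iii \<Omega> N \<rho> G \<gamma> \<longleftrightarrow> (\<forall>s\<in>curl \<Omega> ` G. \<forall>\<mu>\<in>vecs N. b_tilde \<Omega> N \<rho> \<gamma> s \<mu> = 0)"

definition eq_iv :: "(real^2) set \<Rightarrow> ae_fun set \<Rightarrow> ae_field \<Rightarrow> ae_fun \<Rightarrow> bool" where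
  "eq_iv \<Omega> W \<gamma> w \<longleftrightarrow> (\<forall>u\<in>W. ip_vec (grad \<Omega> w) (grad \<Omega> u) = ip_vec \<gamma> (grad \<Omega> u))"

definition decoupled_solution ::
    "(real^2) set \<Rightarrow> nat \<Rightarrow> (nat \<Rightarrow> ae_fun) \<Rightarrow> (ae_field \<Rightarrow> ae_field \<Rightarrow> real) \<Rightarrow>
     ae_fun set \<Rightarrow> ae_field set \<Rightarrow> (ae_field \<Rightarrow> real) \<Rightarrow> (ae_fun \<Rightarrow> real) \<Rightarrow>
     ae_fun \<times> ae_field \<times> ae_fun \<times> (nat \<Rightarrow> real) \<times> ae_fun \<Rightarrow> bool" where
  "decoupled_solution \<Omega> N \<rho> a W G F1 F2 = (\<lambda>(z, \<gamma>, r, \<kappa>, w).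
     z \<in> W \<and> \<gamma> \<in> G \<and> r \<in> curl \<Omega> ` G \<and> \<kappa> \<in> vecs N \<and> w \<in> W \<and>
     eq_i \<Omega> W F2 z \<and> eq_ii \<Omega> N \<rho> a G F1 z \<gamma> r \<kappa> \<and> eq_iii \<Omega> N \<rho> G \<gamma> \<and> eq_iv \<Omega> W \<gamma> w)"

definition grad_perp :: "(real^2) set \<Rightarrow> ae_fun set \<Rightarrow> ae_field set \<Rightarrow> ae_field set" where
  "grad_perp \<Omega> W Q = {\<phi>\<in>Q. \<forall>v\<in>W. ip_curl \<Omega> \<phi> (grad \<Omega> v) = 0}"

end

theory Submission
  imports Defs
begin

text \<open>
  For a solution of the mixed problem, testing the constraint with \<open>Xi w \<gamma>\<close> itself gives \<open>\<gamma> = \<nabla> w\<close>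
  with \<open>w \<in> W_\<Gamma>\<close>, and testing the first equation with \<open>(v, \<nabla> v)\<close> leaves \<open>B w v\<close> on the left, so the
  discrete inf-sup condition determines \<open>w\<close>. Equation (iii) says by (B2) that \<open>\<gamma> \<in> \<nabla> W_\<Gamma>\<close>, which leads to
  the same problem for \<open>w\<close>. What remains of (ii) is a functional on \<open>G_\<Gamma>\<close> that vanishes on \<open>\<nabla> W_\<Gamma>\<close>: by (B1)
  its values on curl-free fields are matched by \<open>\<kappa>\<close>, and the rest factors through the curl and is represented
  by \<open>r\<close>. Riesz representation in the image of \<open>Xi\<close> turns \<open>(r, \<kappa>)\<close> into \<open>\<zeta>\<close>.

  That \<open>\<zeta>\<close> is orthogonal to gradients needs \<open>(t \<bullet> \<nabla> v, 1) = 0\<close> on the components of the free boundary for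
  \<open>v \<in> H1\<close> vanishing on the rest of the boundary, that is \<open>\<integral> \<nabla> v \<times> \<nabla> \<rho> = 0\<close> for the cutoffs \<open>\<rho>\<close>. At every
  boundary point \<open>v = 0\<close> or \<open>\<rho> \<in> {0, 1}\<close>, so \<open>sin (s v) (1 - cos (2 \<pi> m \<rho>))\<close> has zero trace and the integral
  of the cross product of its gradient with \<open>\<nabla> \<rho>\<close> vanishes. Dividing by \<open>s\<close> and letting \<open>s\<close> tend to \<open>0\<close> gives
  \<open>\<integral> \<nabla> v \<times> \<nabla> \<rho> = \<integral> cos (2 \<pi> m \<rho>) \<nabla> v \<times> \<nabla> \<rho>\<close> for all \<open>m\<close>. Averaging over \<open>m\<close> concentrates the right-hand
  side on the set where \<open>\<rho>\<close> is an integer, and there \<open>\<nabla> \<rho> = 0\<close> almost everywhere.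
\<close>

section \<open>Finite-dimensional variational problems\<close>

text \<open>Traces are known only as limits in the square mean on the boundary, so every identity is
  proved for smooth approximants, whose boundary values vanish only in the limit. An estimate of
  integrals of derivatives by the boundary integral of the absolute value therefore does the work of
  Green's formula. Three requirements shape the auxiliary function. The gradient of a product of
  \<open>v\<close> with a function of \<open>\<rho>\<close> contains \<open>v\<close> times the
  gradient of \<open>\<rho>\<close>, which need not be square integrable; \<open>sin (s v)\<close>
  is bounded and behaves like \<open>s v\<close> for small \<open>s\<close>. The factor in
  \<open>\<rho>\<close> has to vanish at both 0 and 1, so that all components of the free boundary
  are treated at once. The part of the gradient parallel to that of \<open>\<rho>\<close> has to
  drop out, which the cross product achieves. The algebra is collected in a locale that receives two
  facts from the analysis: a gradient determines its function in the discrete space, and the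
  tangential pairings of gradients vanish.\<close>

lemma subspace_if_fin_dim: "fin_dim_subspace V \<Longrightarrow> subspace V"
  by (auto simp: fin_dim_subspace_def)

lemma fin_dim_subspace_mono:
  assumes "fin_dim_subspace V" "subspace U" "U \<subseteq> V"
  shows "fin_dim_subspace U"
proof -
  from assms(1) obtain S where S: "finite S" "V = span S"
    by (auto simp: fin_dim_subspace_def)
  obtain T where T: "T \<subseteq> U" "independent T" "U \<subseteq> span T"
    using maximal_independent_subset by blast
  have "finite T"
    using independent_span_bound[OF S(1) T(2)] T(1) assms(3) S(2) by auto
  moreover have "U = span T"
    using T assms(2) span_minimal by blast
  ultimately show ?thesis
    by (auto simp: fin_dim_subspace_def)
qed

text \<open>\<open>curl\<close> and \<open>grad\<close> are linear only where the weak derivatives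
  exist, so \<open>f\<close> is assumed linear on \<open>V\<close> alone. It agrees on
  \<open>V\<close> with the globally linear extension of its values on a basis, and that extension
  maps spans to spans.\<close>

lemma fin_dim_subspace_image:
  assumes "fin_dim_subspace V"
    and add: "\<And>u v. u \<in> V \<Longrightarrow> v \<in> V \<Longrightarrow> f (u + v) = f u + f v"
    and scale: "\<And>c u. u \<in> V \<Longrightarrow> f (c *\<^sub>R u) = c *\<^sub>R f u"
  shows "fin_dim_subspace (f ` V)"
proof -
  from assms(1) obtain S where S: "finite S" "V = span S"
    by (auto simp: fin_dim_subspace_def)
  obtain T where T: "T \<subseteq> V" "independent T" "V \<subseteq> span T"
    using maximal_independent_subset by blast
  have finT: "finite T"
    using independent_span_bound[OF S(1) T(2)] T(1) S(2) by auto
  have VT: "V = span T"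
    using T(1,3) S(2) span_minimal subspace_span by blast
  have "\<exists>g. linear g \<and> (\<forall>x\<in>T. g x = f x)"
    using T(2) by (rule linear_independent_extend)
  then obtain g where g: "linear g" "\<forall>x\<in>T. g x = f x" by blast
  have "v \<in> span T \<and> g v = f v" if "v \<in> span T" for v
    using that
  proof (induction rule: span_induct_alt)
    case base
    have "f 0 = 0" using scale[of 0 0] VT span_zero by force
    then show ?case using g(1) by (simp add: linear_0 span_zero)
  next
    case (step c x y)
    then have "x \<in> V" "y \<in> V" "c *\<^sub>R x \<in> V" "c *\<^sub>R x + y \<in> span T"
      using T(1) VT by (auto intro: span_scale span_add span_base)
    then show ?case
      using step g by (simp add: linear_add linear_scale add scale)
  qed
  then have "f ` V = g ` span T" using VT by (auto intro!: image_cong)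
  also have "\<dots> = span (g ` T)" using g(1) by (simp add: linear_span_image)
  finally show ?thesis using finT by (auto simp: fin_dim_subspace_def)
qed

lemma linear_functionalsD:
  assumes "F \<in> linear_functionals V"
  shows "\<And>u v. u \<in> V \<Longrightarrow> v \<in> V \<Longrightarrow> F (u + v) = F u + F v"
    and "\<And>c u. u \<in> V \<Longrightarrow> F (c *\<^sub>R u) = c * F u"
  using assms by (auto simp: linear_functionals_def)

lemma linear_functional_diff:
  assumes "F \<in> linear_functionals V" "subspace V" "u \<in> V" "v \<in> V"
  shows "F (u - v) = F u - F v"
proof -
  have "F (u + (-1) *\<^sub>R v) = F u + F ((-1) *\<^sub>R v)"
    using assms by (intro linear_functionalsD(1)[of F V]) (auto intro: subspace_scale subspace_neg)
  then show ?thesis using linear_functionalsD(2)[OF assms(1,4), of "-1"] by simp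
qed

lemma linear_functional_eq_on_span:
  assumes "F \<in> linear_functionals (span S)" "F' \<in> linear_functionals (span S)"
    "\<And>s. s \<in> S \<Longrightarrow> F s = F' s" "v \<in> span S"
  shows "F v = F' v"
proof -
  have "v \<in> span S \<and> F v = F' v"
    using assms(4)
  proof (induction rule: span_induct_alt)
    case base
    show ?case
      using linear_functionalsD(2)[OF assms(1), of 0 0] linear_functionalsD(2)[OF assms(2), of 0 0]
      by (simp add: span_zero)
  next
    case (step c x y)
    then show ?case
      using assms(1-3) by (simp add: linear_functionalsD span_base span_scale span_add)
  qed
  then show ?thesis ..
qed

text \<open>Rank-nullity by counting: injectivity keeps the image of the basis independent, and an
  element of \<open>span S\<close> outside the span of that image would give more than
  \<open>card S\<close> independent vectors in \<open>span S\<close>.\<close>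

lemma injective_endomorphism_span:
  assumes "finite S" "independent S" "linear T" "T ` span S \<subseteq> span S"
    "\<And>u. u \<in> span S \<Longrightarrow> T u = 0 \<Longrightarrow> u = 0"
  shows "T ` span S = span S"
proof -
  have inj: "inj_on T (span S)"
    using assms(5) by (intro inj_onI) (metis assms(3) linear_diff right_minus_eq span_diff)
  then have ind: "independent (T ` S)"
    using assms(2,3) by (simp add: linear_independent_injective_image)
  have card: "card (T ` S) = card S"
    using inj by (intro card_image) (meson inj_on_subset span_superset)
  have "span S \<subseteq> span (T ` S)"
  proof
    fix v assume v: "v \<in> span S"
    show "v \<in> span (T ` S)"
    proof (rule ccontr)
      assume n: "v \<notin> span (T ` S)"
      then have "independent (insert v (T ` S))"
        using ind by (simp add: independent_insertI)
      moreover have "insert v (T ` S) \<subseteq> span S"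
        using v assms(4) span_superset by blast
      ultimately have "card (insert v (T ` S)) \<le> card S"
        using independent_span_bound[OF assms(1)] by blast
      moreover have "v \<notin> T ` S" using n span_base[of v "T ` S"] by blast
      ultimately show False using card assms(1) by simp
    qed
  qed
  moreover have "span (T ` S) = T ` span S"
    using assms(3) by (simp add: linear_span_image)
  ultimately show ?thesis using assms(4) by blast
qed

text \<open>The common solvability principle for the discrete problems below: for a square system a
  trivial kernel on one side already gives existence and uniqueness. For an inner product it is
  Riesz representation; for a form with an inf-sup condition it is the discrete Babuska
  theorem.\<close>

lemma nondegenerate_form_solvable:
  assumes V: "fin_dim_subspace V" and B: "bilinear_form_on V B"
    and nd: "\<And>u. u \<in> V \<Longrightarrow> (\<And>v. v \<in> V \<Longrightarrow> B u v = 0) \<Longrightarrow> u = 0"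
    and F: "F \<in> linear_functionals V"
  shows "\<exists>!u. u \<in> V \<and> (\<forall>v\<in>V. B u v = F v)"
proof -
  have sub: "subspace V" using V by (rule subspace_if_fin_dim)
  have Bl: "B u \<in> linear_functionals V" "(\<lambda>w. B w u) \<in> linear_functionals V" if "u \<in> V" for u
    using B that by (auto simp: bilinear_form_on_def)
  from V obtain S0 where S0: "finite S0" "V = span S0"
    by (auto simp: fin_dim_subspace_def)
  obtain S where S: "S \<subseteq> V" "independent S" "V \<subseteq> span S"
    using maximal_independent_subset by blast
  have finS: "finite S"
    using independent_span_bound[OF S0(1) S(2)] S(1) S0(2) by auto
  have VS: "V = span S"
    using S(1,3) S0(2) span_minimal subspace_span by blast
  \<comment> \<open>Functionals on \<open>V\<close> are encoded as vectors of \<open>V\<close>: the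
    values on the basis become the coordinates. The form turns into the endomorphism
    \<open>T\<close>, whose kernel is the kernel of the form.\<close>
  have "\<exists>g. linear g \<and> (\<forall>x\<in>S. g x = (\<Sum>s\<in>S. B x s *\<^sub>R s))"
    using S(2) by (rule linear_independent_extend)
  then obtain T where T: "linear T" "\<And>x. x \<in> S \<Longrightarrow> T x = (\<Sum>s\<in>S. B x s *\<^sub>R s)" by blast
  have "u \<in> span S \<and> T u = (\<Sum>s\<in>S. B u s *\<^sub>R s)" if "u \<in> span S" for u
    using that
  proof (induction rule: span_induct_alt)
    case base
    have "B 0 s = 0" if "s \<in> S" for s
      using linear_functionalsD(2)[OF Bl(2), of s 0 0] S(1) VS span_zero that by force
    then show ?case using T(1) by (simp add: linear_0 span_zero)
  next
    case (step c x y)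
    have "B (c *\<^sub>R x + y) s = c * B x s + B y s" if "s \<in> S" for s
    proof -
      have "s \<in> V" "x \<in> V" "c *\<^sub>R x \<in> V" "y \<in> V"
        using S(1) that step VS by (auto intro: span_scale)
      then show ?thesis using linear_functionalsD[OF Bl(2), of s] by simp
    qed
    moreover have "c *\<^sub>R x + y \<in> span S" using step by (auto intro: span_scale span_add span_base)
    ultimately show ?case
      using step T by (simp add: linear_add linear_scale scaleR_sum_right sum.distrib scaleR_add_left)
  qed
  then have Teq: "T u = (\<Sum>s\<in>S. B u s *\<^sub>R s)" if "u \<in> span S" for u
    using that by blast
  have coord: "c s = c' s" if "(\<Sum>s\<in>S. c s *\<^sub>R s) = (\<Sum>s\<in>S. c' s *\<^sub>R s)" "s \<in> S" for c c' s
  proof -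
    have "(\<Sum>s\<in>S. (c s - c' s) *\<^sub>R s) = 0"
      using that by (simp add: scaleR_diff_left sum_subtractf)
    then have "c s - c' s = 0"
      by (rule independentD[OF S(2) finS order_refl _ that(2)])
    then show ?thesis by simp
  qed
  have inj: "u = 0" if u: "u \<in> span S" "T u = 0" for u
  proof (rule nd)
    show uV: "u \<in> V" using u VS by simp
    fix v assume v: "v \<in> V"
    have "B u s = 0" if "s \<in> S" for s
      using coord[of "B u" "\<lambda>_. 0"] Teq[OF u(1)] u(2) that by simp
    then show "B u v = 0"
      using linear_functional_eq_on_span[of "B u" S "\<lambda>_. 0" v] Bl(1)[OF uV] v VS
      by (simp add: linear_functionals_def)
  qed
  have "T ` span S = span S"
  proof (rule injective_endomorphism_span[OF finS S(2) T(1) _ inj])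
    show "T ` span S \<subseteq> span S"
      by (auto simp: Teq intro!: span_sum span_scale intro: span_base)
  qed
  moreover have "(\<Sum>s\<in>S. F s *\<^sub>R s) \<in> span S"
    by (auto intro!: span_sum span_scale intro: span_base)
  ultimately have "(\<Sum>s\<in>S. F s *\<^sub>R s) \<in> T ` span S" by simp
  then obtain u where u: "u \<in> span S" "(\<Sum>s\<in>S. F s *\<^sub>R s) = T u" by (rule imageE)
  have Bs: "B u s = F s" if "s \<in> S" for s
    using coord[OF trans[OF Teq[OF u(1), symmetric] u(2)[symmetric]] that] .
  then have ex: "\<forall>v\<in>V. B u v = F v"
    using linear_functional_eq_on_span[OF Bl(1)[OF u(1)[folded VS], unfolded VS] F[unfolded VS] Bs]
    by (simp add: VS)
  show ?thesis
  proof (rule ex1I[of _ u])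
    show "u \<in> V \<and> (\<forall>v\<in>V. B u v = F v)" using u(1) VS ex by simp
    fix u' assume u': "u' \<in> V \<and> (\<forall>v\<in>V. B u' v = F v)"
    have "u' - u = 0"
    proof (rule nd)
      show "u' - u \<in> V" using u' u(1) VS sub by (simp add: subspace_diff)
      fix v assume v: "v \<in> V"
      then show "B (u' - u) v = 0"
        using linear_functional_diff[OF Bl(2)[OF v] sub, of u' u] u' ex u(1) VS by simp
    qed
    then show "u' = u" by simp
  qed
qed

section \<open>Smooth functions\<close>

lemma continuous_on_C_k: "C_k k f \<Longrightarrow> continuous_on UNIV f"
  by (cases k) (auto intro: continuous_at_imp_continuous_on differentiable_imp_continuous_within)

lemma C_k_Suc_imp: "C_k (Suc k) f \<Longrightarrow> C_k k f"
proof (induction k arbitrary: f)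
  case 0
  then show ?case using continuous_on_C_k[of "Suc 0" f] by simp
next
  case (Suc k)
  have "C_k k (pderiv_at i f)" for i
    using Suc.prems by (intro Suc.IH) auto
  then show ?case using Suc.prems by auto
qed

lemma smooth_C_k: "smooth f \<Longrightarrow> C_k k f"
  by (simp add: smooth_def)

lemma smooth_differentiable: "smooth f \<Longrightarrow> f differentiable (at x)"
  using smooth_C_k[of f "Suc 0"] by simp

lemma smooth_pderiv_at: "smooth f \<Longrightarrow> smooth (pderiv_at i f)"
  unfolding smooth_def by (metis C_k.simps(2))

lemma continuous_on_smooth: "smooth f \<Longrightarrow> continuous_on A f"
  by (meson continuous_on_C_k continuous_on_subset smooth_C_k subset_UNIV)

lemma borel_measurable_smooth [measurable_dest]: "smooth f \<Longrightarrow> f \<in> borel_measurable borel"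
  by (intro borel_measurable_continuous_onI continuous_on_smooth)

lemma pderiv_at_eq: "(f has_derivative D) (at x) \<Longrightarrow> pderiv_at i f x = D (axis i 1)"
  by (metis frechet_derivative_at pderiv_at_def)

lemma has_derivative_frechet:
  "f differentiable (at x) \<Longrightarrow> (f has_derivative frechet_derivative f (at x)) (at x)"
  by (simp add: frechet_derivative_works)

lemma pderiv_at_const [simp]: "pderiv_at i (\<lambda>_. c) = (\<lambda>_. 0)"
  by (rule ext, subst pderiv_at_eq[of _ "\<lambda>_. 0"]) auto

lemma pderiv_at_coord: "pderiv_at i (\<lambda>x. x $ j) = (\<lambda>_. if i = j then 1 else 0)"
proof
  fix x :: "real^2"
  have "((\<lambda>x. x $ j) has_derivative (\<lambda>h. h $ j)) (at x)"
    by (intro bounded_linear_imp_has_derivative bounded_linear_vec_nth)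
  then show "pderiv_at i (\<lambda>x. x $ j) x = (if i = j then 1 else 0)"
    by (simp add: pderiv_at_eq axis_def)
qed

lemma pderiv_at_add:
  assumes "f differentiable (at x)" "g differentiable (at x)"
  shows "pderiv_at i (\<lambda>x. f x + g x) x = pderiv_at i f x + pderiv_at i g x"
  by (subst pderiv_at_eq[OF has_derivative_add[OF assms[THEN has_derivative_frechet]]])
    (simp add: pderiv_at_def)

lemma pderiv_at_mult:
  assumes "f differentiable (at x)" "g differentiable (at x)"
  shows "pderiv_at i (\<lambda>x. f x * g x) x = f x * pderiv_at i g x + pderiv_at i f x * g x"
  by (subst pderiv_at_eq[OF has_derivative_mult[OF assms[THEN has_derivative_frechet]]])
    (simp add: pderiv_at_def)

lemma has_derivative_compose_real:
  assumes "h differentiable (at x)" "(F has_real_derivative d) (at (h x))"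
  shows "((\<lambda>x. F (h x)) has_derivative (\<lambda>v. d * frechet_derivative h (at x) v)) (at x)"
  using has_derivative_compose[OF has_derivative_frechet[OF assms(1)] assms(2)[unfolded has_field_derivative_def]]
  by (simp add: o_def)

lemma pderiv_at_compose_real:
  assumes "h differentiable (at x)" "(F has_real_derivative d) (at (h x))"
  shows "pderiv_at i (\<lambda>x. F (h x)) x = d * pderiv_at i h x"
  by (subst pderiv_at_eq[OF has_derivative_compose_real[OF assms]]) (simp add: pderiv_at_def)

lemma C_k_const: "C_k k (\<lambda>_. c)"
  by (induction k arbitrary: c) auto

lemma C_k_add: "C_k k f \<Longrightarrow> C_k k g \<Longrightarrow> C_k k (\<lambda>x. f x + g x)"
proof (induction k arbitrary: f g)
  case 0
  then show ?case by (auto intro: continuous_intros)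
next
  case (Suc k)
  then have eq: "pderiv_at i (\<lambda>x. f x + g x) = (\<lambda>x. pderiv_at i f x + pderiv_at i g x)" for i
    by (auto intro!: pderiv_at_add)
  from Suc show ?case unfolding C_k.simps(2) eq by auto
qed

lemma C_k_mult: "C_k k f \<Longrightarrow> C_k k g \<Longrightarrow> C_k k (\<lambda>x. f x * g x)"
proof (induction k arbitrary: f g)
  case 0
  then show ?case by (auto intro: continuous_intros)
next
  case (Suc k)
  then have eq: "pderiv_at i (\<lambda>x. f x * g x) =
      (\<lambda>x. f x * pderiv_at i g x + pderiv_at i f x * g x)" for i
    by (auto intro!: pderiv_at_mult)
  have "C_k k f" "C_k k g" using Suc.prems C_k_Suc_imp by blast+
  then have "C_k k (\<lambda>x. f x * pderiv_at i g x + pderiv_at i f x * g x)" for i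
    using Suc.prems by (intro C_k_add Suc.IH) auto
  then show ?case using Suc.prems unfolding C_k.simps(2) eq by auto
qed

text \<open>The outer function comes with all its derivatives as one sequence \<open>F\<close>. The
  chain rule replaces \<open>F n\<close> by \<open>F (Suc n)\<close> while \<open>k\<close> drops,
  which is why the induction leaves \<open>n\<close> arbitrary.\<close>

lemma C_k_compose_real:
  fixes F :: "nat \<Rightarrow> real \<Rightarrow> real"
  assumes F: "\<And>n x. (F n has_real_derivative F (Suc n) x) (at x)"
  shows "C_k k h \<Longrightarrow> C_k k (\<lambda>x. F n (h x))"
proof (induction k arbitrary: n)
  case 0
  have "continuous_on UNIV (F n)"
    using F DERIV_isCont by (blast intro: continuous_at_imp_continuous_on)
  with 0 show ?case
    by (auto intro: continuous_on_compose2)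
next
  case (Suc k)
  then have eq: "pderiv_at i (\<lambda>x. F n (h x)) = (\<lambda>x. F (Suc n) (h x) * pderiv_at i h x)" for i
    by (auto intro!: pderiv_at_compose_real F)
  have "C_k k (\<lambda>x. F (Suc n) (h x))" using Suc C_k_Suc_imp by blast
  then have "C_k k (\<lambda>x. F (Suc n) (h x) * pderiv_at i h x)" for i
    using Suc.prems by (intro C_k_mult) auto
  moreover have "(\<lambda>x. F n (h x)) differentiable (at x)" for x
    using has_derivative_compose_real[OF _ F, of h x n] Suc.prems
    by (auto simp: differentiable_def)
  ultimately show ?case unfolding C_k.simps(2) eq by auto
qed

lemma smooth_compose_real:
  fixes F :: "nat \<Rightarrow> real \<Rightarrow> real"
  assumes "\<And>n x. (F n has_real_derivative F (Suc n) x) (at x)" "smooth h"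
  shows "smooth (\<lambda>x. F n (h x))"
  using C_k_compose_real[of F] assms by (auto simp: smooth_def)

lemma smooth_const: "smooth (\<lambda>_. c)"
  by (simp add: smooth_def C_k_const)

lemma smooth_add: "smooth f \<Longrightarrow> smooth g \<Longrightarrow> smooth (\<lambda>x. f x + g x)"
  by (simp add: smooth_def C_k_add)

lemma smooth_mult: "smooth f \<Longrightarrow> smooth g \<Longrightarrow> smooth (\<lambda>x. f x * g x)"
  by (simp add: smooth_def C_k_mult)

lemma smooth_cmult: "smooth f \<Longrightarrow> smooth (\<lambda>x. c * f x)"
  by (intro smooth_mult smooth_const)

lemma smooth_diff: "smooth f \<Longrightarrow> smooth g \<Longrightarrow> smooth (\<lambda>x. f x - g x)"
  using smooth_add[OF _ smooth_cmult, of f g "-1"] by simp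

lemma smooth_coord: "smooth (\<lambda>x. x $ i)"
  unfolding smooth_def
proof
  fix k show "C_k k (\<lambda>x. x $ i)"
    by (cases k) (auto intro!: continuous_intros bounded_linear_imp_differentiable
        bounded_linear_vec_nth C_k_const simp: pderiv_at_coord)
qed

lemma smooth_exp: "smooth h \<Longrightarrow> smooth (\<lambda>x. exp (h x))"
  by (rule smooth_compose_real[of "\<lambda>_. exp"]) (auto intro: DERIV_exp)

lemma smooth_sin: "smooth h \<Longrightarrow> smooth (\<lambda>x. sin (h x))"
  and smooth_cos: "smooth h \<Longrightarrow> smooth (\<lambda>x. cos (h x))"
proof -
  \<comment> \<open>The derivatives of the sine are its shifts by quarter periods, so
    \<open>n = 0\<close> and \<open>n = 1\<close> give sine and cosine from one sequence.\<close>
  define F where "F = (\<lambda>n x. sin (x + real n * (pi / 2)))"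
  have F: "(F n has_real_derivative F (Suc n) x) (at x)" for n x
  proof -
    have "F (Suc n) x = cos (x + real n * (pi / 2))"
      unfolding F_def by (simp add: algebra_simps add_divide_distrib sin_add)
        (simp add: cos_add algebra_simps)
    then show ?thesis
      unfolding F_def by (auto intro!: derivative_eq_intros)
  qed
  assume "smooth h"
  then have "smooth (\<lambda>x. F n (h x))" for n
    using F by (rule smooth_compose_real[rotated])
  from this[of 0] this[of 1] show "smooth (\<lambda>x. sin (h x))" "smooth (\<lambda>x. cos (h x))"
    by (simp_all add: F_def sin_add)
qed

section \<open>Symmetry of second partial derivatives\<close>

lemma has_derivative_pderiv_line:
  assumes "f differentiable (at (x + t *\<^sub>R axis i 1))"
  shows "((\<lambda>t. f (x + t *\<^sub>R axis i 1)) has_real_derivative pderiv_at i f (x + t *\<^sub>R axis i 1)) (at t)"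
proof -
  let ?D = "frechet_derivative f (at (x + t *\<^sub>R axis i 1))"
  have D: "(f has_derivative ?D) (at (x + t *\<^sub>R axis i 1))"
    using assms by (rule has_derivative_frechet)
  have l: "((\<lambda>t. x + t *\<^sub>R axis i 1) has_derivative (\<lambda>h. h *\<^sub>R axis i 1)) (at t)"
    by (auto intro!: derivative_eq_intros)
  have "((\<lambda>t. f (x + t *\<^sub>R axis i 1)) has_derivative (\<lambda>h. ?D (h *\<^sub>R axis i 1))) (at t)"
    using has_derivative_compose[OF l D] by simp
  moreover have "?D (h *\<^sub>R axis i 1) = pderiv_at i f (x + t *\<^sub>R axis i 1) * h" for h
    using linear_scale[OF has_derivative_linear[OF D], of h] by (simp add: pderiv_at_def)
  ultimately show ?thesis by (simp add: has_field_derivative_def)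
qed

text \<open>The mean value theorem is applied twice, first along \<open>axis i\<close> to the
  increment in direction \<open>j\<close>, then along \<open>axis j\<close> to
  \<open>pderiv_at i f\<close>. The second difference on the left is symmetric in \<open>i\<close>
  and \<open>j\<close>, which is what makes the formula useful.\<close>

lemma second_difference_mean_value:
  assumes f: "smooth f" and h: "0 < h"
  obtains y where "dist y x \<le> 2 * h"
    "f (x + h *\<^sub>R axis i 1 + h *\<^sub>R axis j 1) - f (x + h *\<^sub>R axis i 1) - f (x + h *\<^sub>R axis j 1) + f x
      = h * h * pderiv_at j (pderiv_at i f) y"
proof -
  let ?e = "axis i 1 :: real^2" and ?d = "axis j 1 :: real^2"
  define \<phi> where "\<phi> t = f ((x + h *\<^sub>R ?d) + t *\<^sub>R ?e) - f (x + t *\<^sub>R ?e)" for t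
  have "(\<phi> has_real_derivative
      pderiv_at i f ((x + h *\<^sub>R ?d) + t *\<^sub>R ?e) - pderiv_at i f (x + t *\<^sub>R ?e)) (at t)" for t
    unfolding \<phi>_def
    by (intro DERIV_diff has_derivative_pderiv_line smooth_differentiable f)
  from MVT2[OF h this] obtain \<xi> where \<xi>: "0 < \<xi>" "\<xi> < h"
    "\<phi> h - \<phi> 0 = h * (pderiv_at i f ((x + h *\<^sub>R ?d) + \<xi> *\<^sub>R ?e) - pderiv_at i f (x + \<xi> *\<^sub>R ?e))"
    by auto
  have "((\<lambda>t. pderiv_at i f ((x + \<xi> *\<^sub>R ?e) + t *\<^sub>R ?d)) has_real_derivative
      pderiv_at j (pderiv_at i f) ((x + \<xi> *\<^sub>R ?e) + t *\<^sub>R ?d)) (at t)" for t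
    by (intro has_derivative_pderiv_line smooth_differentiable smooth_pderiv_at f)
  from MVT2[OF h this] obtain \<eta> where \<eta>: "0 < \<eta>" "\<eta> < h"
    "pderiv_at i f ((x + \<xi> *\<^sub>R ?e) + h *\<^sub>R ?d) - pderiv_at i f (x + \<xi> *\<^sub>R ?e)
      = h * pderiv_at j (pderiv_at i f) ((x + \<xi> *\<^sub>R ?e) + \<eta> *\<^sub>R ?d)"
    by auto
  show thesis
  proof (rule that[of "x + \<xi> *\<^sub>R ?e + \<eta> *\<^sub>R ?d"])
    have "norm (\<xi> *\<^sub>R ?e + \<eta> *\<^sub>R ?d) \<le> \<bar>\<xi>\<bar> + \<bar>\<eta>\<bar>"
      by (rule order_trans[OF norm_triangle_ineq]) (simp add: norm_axis_1)
    then show "dist (x + \<xi> *\<^sub>R ?e + \<eta> *\<^sub>R ?d) x \<le> 2 * h"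
      using \<xi> \<eta> by (simp add: dist_norm add.assoc)
    show "f (x + h *\<^sub>R ?e + h *\<^sub>R ?d) - f (x + h *\<^sub>R ?e) - f (x + h *\<^sub>R ?d) + f x
      = h * h * pderiv_at j (pderiv_at i f) (x + \<xi> *\<^sub>R ?e + \<eta> *\<^sub>R ?d)"
      using \<xi>(3) \<eta>(3) by (simp add: \<phi>_def add_ac)
  qed
qed

text \<open>Both orders of differentiation represent the same second difference at points within
  \<open>2 * h\<close> of \<open>x\<close>, and continuity of the second derivatives lets
  \<open>h\<close> tend to 0. The symmetry is behind \<open>curl_grad\<close> and the cancellation
  in \<open>integral_smooth_cross_boundary\<close>.\<close>

lemma pderiv_at_commute:
  assumes f: "smooth f"
  shows "pderiv_at i (pderiv_at j f) = pderiv_at j (pderiv_at i f)"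
proof
  fix x
  let ?A = "pderiv_at i (pderiv_at j f)" and ?B = "pderiv_at j (pderiv_at i f)"
  define h :: "nat \<Rightarrow> real" where "h n = 1 / real (Suc n)" for n
  have hpos: "h n > 0" for n by (simp add: h_def)
  have "\<exists>y z. dist y x \<le> 2 * h n \<and> dist z x \<le> 2 * h n \<and> ?A y = ?B z" for n
  proof -
    obtain y where y: "dist y x \<le> 2 * h n"
      "f (x + h n *\<^sub>R axis j 1 + h n *\<^sub>R axis i 1) - f (x + h n *\<^sub>R axis j 1) - f (x + h n *\<^sub>R axis i 1) + f x
        = h n * h n * ?A y"
      using second_difference_mean_value[OF f hpos] by blast
    obtain z where z: "dist z x \<le> 2 * h n"
      "f (x + h n *\<^sub>R axis i 1 + h n *\<^sub>R axis j 1) - f (x + h n *\<^sub>R axis i 1) - f (x + h n *\<^sub>R axis j 1) + f x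
        = h n * h n * ?B z"
      using second_difference_mean_value[OF f hpos] by blast
    have "h n * h n * ?A y = h n * h n * ?B z"
      using y(2) z(2) by (simp add: algebra_simps)
    then show ?thesis using y(1) z(1) hpos[of n] by auto
  qed
  then obtain y z where yz: "\<And>n. dist (y n) x \<le> 2 * h n" "\<And>n. dist (z n) x \<le> 2 * h n"
    "\<And>n. ?A (y n) = ?B (z n)" by metis
  have h0: "(\<lambda>n. 2 * h n) \<longlonglongrightarrow> 0"
    using tendsto_mult_right_zero[OF LIMSEQ_inverse_real_of_nat, of 2]
    by (simp add: h_def inverse_eq_divide)
  have "y \<longlonglongrightarrow> x"
    using tendsto_0_le[OF h0, of "\<lambda>n. dist (y n) x" 1] yz(1) hpos
    by (auto simp: tendsto_dist_iff[of y x] abs_of_pos intro!: always_eventually)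
  moreover have "z \<longlonglongrightarrow> x"
    using tendsto_0_le[OF h0, of "\<lambda>n. dist (z n) x" 1] yz(2) hpos
    by (auto simp: tendsto_dist_iff[of z x] abs_of_pos intro!: always_eventually)
  moreover have "isCont ?A x" "isCont ?B x"
    using continuous_on_smooth[of ?A UNIV] continuous_on_smooth[of ?B UNIV] f
    by (auto simp: smooth_pderiv_at continuous_on_eq_continuous_at)
  ultimately have "(\<lambda>n. ?A (y n)) \<longlonglongrightarrow> ?A x" "(\<lambda>n. ?B (z n)) \<longlonglongrightarrow> ?B x"
    by (auto intro: isCont_tendsto_compose)
  then show "?A x = ?B x"
    using yz(3) LIMSEQ_unique by fastforce
qed

section \<open>Flat functions and bump functions\<close>

definition flat_exp :: "real poly \<Rightarrow> real \<Rightarrow> real" where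
  "flat_exp P x = (if x > 0 then poly P (1 / x) * exp (- (1 / x)) else 0)"

lemma poly_times_exp_tendsto_0: "((\<lambda>t::real. poly P t * exp (- t)) \<longlongrightarrow> 0) at_top"
proof -
  have "((\<lambda>t::real. \<Sum>i\<le>degree P. coeff P i * (t ^ i / exp t)) \<longlongrightarrow> (\<Sum>i\<le>degree P. coeff P i * 0)) at_top"
    by (intro tendsto_sum tendsto_mult tendsto_const tendsto_power_div_exp_0)
  moreover have "poly P t * exp (- t) = (\<Sum>i\<le>degree P. coeff P i * (t ^ i / exp t))" for t :: real
    by (simp add: poly_altdef exp_minus field_simps sum_distrib_left sum_divide_distrib)
  ultimately show ?thesis by simp
qed

text \<open>The family \<open>flat_exp\<close> is closed under differentiation: for
  \<open>x > 0\<close> and \<open>t = 1 / x\<close> the derivative of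
  \<open>poly P t * exp (- t)\<close> in \<open>x\<close> is
  \<open>t ^ 2 * poly (P - pderiv P) t * exp (- t)\<close>, and \<open>[:0, 0, 1:]\<close> is the
  square of \<open>t\<close> as a polynomial. Iterating from \<open>P = 1\<close> lists all
  derivatives of the standard flat function.\<close>

lemma flat_exp_deriv:
  "(flat_exp P has_real_derivative flat_exp ([:0, 0, 1:] * (P - pderiv P)) x) (at x)"
proof -
  let ?Q = "[:0, 0, 1:] * (P - pderiv P)"
  consider "x < 0" | "x = 0" | "x > 0" by linarith
  then show ?thesis
  proof cases
    case 1
    have "((\<lambda>_. 0) has_real_derivative 0) (at x)" by simp
    then have "(flat_exp P has_real_derivative 0) (at x)"
      by (rule has_field_derivative_transform_within_open[of _ _ _ "{..<0}"])
        (use 1 in \<open>auto simp: flat_exp_def\<close>)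
    then show ?thesis using 1 by (simp add: flat_exp_def)
  next
    case 3
    have "((\<lambda>x. poly P (1 / x) * exp (- (1 / x))) has_real_derivative flat_exp ?Q x) (at x)"
      using 3 by (auto intro!: derivative_eq_intros DERIV_chain'[OF _ poly_DERIV]
          simp: flat_exp_def field_simps power2_eq_square)
    then show ?thesis
      by (rule has_field_derivative_transform_within_open[of _ _ _ "{0<..}"])
        (use 3 in \<open>auto simp: flat_exp_def\<close>)
  next
    case 2
    have "((\<lambda>y. (flat_exp P (0 + y) - flat_exp P 0) / y) \<longlongrightarrow> 0) (at 0)"
    proof (rule filterlim_split_at)
      have "eventually (\<lambda>y. (flat_exp P (0 + y) - flat_exp P 0) / y = 0) (at_left 0)"
        by (auto simp: eventually_at_filter flat_exp_def)
      then show "((\<lambda>y. (flat_exp P (0 + y) - flat_exp P 0) / y) \<longlongrightarrow> 0) (at_left 0)"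
        by (rule tendsto_eventually)
      \<comment> \<open>With \<open>t = 1 / y\<close> the difference quotient at 0 is
        \<open>t * poly P t * exp (- t)\<close>, and \<open>t\<close> tends to infinity. The factor
        \<open>[:0, 1:]\<close> accounts for the division by \<open>y\<close>.\<close>
      have "((\<lambda>y::real. poly ([:0, 1:] * P) (inverse y) * exp (- inverse y)) \<longlongrightarrow> 0) (at_right 0)"
        using filterlim_compose[OF poly_times_exp_tendsto_0 filterlim_inverse_at_top_right] .
      moreover have "eventually (\<lambda>y. poly ([:0, 1:] * P) (inverse y) * exp (- inverse y)
          = (flat_exp P (0 + y) - flat_exp P 0) / y) (at_right 0)"
        by (auto simp: eventually_at_filter flat_exp_def inverse_eq_divide)
      ultimately show "((\<lambda>y. (flat_exp P (0 + y) - flat_exp P 0) / y) \<longlongrightarrow> 0) (at_right 0)"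
        by (rule Lim_transform_eventually)
    qed
    then show ?thesis using 2 by (simp add: DERIV_def flat_exp_def)
  qed
qed

lemma smooth_flat_exp: "smooth h \<Longrightarrow> smooth (\<lambda>x. flat_exp 1 (h x))"
  using smooth_compose_real[of "\<lambda>n. flat_exp (((\<lambda>P. [:0, 0, 1:] * (P - pderiv P)) ^^ n) 1)" h 0]
  by (simp add: flat_exp_deriv del: mult_pCons_left)

lemma flat_exp_1_pos_iff: "flat_exp 1 x > 0 \<longleftrightarrow> x > 0" and flat_exp_1_nonneg: "flat_exp 1 x \<ge> 0"
  by (auto simp: flat_exp_def)

text \<open>\<open>g\<close> multiplies one flat factor for each side of the box, hence is smooth
  and positive exactly inside. The functions \<open>1 - exp (- n g)\<close> are nonzero at the same
  points and increase to 1 where \<open>g\<close> is positive; their supports stay in the closed box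
  and so are compact subsets of \<open>\<Omega>\<close>.\<close>

lemma test_functions_approximate_box:
  fixes a b :: "real^2"
  assumes "cbox a b \<subseteq> \<Omega>"
  obtains \<phi> where "\<And>n. \<phi> n \<in> test_functions \<Omega>" "\<And>n x. 0 \<le> \<phi> n x" "\<And>n x. \<phi> n x \<le> indicator (box a b) x"
    "\<And>x. (\<lambda>n. \<phi> n x) \<longlonglongrightarrow> indicator (box a b) x"
proof -
  define g where "g = (\<lambda>x::real^2. flat_exp 1 (x $ 1 - a $ 1) * flat_exp 1 (b $ 1 - x $ 1) *
     (flat_exp 1 (x $ 2 - a $ 2) * flat_exp 1 (b $ 2 - x $ 2)))"
  define \<phi> :: "nat \<Rightarrow> real^2 \<Rightarrow> real" where "\<phi> = (\<lambda>n x. 1 - exp (- real n * g x))"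
  have g_nonneg: "g x \<ge> 0" for x
    by (simp add: g_def flat_exp_1_nonneg)
  have g_pos: "g x > 0 \<longleftrightarrow> x \<in> box a b" for x
    unfolding mem_box_cart forall_2 g_def
    using flat_exp_1_nonneg flat_exp_1_pos_iff
    by (smt (verit) mult_pos_pos mult_nonneg_nonneg mult_eq_0_iff)
  have sg: "smooth g"
    unfolding g_def by (intro smooth_mult smooth_flat_exp smooth_diff smooth_coord smooth_const)
  have outside: "\<phi> n x = 0" if "x \<notin> box a b" for n x
    using g_pos[of x] g_nonneg[of x] that by (auto simp: \<phi>_def)
  have supp: "closure {x. \<phi> n x \<noteq> 0} \<subseteq> cbox a b" for n
    using outside box_subset_cbox[of a b] by (intro closure_minimal) auto
  show thesis
  proof (rule that[of \<phi>])
    show "\<phi> n \<in> test_functions \<Omega>" for n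
    proof -
      have "smooth (\<phi> n)"
        unfolding \<phi>_def by (intro smooth_diff smooth_const smooth_exp smooth_cmult sg)
      moreover have "compact (closure {x. \<phi> n x \<noteq> 0})"
        using supp compact_cbox by (metis closed_closure compact_Int_closed inf.absorb_iff2)
      ultimately show ?thesis
        using supp assms unfolding test_functions_def by blast
    qed
    show "0 \<le> \<phi> n x" for n x using g_nonneg[of x] by (simp add: \<phi>_def)
    show "\<phi> n x \<le> indicator (box a b) x" for n x
      using outside[of x n] by (auto simp: indicator_def \<phi>_def)
    show "(\<lambda>n. \<phi> n x) \<longlonglongrightarrow> indicator (box a b) x" for x
    proof (cases "x \<in> box a b")
      case True
      then have "exp (- g x) < 1" using g_pos by simp
      then have "norm (exp (- g x)) < 1" by (simp only: real_norm_def abs_exp_cancel)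
      then have "(\<lambda>n. exp (- g x) ^ n) \<longlonglongrightarrow> 0" by (rule LIMSEQ_power_zero)
      then have "(\<lambda>n. 1 - exp (- g x) ^ n) \<longlonglongrightarrow> 1 - 0"
        by (rule tendsto_diff[OF tendsto_const])
      then show ?thesis using True by (simp add: \<phi>_def exp_of_nat_mult[symmetric])
    qed (simp add: outside)
  qed
qed

lemma pderiv_at_eq_0_outside_support:
  assumes "x \<notin> closure {x. f x \<noteq> 0}"
  shows "pderiv_at i f x = 0"
proof -
  have "((\<lambda>_. 0) has_derivative (\<lambda>_. 0)) (at x)" by simp
  then have "(f has_derivative (\<lambda>_. 0)) (at x)"
    by (rule has_derivative_transform_within_open[of _ _ _ _ "- closure {x. f x \<noteq> 0}"])
      (use assms closure_subset[of "{x. f x \<noteq> 0}"] in auto)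
  then show ?thesis by (simp add: pderiv_at_eq)
qed

lemma pderiv_at_test_function:
  assumes "\<phi> \<in> test_functions \<Omega>"
  shows "pderiv_at i \<phi> \<in> test_functions \<Omega>"
proof -
  have sub: "closure {x. pderiv_at i \<phi> x \<noteq> 0} \<subseteq> closure {x. \<phi> x \<noteq> 0}"
    using pderiv_at_eq_0_outside_support by (intro closure_minimal) auto
  have "compact (closure {x. \<phi> x \<noteq> 0} \<inter> closure {x. pderiv_at i \<phi> x \<noteq> 0})"
    using assms by (intro compact_Int_closed) (auto simp: test_functions_def)
  then have "compact (closure {x. pderiv_at i \<phi> x \<noteq> 0})"
    using sub by (simp add: Int_absorb1)
  then show ?thesis
    using assms sub unfolding test_functions_def by (auto simp: smooth_pderiv_at)
qed

section \<open>Square integrable functions\<close>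

definition sq_int :: "(real^2 \<Rightarrow> real) \<Rightarrow> bool" where
  "sq_int f \<longleftrightarrow> f \<in> borel_measurable borel \<and> integrable lborel (\<lambda>x. (f x)\<^sup>2)"

lemma sq_int_measurable [measurable_dest]: "sq_int f \<Longrightarrow> f \<in> borel_measurable borel"
  by (simp add: sq_int_def)

lemma sq_int_integrable_power2: "sq_int f \<Longrightarrow> integrable lborel (\<lambda>x. (f x)\<^sup>2)"
  by (simp add: sq_int_def)

lemma sq_int_mult_integrable:
  assumes "sq_int f" "sq_int g"
  shows "integrable lborel (\<lambda>x. f x * g x)"
proof (rule Bochner_Integration.integrable_bound)
  show "integrable lborel (\<lambda>x. (f x)\<^sup>2 + (g x)\<^sup>2)"
    using assms by (intro Bochner_Integration.integrable_add) (auto simp: sq_int_def)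
  have [measurable]: "f \<in> borel_measurable borel" "g \<in> borel_measurable borel"
    using assms by (auto simp: sq_int_def)
  show "(\<lambda>x. f x * g x) \<in> borel_measurable lborel" by measurable
  have "\<bar>f x * g x\<bar> \<le> (f x)\<^sup>2 + (g x)\<^sup>2" for x
    using sum_squares_bound[of "\<bar>f x\<bar>" "\<bar>g x\<bar>"] mult_nonneg_nonneg[OF abs_ge_zero abs_ge_zero, of "f x" "g x"]
    unfolding abs_mult power2_abs by linarith
  then show "AE x in lborel. norm (f x * g x) \<le> norm ((f x)\<^sup>2 + (g x)\<^sup>2)" by simp
qed

lemma sq_int_mono:
  assumes "sq_int g" "f \<in> borel_measurable borel" "AE x in lborel. \<bar>f x\<bar> \<le> C * \<bar>g x\<bar>"
  shows "sq_int f"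
  unfolding sq_int_def
proof
  show "f \<in> borel_measurable borel" by fact
  note [measurable] = this
  show "integrable lborel (\<lambda>x. (f x)\<^sup>2)"
  proof (rule Bochner_Integration.integrable_bound)
    show "integrable lborel (\<lambda>x. C\<^sup>2 * (g x)\<^sup>2)"
      using assms(1) by (intro integrable_mult_right) (simp add: sq_int_def)
    show "(\<lambda>x. (f x)\<^sup>2) \<in> borel_measurable lborel" by measurable
    show "AE x in lborel. norm ((f x)\<^sup>2) \<le> norm (C\<^sup>2 * (g x)\<^sup>2)"
      using assms(3)
    proof eventually_elim
      case (elim x)
      then have "\<bar>f x\<bar>\<^sup>2 \<le> (C * \<bar>g x\<bar>)\<^sup>2" by (intro power_mono) auto
      then show ?case by (simp add: power_mult_distrib)
    qed
  qed
qed

lemma sq_int_add: 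
  assumes "sq_int f" "sq_int g"
  shows "sq_int (\<lambda>x. f x + g x)"
proof -
  have [measurable]: "f \<in> borel_measurable borel" "g \<in> borel_measurable borel"
    using assms by (auto simp: sq_int_def)
  have "integrable lborel (\<lambda>x. (f x)\<^sup>2 + (g x)\<^sup>2 + 2 * (f x * g x))"
    using assms by (intro Bochner_Integration.integrable_add integrable_mult_right sq_int_mult_integrable)
      (auto simp: sq_int_def)
  then show ?thesis
    by (auto simp: sq_int_def power2_sum mult.assoc)
qed

lemma sq_int_cmult: "sq_int f \<Longrightarrow> sq_int (\<lambda>x. c * f x)"
  unfolding sq_int_def by (auto simp: power_mult_distrib)

lemma sq_int_diff: "sq_int f \<Longrightarrow> sq_int g \<Longrightarrow> sq_int (\<lambda>x. f x - g x)"
  using sq_int_add[OF _ sq_int_cmult, of f g "-1"] by simp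

lemma sq_int_bounded_mult:
  assumes "sq_int f" "A \<in> borel_measurable borel" "\<And>x. \<bar>A x\<bar> \<le> C"
  shows "sq_int (\<lambda>x. A x * f x)"
proof (rule sq_int_mono[of f _ C])
  show "sq_int f" by fact
  have [measurable]: "f \<in> borel_measurable borel" "A \<in> borel_measurable borel"
    using assms by (auto simp: sq_int_def)
  show "(\<lambda>x. A x * f x) \<in> borel_measurable borel" by measurable
  show "AE x in lborel. \<bar>A x * f x\<bar> \<le> C * \<bar>f x\<bar>"
    using assms(3) by (simp add: abs_mult mult_right_mono)
qed

lemma Cauchy_Schwarz_sq_int:
  assumes "sq_int f" "sq_int g"
  shows "(LBINT x. f x * g x)\<^sup>2 \<le> (LBINT x. (f x)\<^sup>2) * (LBINT x. (g x)\<^sup>2)"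
proof -
  let ?F = "LBINT x. (f x)\<^sup>2" and ?G = "LBINT x. (g x)\<^sup>2" and ?I = "LBINT x. f x * g x"
  have nn: "?F \<ge> 0" "?G \<ge> 0" by auto
  have q: "0 \<le> s\<^sup>2 * ?F - 2 * s * t * ?I + t\<^sup>2 * ?G" for s t
  proof -
    have "0 \<le> (LBINT x. (s * f x - t * g x)\<^sup>2)" by simp
    also have "\<dots> = (LBINT x. s\<^sup>2 * (f x)\<^sup>2 - 2 * s * t * (f x * g x) + t\<^sup>2 * (g x)\<^sup>2)"
      by (simp add: power2_diff power_mult_distrib algebra_simps)
    also have "\<dots> = s\<^sup>2 * ?F - 2 * s * t * ?I + t\<^sup>2 * ?G"
      using assms sq_int_mult_integrable[OF assms]
      by (simp add: sq_int_def integrable_mult_right)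
    finally show ?thesis .
  qed
  show ?thesis
  proof (cases "?G = 0")
    case True
    have "?I = 0"
    proof (rule ccontr)
      assume n: "?I \<noteq> 0"
      \<comment> \<open>For \<open>?G = 0\<close> the form is affine in \<open>t\<close>, and this
        \<open>t\<close> turns it into \<open>?F - 2 * (?F + 1)\<close>, which is negative.\<close>
      from q[of 1 "(?F + 1) / ?I"] True n have "0 \<le> ?F - 2 * (?F + 1)" by simp
      then show False using nn by simp
    qed
    then show ?thesis using True by simp
  next
    case False
    then have "?G > 0"
      by (intro order.not_eq_order_implies_strict[OF not_sym nn(2)])
    \<comment> \<open>The ratio \<open>t / s = ?I / ?G\<close> minimises the quadratic form; in this
      scaling its value is \<open>?G\<close> times the Cauchy-Schwarz defect.\<close>
    moreover from q[of ?G ?I] have "0 \<le> ?G * (?F * ?G - ?I\<^sup>2)"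
      by (simp add: power2_eq_square algebra_simps)
    ultimately show ?thesis by (simp add: zero_le_mult_iff)
  qed
qed

text \<open>Formulated for functions instead of classes in \<open>ae_fun\<close>, because it is
  applied to sequences multiplied by sines and cosines of other functions, whose limits are taken
  pointwise.\<close>

definition L2_tendsto :: "(nat \<Rightarrow> real^2 \<Rightarrow> real) \<Rightarrow> (real^2 \<Rightarrow> real) \<Rightarrow> bool" where
  "L2_tendsto f g \<longleftrightarrow> (\<forall>n. sq_int (f n)) \<and> sq_int g \<and> (\<lambda>n. LBINT x. (f n x - g x)\<^sup>2) \<longlonglongrightarrow> 0"

lemma L2_tendsto_sq_int: "L2_tendsto f g \<Longrightarrow> sq_int (f n)" "L2_tendsto f g \<Longrightarrow> sq_int g"
  by (auto simp: L2_tendsto_def)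

lemma L2_tendsto_subseq: "L2_tendsto f g \<Longrightarrow> strict_mono r \<Longrightarrow> L2_tendsto (\<lambda>n. f (r n)) g"
  unfolding L2_tendsto_def using LIMSEQ_subseq_LIMSEQ by (fastforce simp: o_def)

lemma integral_power2_add_le:
  assumes "sq_int f" "sq_int g"
  shows "(LBINT x. (f x + g x)\<^sup>2) \<le> 2 * (LBINT x. (f x)\<^sup>2) + 2 * (LBINT x. (g x)\<^sup>2)"
proof -
  have "(LBINT x. (f x + g x)\<^sup>2) \<le> (LBINT x. 2 * (f x)\<^sup>2 + 2 * (g x)\<^sup>2)"
  proof (rule integral_mono)
    show "integrable lborel (\<lambda>x. (f x + g x)\<^sup>2)" using sq_int_add[OF assms] by (simp add: sq_int_def)
    show "integrable lborel (\<lambda>x. 2 * (f x)\<^sup>2 + 2 * (g x)\<^sup>2)"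
      using assms by (auto simp: sq_int_def)
    show "(f x + g x)\<^sup>2 \<le> 2 * (f x)\<^sup>2 + 2 * (g x)\<^sup>2" for x
      using sum_squares_bound[of "f x" "g x"] by (simp add: power2_sum)
  qed
  then show ?thesis using assms by (simp add: sq_int_def)
qed

lemma L2_tendsto_add:
  assumes "L2_tendsto f f'" "L2_tendsto g g'"
  shows "L2_tendsto (\<lambda>n x. f n x + g n x) (\<lambda>x. f' x + g' x)"
  unfolding L2_tendsto_def
proof (intro conjI allI)
  show "sq_int (\<lambda>x. f n x + g n x)" for n using assms by (simp add: L2_tendsto_def sq_int_add)
  show "sq_int (\<lambda>x. f' x + g' x)" using assms by (simp add: L2_tendsto_def sq_int_add)
  have lim: "(\<lambda>n. 2 * (LBINT x. (f n x - f' x)\<^sup>2) + 2 * (LBINT x. (g n x - g' x)\<^sup>2)) \<longlonglongrightarrow> 2 * 0 + 2 * 0"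
    using assms by (intro tendsto_intros) (auto simp: L2_tendsto_def)
  show "(\<lambda>n. LBINT x. (f n x + g n x - (f' x + g' x))\<^sup>2) \<longlonglongrightarrow> 0"
  proof (rule tendsto_sandwich[OF _ _ tendsto_const])
    show "\<forall>\<^sub>F n in sequentially. 0 \<le> (LBINT x. (f n x + g n x - (f' x + g' x))\<^sup>2)" by simp
    show "\<forall>\<^sub>F n in sequentially. (LBINT x. (f n x + g n x - (f' x + g' x))\<^sup>2) \<le>
      2 * (LBINT x. (f n x - f' x)\<^sup>2) + 2 * (LBINT x. (g n x - g' x)\<^sup>2)"
    proof (rule always_eventually, rule allI)
      fix n
      have "(LBINT x. ((f n x - f' x) + (g n x - g' x))\<^sup>2) \<le>
          2 * (LBINT x. (f n x - f' x)\<^sup>2) + 2 * (LBINT x. (g n x - g' x)\<^sup>2)"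
        using assms by (intro integral_power2_add_le sq_int_diff) (auto simp: L2_tendsto_def)
      then show "(LBINT x. (f n x + g n x - (f' x + g' x))\<^sup>2) \<le>
          2 * (LBINT x. (f n x - f' x)\<^sup>2) + 2 * (LBINT x. (g n x - g' x)\<^sup>2)"
        by (simp add: algebra_simps)
    qed
  qed (use lim in simp)
qed

lemma L2_tendsto_integral_mult:
  assumes "L2_tendsto f f'" "sq_int g"
  shows "(\<lambda>n. LBINT x. f n x * g x) \<longlonglongrightarrow> (LBINT x. f' x * g x)"
proof -
  have s: "sq_int (f n)" "sq_int f'" for n using assms by (auto simp: L2_tendsto_def)
  have diff: "(LBINT x. f n x * g x) - (LBINT x. f' x * g x) = (LBINT x. (f n x - f' x) * g x)" for n
    using sq_int_mult_integrable[OF s(1) assms(2)] sq_int_mult_integrable[OF s(2) assms(2)]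
    by (simp add: left_diff_distrib)
  have "(\<lambda>n. (LBINT x. (f n x - f' x) * g x)\<^sup>2) \<longlonglongrightarrow> 0"
  proof (rule tendsto_sandwich[OF _ _ tendsto_const])
    show "\<forall>\<^sub>F n in sequentially. 0 \<le> (LBINT x. (f n x - f' x) * g x)\<^sup>2" by simp
    show "\<forall>\<^sub>F n in sequentially. (LBINT x. (f n x - f' x) * g x)\<^sup>2 \<le>
        (LBINT x. (f n x - f' x)\<^sup>2) * (LBINT x. (g x)\<^sup>2)"
      using assms s by (intro always_eventually allI Cauchy_Schwarz_sq_int sq_int_diff)
    show "(\<lambda>n. (LBINT x. (f n x - f' x)\<^sup>2) * (LBINT x. (g x)\<^sup>2)) \<longlonglongrightarrow> 0"
      using assms by (intro tendsto_mult_left_zero) (auto simp: L2_tendsto_def)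
  qed
  from tendsto_real_sqrt[OF this] have "(\<lambda>n. LBINT x. (f n x - f' x) * g x) \<longlonglongrightarrow> 0"
    by (simp add: tendsto_rabs_zero_iff)
  then show ?thesis
    by (simp add: LIM_zero_cancel flip: diff)
qed

text \<open>The error is split as \<open>A n * (f n - f') + (A n - A') * f'\<close>. The uniform
  bound on \<open>A n\<close> controls the first term by the convergence of \<open>f n\<close>; in
  the second \<open>f'\<close> is fixed, so almost everywhere convergence of \<open>A n\<close> and
  dominated convergence suffice.\<close>

lemma L2_tendsto_bounded_mult:
  assumes f: "L2_tendsto f f'"
    and A: "\<And>n. A n \<in> borel_measurable borel" "A' \<in> borel_measurable borel"
      "\<And>n x. \<bar>A n x\<bar> \<le> C" "AE x in lborel. (\<lambda>n. A n x) \<longlonglongrightarrow> A' x" "\<And>x. \<bar>A' x\<bar> \<le> C"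
  shows "L2_tendsto (\<lambda>n x. A n x * f n x) (\<lambda>x. A' x * f' x)"
  unfolding L2_tendsto_def
proof (intro conjI allI)
  have s: "sq_int (f n)" "sq_int f'" for n using f by (auto simp: L2_tendsto_def)
  note [measurable] = A(1,2) sq_int_measurable[OF s(1)] sq_int_measurable[OF s(2)]
  show sq: "sq_int (\<lambda>x. A n x * f n x)" for n using s A by (intro sq_int_bounded_mult)
  show sq': "sq_int (\<lambda>x. A' x * f' x)" using s A by (intro sq_int_bounded_mult)
  have sA: "sq_int (\<lambda>x. A n x * (f n x - f' x))" "sq_int (\<lambda>x. (A n x - A' x) * f' x)" for n
  proof -
    show "sq_int (\<lambda>x. A n x * (f n x - f' x))"
      using s A by (intro sq_int_bounded_mult sq_int_diff)
    have "sq_int (\<lambda>x. A n x * f' x - A' x * f' x)"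
      using s A by (intro sq_int_bounded_mult sq_int_diff)
    then show "sq_int (\<lambda>x. (A n x - A' x) * f' x)" by (simp add: left_diff_distrib)
  qed
  have 1: "(\<lambda>n. LBINT x. (A n x * (f n x - f' x))\<^sup>2) \<longlonglongrightarrow> 0"
  proof (rule tendsto_sandwich[OF _ _ tendsto_const])
    show "\<forall>\<^sub>F n in sequentially. 0 \<le> (LBINT x. (A n x * (f n x - f' x))\<^sup>2)" by simp
    have "(A n x * (f n x - f' x))\<^sup>2 \<le> C\<^sup>2 * (f n x - f' x)\<^sup>2" for n x
      unfolding power_mult_distrib using power_mono[OF A(3)[of n x], of 2]
      by (intro mult_right_mono) auto
    then have "(LBINT x. (A n x * (f n x - f' x))\<^sup>2) \<le> (LBINT x. C\<^sup>2 * (f n x - f' x)\<^sup>2)" for n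
      using sA(1)[of n] sq_int_diff[OF s] by (intro integral_mono) (auto simp: sq_int_def)
    then show "\<forall>\<^sub>F n in sequentially. (LBINT x. (A n x * (f n x - f' x))\<^sup>2) \<le> C\<^sup>2 * (LBINT x. (f n x - f' x)\<^sup>2)"
      by simp
    show "(\<lambda>n. C\<^sup>2 * (LBINT x. (f n x - f' x)\<^sup>2)) \<longlonglongrightarrow> 0"
      using f by (intro tendsto_mult_right_zero) (auto simp: L2_tendsto_def)
  qed
  have 2: "(\<lambda>n. LBINT x. ((A n x - A' x) * f' x)\<^sup>2) \<longlonglongrightarrow> (\<integral>x. 0 \<partial>(lborel :: (real^2) measure))"
  proof (rule integral_dominated_convergence[where w="\<lambda>x. (2 * C)\<^sup>2 * (f' x)\<^sup>2"])
    show "integrable lborel (\<lambda>x. (2 * C)\<^sup>2 * (f' x)\<^sup>2)" using s by (simp add: sq_int_def)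
    show "AE x in lborel. (\<lambda>n. ((A n x - A' x) * f' x)\<^sup>2) \<longlonglongrightarrow> 0"
      using A(4)
    proof eventually_elim
      case (elim x)
      then have "(\<lambda>n. ((A n x - A' x) * f' x)\<^sup>2) \<longlonglongrightarrow> ((A' x - A' x) * f' x)\<^sup>2" by (intro tendsto_intros)
      then show ?case by simp
    qed
    show "AE x in lborel. norm (((A n x - A' x) * f' x)\<^sup>2) \<le> (2 * C)\<^sup>2 * (f' x)\<^sup>2" for n
    proof (rule AE_I2)
      fix x
      have "\<bar>A n x - A' x\<bar> \<le> 2 * C" using A(3)[of n x] A(5)[of x] by linarith
      from power_mono[OF this, of 2] show "norm (((A n x - A' x) * f' x)\<^sup>2) \<le> (2 * C)\<^sup>2 * (f' x)\<^sup>2"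
        by (simp add: power_mult_distrib[of _ "f' x"] mult_right_mono)
    qed
  qed measurable
  show "(\<lambda>n. LBINT x. (A n x * f n x - A' x * f' x)\<^sup>2) \<longlonglongrightarrow> 0"
  proof (rule tendsto_sandwich[OF _ _ tendsto_const])
    show "\<forall>\<^sub>F n in sequentially. 0 \<le> (LBINT x. (A n x * f n x - A' x * f' x)\<^sup>2)" by simp
    have "(LBINT x. (A n x * (f n x - f' x) + (A n x - A' x) * f' x)\<^sup>2) \<le>
      2 * (LBINT x. (A n x * (f n x - f' x))\<^sup>2) + 2 * (LBINT x. ((A n x - A' x) * f' x)\<^sup>2)" for n
      by (intro integral_power2_add_le sA)
    then show "\<forall>\<^sub>F n in sequentially. (LBINT x. (A n x * f n x - A' x * f' x)\<^sup>2) \<le>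
      2 * (LBINT x. (A n x * (f n x - f' x))\<^sup>2) + 2 * (LBINT x. ((A n x - A' x) * f' x)\<^sup>2)"
      by (simp add: algebra_simps)
    show "(\<lambda>n. 2 * (LBINT x. (A n x * (f n x - f' x))\<^sup>2) + 2 * (LBINT x. ((A n x - A' x) * f' x)\<^sup>2)) \<longlonglongrightarrow> 0"
      using tendsto_add[OF tendsto_mult_right_zero[OF 1, of 2] tendsto_mult_right_zero[OF 2[simplified], of 2]]
      by simp
  qed
qed

lemma L2_tendsto_AE_subseq:
  assumes "L2_tendsto f f'"
  obtains r where "strict_mono r" "AE x in lborel. (\<lambda>n. f (r n) x) \<longlonglongrightarrow> f' x"
proof -
  have "\<exists>r. strict_mono r \<and> (AE x in lborel. (\<lambda>n. (f (r n) x - f' x)\<^sup>2) \<longlonglongrightarrow> 0)"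
    using assms by (intro tendsto_L1_AE_subseq)
      (auto simp: L2_tendsto_def intro!: sq_int_integrable_power2 sq_int_diff)
  then obtain r where r: "strict_mono r" "AE x in lborel. (\<lambda>n. (f (r n) x - f' x)\<^sup>2) \<longlonglongrightarrow> 0"
    by blast
  from r(2) have "AE x in lborel. (\<lambda>n. f (r n) x) \<longlonglongrightarrow> f' x"
  proof eventually_elim
    case (elim x)
    from tendsto_real_sqrt[OF elim] have "(\<lambda>n. \<bar>f (r n) x - f' x\<bar>) \<longlonglongrightarrow> 0" by simp
    then show ?case by (simp add: LIM_zero_cancel tendsto_rabs_zero_iff)
  qed
  then show thesis using that r(1) by blast
qed

section \<open>Classes of functions, their representatives and the inner product\<close>

lemma rep_ae_fun_measurable [measurable]: "rep_ae_fun f \<in> borel_measurable borel"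
  using Quotient_rep_reflp[OF Quotient_ae_fun] by (auto simp: ae_rel_def)

lemma ae_rel_refl: "F \<in> borel_measurable borel \<Longrightarrow> ae_rel F F"
  by (simp add: ae_rel_def)

lemma ae_class_rep [simp]: "ae_class (rep_ae_fun f) = f"
  using Quotient_abs_rep[OF Quotient_ae_fun] .

lemma AE_rep_ae_class:
  assumes "F \<in> borel_measurable borel"
  shows "AE x in lborel. rep_ae_fun (ae_class F) x = F x"
  using rep_abs_rsp_left[OF Quotient3_ae_fun, of F F] ae_rel_refl[OF assms]
  by (simp add: ae_rel_def)

lemma ae_class_eqI:
  assumes "F \<in> borel_measurable borel" "F' \<in> borel_measurable borel" "AE x in lborel. F x = F' x"
  shows "ae_class F = ae_class F'"
  using assms Quotient_rel_abs[OF Quotient_ae_fun] by (auto simp: ae_rel_def)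

lemma ae_fun_eqI: "AE x in lborel. rep_ae_fun f x = rep_ae_fun g x \<Longrightarrow> f = g"
  using ae_class_eqI[of "rep_ae_fun f" "rep_ae_fun g"] by simp

lemma AE_rep_add: "AE x in lborel. rep_ae_fun (f + g) x = rep_ae_fun f x + rep_ae_fun g x"
proof -
  have "f + g = ae_class (\<lambda>x. rep_ae_fun f x + rep_ae_fun g x)"
    using plus_ae_fun.abs_eq[of "rep_ae_fun f" "rep_ae_fun g"] by (simp add: ae_rel_refl)
  then show ?thesis using AE_rep_ae_class by simp
qed

lemma AE_rep_scaleR: "AE x in lborel. rep_ae_fun (c *\<^sub>R f) x = c * rep_ae_fun f x"
proof -
  have "c *\<^sub>R f = ae_class (\<lambda>x. c * rep_ae_fun f x)"
    using scaleR_ae_fun.abs_eq[of "rep_ae_fun f" c] by (simp add: ae_rel_refl)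
  then show ?thesis using AE_rep_ae_class by simp
qed

lemma AE_rep_diff: "AE x in lborel. rep_ae_fun (f - g) x = rep_ae_fun f x - rep_ae_fun g x"
  using AE_rep_add[of f "(-1) *\<^sub>R g"] AE_rep_scaleR[of "-1" g] by eventually_elim simp

lemma AE_rep_zero: "AE x in lborel. rep_ae_fun 0 x = 0"
  using AE_rep_ae_class[of "\<lambda>_. 0"] by (simp add: zero_ae_fun.abs_eq)

lemma square_integrable_iff: "square_integrable f \<longleftrightarrow> sq_int (rep_ae_fun f)"
  by (simp add: square_integrable.rep_eq sq_int_def)

lemma L2_iff: "f \<in> L2 \<Omega> \<longleftrightarrow> sq_int (rep_ae_fun f) \<and> (AE x in lborel. x \<notin> \<Omega> \<longrightarrow> rep_ae_fun f x = 0)"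
  by (simp add: L2_def square_integrable_iff vanishes_off.rep_eq)

lemma sq_int_rep: "f \<in> L2 \<Omega> \<Longrightarrow> sq_int (rep_ae_fun f)"
  by (simp add: L2_iff)

lemma sq_int_cong_AE:
  assumes "sq_int f" "g \<in> borel_measurable borel" "AE x in lborel. f x = g x"
  shows "sq_int g"
  using assms(3) by (intro sq_int_mono[OF assms(1,2), of 1]) (auto elim: AE_mp)

lemma ae_class_in_L2:
  assumes "sq_int F" "AE x in lborel. x \<notin> \<Omega> \<longrightarrow> F x = 0"
  shows "ae_class F \<in> L2 \<Omega>"
proof -
  have F: "AE x in lborel. rep_ae_fun (ae_class F) x = F x"
    using assms(1) by (intro AE_rep_ae_class) (simp add: sq_int_def)
  then have "sq_int (rep_ae_fun (ae_class F))"
    by (intro sq_int_cong_AE[OF assms(1)]) (auto elim: AE_mp)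
  moreover have "AE x in lborel. x \<notin> \<Omega> \<longrightarrow> rep_ae_fun (ae_class F) x = 0"
    using F assms(2) by eventually_elim auto
  ultimately show ?thesis by (simp add: L2_iff)
qed

lemma subspace_L2: "subspace (L2 \<Omega>)"
proof (rule subspaceI)
  have "ae_class (\<lambda>_. 0) \<in> L2 \<Omega>"
    by (intro ae_class_in_L2) (auto simp: sq_int_def)
  then show "0 \<in> L2 \<Omega>" by (simp add: zero_ae_fun.abs_eq)
  fix f g assume fg: "f \<in> L2 \<Omega>" "g \<in> L2 \<Omega>"
  have "sq_int (rep_ae_fun (f + g))"
    by (rule sq_int_cong_AE[OF sq_int_add[OF fg[THEN sq_int_rep]]])
      (use AE_rep_add[of f g] in \<open>auto elim: AE_mp\<close>)
  moreover have "AE x in lborel. x \<notin> \<Omega> \<longrightarrow> rep_ae_fun (f + g) x = 0"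
    using AE_rep_add[of f g] conjunct2[OF fg(1)[unfolded L2_iff]] conjunct2[OF fg(2)[unfolded L2_iff]]
    by eventually_elim auto
  ultimately show "f + g \<in> L2 \<Omega>" by (simp add: L2_iff)
next
  fix c f assume f: "f \<in> L2 \<Omega>"
  have "sq_int (rep_ae_fun (c *\<^sub>R f))"
    by (rule sq_int_cong_AE[OF sq_int_cmult[OF f[THEN sq_int_rep]]])
      (use AE_rep_scaleR[of c f] in \<open>auto elim: AE_mp\<close>)
  moreover have "AE x in lborel. x \<notin> \<Omega> \<longrightarrow> rep_ae_fun (c *\<^sub>R f) x = 0"
    using AE_rep_scaleR[of c f] conjunct2[OF f[unfolded L2_iff]] by eventually_elim auto
  ultimately show "c *\<^sub>R f \<in> L2 \<Omega>" by (simp add: L2_iff)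
qed

lemma ip_commute: "ip f g = ip g f"
  by (simp add: ip.rep_eq mult.commute)

lemma ip_ae_class:
  assumes "F \<in> borel_measurable borel"
  shows "ip f (ae_class F) = (LBINT x. rep_ae_fun f x * F x)"
proof -
  have [measurable]: "F \<in> borel_measurable borel" by fact
  show ?thesis
    unfolding ip.rep_eq
    by (rule integral_cong_AE) (use AE_rep_ae_class[OF assms] in \<open>auto elim: AE_mp\<close>)
qed

lemma ip_scaleR_left: "ip (c *\<^sub>R f) g = c * ip f g"
proof -
  have "ip (c *\<^sub>R f) g = (LBINT x. c * (rep_ae_fun f x * rep_ae_fun g x))"
    unfolding ip.rep_eq
    by (rule integral_cong_AE) (use AE_rep_scaleR[of c f] in \<open>auto elim: AE_mp\<close>)
  then show ?thesis by (simp add: ip.rep_eq)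
qed

lemma ip_add_left:
  assumes "sq_int (rep_ae_fun f)" "sq_int (rep_ae_fun g)" "sq_int (rep_ae_fun h)"
  shows "ip (f + g) h = ip f h + ip g h"
proof -
  have "ip (f + g) h = (LBINT x. rep_ae_fun f x * rep_ae_fun h x + rep_ae_fun g x * rep_ae_fun h x)"
    unfolding ip.rep_eq
    by (rule integral_cong_AE) (use AE_rep_add[of f g] in \<open>auto elim: AE_mp simp: distrib_right\<close>)
  then show ?thesis
    using assms by (simp add: ip.rep_eq sq_int_mult_integrable)
qed

lemma ip_zero_left [simp]: "ip 0 g = 0"
  using ip_scaleR_left[of 0 0 g] by simp

lemma ip_zero_right [simp]: "ip g 0 = 0"
  by (simp add: ip_commute[of g])

lemma ip_self_nonneg: "ip f f \<ge> 0"
  by (simp add: ip.rep_eq)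

lemma ip_self_eq: "ip f f = (LBINT x. (rep_ae_fun f x)\<^sup>2)"
  by (simp add: ip.rep_eq power2_eq_square)

lemma ip_self_eq_0D:
  assumes "f \<in> L2 \<Omega>" "ip f f = 0"
  shows "f = 0"
proof -
  have "AE x in lborel. (rep_ae_fun f x)\<^sup>2 = 0"
    using assms sq_int_rep[OF assms(1)] unfolding ip_self_eq
    by (subst (asm) integral_nonneg_eq_0_iff_AE) (auto simp: sq_int_def)
  then have "AE x in lborel. rep_ae_fun f x = rep_ae_fun 0 x"
    using AE_rep_zero by eventually_elim simp
  then show ?thesis by (rule ae_fun_eqI)
qed

section \<open>Integrals of derivatives and boundary integrals\<close>

lemma integral_derivative_Icc:
  fixes F f :: "real \<Rightarrow> real"
  assumes "a \<le> b" "\<And>x. (F has_real_derivative f x) (at x)" "continuous_on UNIV f"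
  shows "(LBINT x. indicator {a<..<b} x * f x) = F b - F a"
proof -
  have "(LBINT x. f x * indicator {a..b} x) = F b - F a"
    using assms by (intro integral_FTC_Icc_real) (auto simp: continuous_on_eq_continuous_at)
  moreover have "(LBINT x. indicator {a<..<b} x * f x) = (LBINT x. f x * indicator {a..b} x)"
  proof (rule integral_cong_AE)
    have [measurable]: "f \<in> borel_measurable borel"
      using assms(3) by (rule borel_measurable_continuous_onI)
    show "(\<lambda>x. indicator {a<..<b} x * f x) \<in> borel_measurable lborel"
      "(\<lambda>x. f x * indicator {a..b} x) \<in> borel_measurable lborel" by measurable
    have "AE x in lborel. x \<notin> {a, b}"
      by (intro AE_not_in finite_imp_null_set_lborel) simp
    then show "AE x in lborel. indicator {a<..<b} x * f x = f x * indicator {a..b} x"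
      by eventually_elim (auto simp: indicator_def)
  qed
  ultimately show ?thesis by simp
qed

lemma integrable_indicator_continuous:
  fixes f :: "'a::euclidean_space \<Rightarrow> real"
  assumes "continuous_on UNIV f" "bounded U" "U \<in> sets borel"
  shows "integrable lborel (\<lambda>x. indicator U x * f x)"
proof -
  obtain r where r: "U \<subseteq> cball 0 r"
    using assms(2) unfolding bounded_iff subset_iff mem_cball_0 by blast
  have [measurable]: "f \<in> borel_measurable borel" "U \<in> sets borel"
    using assms by (auto intro: borel_measurable_continuous_onI)
  have "integrable lborel (\<lambda>x. indicator (cball 0 r) x *\<^sub>R f x)"
    using assms(1) by (intro borel_integrable_compact compact_cball) (blast intro: continuous_on_subset)
  then show ?thesis
    by (rule Bochner_Integration.integrable_bound) (use r in \<open>auto simp: indicator_def subset_iff\<close>)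
qed

text \<open>The summand for \<open>Max S\<close>, which can be the end point of only one interval, makes the induction work.\<close>

lemma integral_derivative_le_frontier_aux:
  fixes F f :: "real \<Rightarrow> real"
  assumes F: "\<And>x. (F has_real_derivative f x) (at x)" "continuous_on UNIV f"
  shows "finite S \<Longrightarrow> (\<And>U. open U \<Longrightarrow> bounded U \<Longrightarrow> frontier U \<subseteq> S \<Longrightarrow>
    \<bar>LBINT x. indicator U x * f x\<bar> + (if S = {} then 0 else \<bar>F (Max S)\<bar>) \<le> 2 * (\<Sum>s\<in>S. \<bar>F s\<bar>))"
proof (induction S rule: finite_linorder_max_induct)
  case (empty U)
  then have "frontier U = {}" by simp
  then have "U = {}"
    using empty(2) by (metis frontier_eq_empty not_bounded_UNIV)
  then show ?case by simp
next
  case (insert b A)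
  \<comment> \<open>A connected set free of frontier points lies in \<open>U\<close> or misses it,
    and a ray cannot lie in the bounded set \<open>U\<close>.\<close>
  have above: "U \<inter> {b<..} = {}"
  proof (rule ccontr)
    assume n: "U \<inter> {b<..} \<noteq> {}"
    have "{b<..} \<inter> frontier U = {}"
      using insert.prems(3) insert.hyps(2) by fastforce
    then have "{b<..} \<subseteq> U"
      using connected_Int_frontier[of "{b<..}" U] n by auto
    then have "bdd_above {b<..}"
      by (rule bounded_imp_bdd_above[OF bounded_subset[OF insert.prems(2)]])
    then obtain m where "\<And>x. b < x \<Longrightarrow> x \<le> m" by (auto simp: bdd_above_def)
    from this[of "max b m + 1"] show False by arith
  qed
  show ?case
  proof (cases "A = {}")
    case True
    have "{..<b} \<inter> U = {}"
    proof (rule ccontr)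
      assume n: "{..<b} \<inter> U \<noteq> {}"
      have "{..<b} \<inter> frontier U = {}"
        using insert.prems(3) True by fastforce
      then have "{..<b} \<subseteq> U"
        using connected_Int_frontier[of "{..<b}" U] n by auto
      then have "bdd_below {..<b}"
        by (rule bounded_imp_bdd_below[OF bounded_subset[OF insert.prems(2)]])
      then obtain m where "\<And>x. x < b \<Longrightarrow> m \<le> x" by (auto simp: bdd_below_def)
      from this[of "min b m - 1"] show False by arith
    qed
    then have "U \<subseteq> {b}" using above by force
    then have "U = {}" using insert.prems(1) by (metis not_open_singleton subset_singletonD)
    then show ?thesis using True by simp
  next
    case False
    define c where "c = Max A"
    have c: "c \<in> A" "\<And>x. x \<in> A \<Longrightarrow> x \<le> c" "c < b"
      using False insert.hyps by (auto simp: c_def)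
    \<comment> \<open>Between \<open>c\<close> and \<open>b\<close>, the two largest points of
      \<open>insert b A\<close>, the set \<open>U\<close> is all or nothing; only the part below
      \<open>c\<close> is left to the induction.\<close>
    define U' where "U' = U \<inter> {..<c}"
    have U'S: "frontier U' \<subseteq> A"
    proof -
      have "closure U' \<subseteq> closure U \<inter> {..c}"
        unfolding U'_def using closure_subset[of U] by (intro closure_minimal closed_Int) auto
      then have "frontier U' \<subseteq> (closure U \<inter> {..c}) - U'"
        using insert.prems(1) by (auto simp: frontier_def interior_open U'_def)
      also have "\<dots> \<subseteq> insert c (frontier U \<inter> {..c})"
        using insert.prems(1) by (auto simp: frontier_def interior_open U'_def)
      also have "\<dots> \<subseteq> A" using insert.prems(3) c by auto
      finally show ?thesis .
    qed
    have U': "\<bar>LBINT x. indicator U' x * f x\<bar> + \<bar>F c\<bar> \<le> 2 * (\<Sum>s\<in>A. \<bar>F s\<bar>)"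
      using insert.IH[of U'] open_Int[OF insert.prems(1) open_lessThan] bounded_Int[OF disjI1[OF insert.prems(2)]] U'S False
      by (auto simp: U'_def c_def)
    define V where "V = U \<inter> {c<..<b}"
    have "{c<..<b} \<inter> frontier U = {}"
      using insert.prems(3) c by fastforce
    then have "V = {} \<or> V = {c<..<b}"
      using connected_Int_frontier[of "{c<..<b}" U] by (auto simp: V_def)
    then have V: "\<bar>LBINT x. indicator V x * f x\<bar> \<le> \<bar>F b\<bar> + \<bar>F c\<bar>"
      using integral_derivative_Icc[OF less_imp_le[OF c(3)] F] by auto
    have meas [measurable]: "U \<in> sets borel" "U' \<in> sets borel" "V \<in> sets borel" "f \<in> borel_measurable borel"
      using insert.prems(1) F(2) by (auto simp: U'_def V_def intro: borel_measurable_continuous_onI)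
    have "(LBINT x. indicator U x * f x) = (LBINT x. indicator U' x * f x + indicator V x * f x)"
    proof (rule integral_cong_AE)
      have "AE x in lborel. x \<notin> {b, c}"
        by (intro AE_not_in finite_imp_null_set_lborel) simp
      then show "AE x in lborel. indicator U x * f x = indicator U' x * f x + indicator V x * f x"
        by eventually_elim (use above in \<open>auto simp: indicator_def U'_def V_def\<close>)
    qed measurable
    also have "\<dots> = (LBINT x. indicator U' x * f x) + (LBINT x. indicator V x * f x)"
      using insert.prems(2) meas
      by (intro Bochner_Integration.integral_add integrable_indicator_continuous F(2))
        (auto simp: U'_def V_def)
    \<comment> \<open>The \<open>\<bar>F c\<bar>\<close> contributed by \<open>V\<close> is exactly
      the summand reserved in the induction hypothesis for \<open>U'\<close>, so it cancels.\<close>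
    finally have "\<bar>LBINT x. indicator U x * f x\<bar> \<le> 2 * (\<Sum>s\<in>A. \<bar>F s\<bar>) + \<bar>F b\<bar>"
      using U' V by linarith
    moreover have "Max (insert b A) = b"
      using insert.hyps False by (simp add: max_def) (metis Max_in c(3) c_def less_le not_le)
    moreover have "b \<notin> A" using insert.hyps(2) by auto
    ultimately show ?thesis using insert.hyps(1) by simp
  qed
qed

text \<open>Each component of \<open>U\<close> contributes the difference of \<open>F\<close> at its
  end points, and a point of \<open>S\<close> ends at most two components; hence the factor 2. The
  auxiliary induction reaches this bound without listing the components.\<close>

lemma integral_derivative_le_frontier:
  fixes F f :: "real \<Rightarrow> real"
  assumes "\<And>x. (F has_real_derivative f x) (at x)" "continuous_on UNIV f"
    "finite S" "open U" "bounded U" "frontier U \<subseteq> S"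
  shows "\<bar>LBINT x. indicator U x * f x\<bar> \<le> 2 * (\<Sum>s\<in>S. \<bar>F s\<bar>)"
proof -
  have "0 \<le> (if S = {} then 0 else \<bar>F (Max S)\<bar>)" by simp
  with integral_derivative_le_frontier_aux[OF assms(1-6)] show ?thesis by linarith
qed

section \<open>Coordinate lines and iterated integration in the plane\<close>

definition pt :: "2 \<Rightarrow> real \<Rightarrow> real \<Rightarrow> real^2" where
  "pt i s t = (\<chi> k. if k = i then s else t)"

lemma pt_nth [simp]: "pt i s t $ k = (if k = i then s else t)"
  by (simp add: pt_def)

lemma plus_1_neq_2 [simp]: "i + 1 \<noteq> (i::2)"
  using exhaust_2[of i] by auto

text \<open>Addition in the index type \<open>2\<close> is modulo 2, so \<open>i + 1\<close> always
  denotes the coordinate other than \<open>i\<close>. One argument thereby treats both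
  directions.\<close>

lemma UNIV_2_insert: "(UNIV :: 2 set) = {i, i + 1}"
  using exhaust_2 by (metis (full_types) UNIV_eq_I insertCI plus_1_neq_2)

lemma all_2_iff: "(\<forall>k. P k) \<longleftrightarrow> P i \<and> P (i + 1)" for i :: 2
proof -
  have "(\<forall>k\<in>UNIV. P k) \<longleftrightarrow> P i \<and> P (i + 1)"
    by (subst UNIV_2_insert[of i]) simp
  then show ?thesis by simp
qed

lemma pt_eta: "pt i (x $ i) (x $ (i + 1)) = x"
  by (simp add: vec_eq_iff all_2_iff[of _ i])

lemma pt_line: "pt i s t = pt i 0 t + s *\<^sub>R axis i 1"
  by (simp add: vec_eq_iff axis_def)

lemma continuous_on_pt: "continuous_on A (\<lambda>z. pt i (fst z) (snd z))"
  unfolding pt_def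
proof (intro continuous_on_vec_lambda)
  show "continuous_on A (\<lambda>z. if k = i then fst z else snd z)" for k
    by (cases "k = i") (auto intro: continuous_on_fst continuous_on_snd continuous_on_id)
qed

lemma continuous_on_pt_line: "continuous_on A (\<lambda>s. pt i s t)"
  unfolding pt_def
proof (intro continuous_on_vec_lambda)
  show "continuous_on A (\<lambda>s. if k = i then s else t)" for k
    by (cases "k = i") auto
qed

lemma measurable_pt [measurable]: "(\<lambda>z. pt i (fst z) (snd z)) \<in> borel_measurable borel"
  by (intro borel_measurable_continuous_onI continuous_on_pt)

text \<open>Lebesgue measure is determined by its values on boxes, and the preimage of a box under a
  choice of coordinates is a box with the same side lengths. Fubini's theorem carries over from
  pairs to \<open>real^2\<close> along this map.\<close>

lemma distr_lborel_pt: "distr (lborel :: (real \<times> real) measure) borel (\<lambda>z. pt i (fst z) (snd z)) = lborel"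
proof (rule lborel_eqI[symmetric])
  fix l u :: "real^2"
  assume le: "\<And>b. b \<in> Basis \<Longrightarrow> l \<bullet> b \<le> u \<bullet> b"
  then have le: "l $ k \<le> u $ k" for k
    using le[of "axis k 1"] by (simp add: inner_axis axis_in_Basis_iff)
  have "(\<lambda>z. pt i (fst z) (snd z)) -` box l u = box (l $ i, l $ (i + 1)) (u $ i, u $ (i + 1))"
    unfolding set_eq_iff vimage_eq mem_box_cart all_2_iff[of _ i]
    by (auto simp: mem_box Basis_prod_def)
  then have "emeasure (distr lborel borel (\<lambda>z. pt i (fst z) (snd z))) (box l u) =
      emeasure lborel (box (l $ i, l $ (i + 1)) (u $ i, u $ (i + 1)))"
    by (subst emeasure_distr) auto
  also have "\<dots> = ennreal (\<Prod>b\<in>Basis. ((u $ i, u $ (i + 1)) - (l $ i, l $ (i + 1))) \<bullet> b)"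
    using le by (intro emeasure_lborel_box) (auto simp: Basis_prod_def)
  also have "(\<Prod>b\<in>Basis. ((u $ i, u $ (i + 1)) - (l $ i, l $ (i + 1))) \<bullet> b) =
      (u $ i - l $ i) * (u $ (i + 1) - l $ (i + 1))"
    by (simp add: Basis_prod_def)
  also have "\<dots> = (\<Prod>k\<in>UNIV. u $ k - l $ k)"
    by (subst UNIV_2_insert[of i]) simp
  also have "\<dots> = (\<Prod>b\<in>Basis. (u - l) \<bullet> b)"
    by (simp add: Basis_vec_def prod.UNION_disjoint inner_axis axis_eq_axis)
  finally show "emeasure (distr lborel borel (\<lambda>z. pt i (fst z) (snd z))) (box l u) = ennreal (\<Prod>b\<in>Basis. (u - l) \<bullet> b)" .
qed simp

lemma integrable_pt:
  fixes f :: "real^2 \<Rightarrow> real"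
  assumes "integrable lborel f"
  shows "integrable (lborel \<Otimes>\<^sub>M lborel) (\<lambda>(s, t). f (pt i s t))"
proof -
  have "integrable (distr lborel borel (\<lambda>z. pt i (fst z) (snd z))) f"
    using assms distr_lborel_pt by simp
  then have "integrable lborel (\<lambda>z. f (pt i (fst z) (snd z)))"
    by (rule integrable_distr[rotated]) simp
  then show ?thesis by (simp add: lborel_prod case_prod_unfold)
qed

lemma integral_pt:
  fixes f :: "real^2 \<Rightarrow> real"
  assumes "integrable lborel f"
  shows "(LBINT x. f x) = (LBINT t. (LBINT s. f (pt i s t)))"
    "integrable lborel (\<lambda>t. LBINT s. f (pt i s t))"
proof -
  have [measurable]: "f \<in> borel_measurable borel" using assms by auto
  have "(LBINT x. f x) = (LBINT z. f (pt i (fst z) (snd z)))"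
    by (subst distr_lborel_pt[of i, symmetric], subst integral_distr) auto
  also have "\<dots> = (\<integral>(s, t). f (pt i s t) \<partial>(lborel \<Otimes>\<^sub>M lborel))"
    by (simp add: lborel_prod case_prod_unfold)
  also have "\<dots> = (LBINT t. (LBINT s. f (pt i s t)))"
    by (rule lborel_pair.integral_snd[OF integrable_pt[OF assms], symmetric])
  finally show "(LBINT x. f x) = (LBINT t. (LBINT s. f (pt i s t)))" .
  show "integrable lborel (\<lambda>t. LBINT s. f (pt i s t))"
    using lborel_pair.integrable_snd[OF integrable_pt[OF assms]] .
qed

lemma DERIV_pt_line:
  assumes "smooth F"
  shows "((\<lambda>s. F (pt i s t)) has_real_derivative pderiv_at i F (pt i s t)) (at s)"
  using has_derivative_pderiv_line[OF smooth_differentiable[OF assms], of "pt i 0 t" i]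
  by (simp flip: pt_line)

lemma integral_pderiv_compact_support:
  assumes F: "smooth F" "bounded {x. F x \<noteq> 0}"
  shows "(LBINT x. pderiv_at i F x) = 0"
proof -
  obtain r where r: "{x. F x \<noteq> 0} \<subseteq> cball 0 r"
    using F(2) unfolding bounded_iff subset_iff mem_cball_0 by blast
  then have "closure {x. F x \<noteq> 0} \<subseteq> cball 0 r" by (intro closure_minimal) auto
  then have out: "pderiv_at i F x = 0" if "x \<notin> cball 0 r" for x
    using pderiv_at_eq_0_outside_support that by blast
  have cont: "continuous_on UNIV (pderiv_at i F)"
    by (intro continuous_on_smooth smooth_pderiv_at F)
  have eq: "pderiv_at i F = (\<lambda>x. indicator (cball 0 r) x * pderiv_at i F x)"
    using out by (auto simp: fun_eq_iff indicator_def)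
  have int: "integrable lborel (pderiv_at i F)"
    by (subst eq) (intro integrable_indicator_continuous cont; simp)
  have zero: "(LBINT s. pderiv_at i F (pt i s t)) = 0" for t
  proof -
    \<comment> \<open>Beyond \<open>R\<close> the line has left the ball containing the support; the
      maximum with 0 also keeps \<open>-R\<close> below \<open>R\<close>.\<close>
    define R where "R = max r 0 + 1"
    have big: "pt i s t \<notin> cball 0 r" if "\<bar>s\<bar> \<ge> R" for s
      using component_le_norm_cart[of "pt i s t" i] that by (auto simp: R_def)
    have "(LBINT s. pderiv_at i F (pt i s t)) = (LBINT s. indicator {-R<..<R} s * pderiv_at i F (pt i s t))"
    proof (rule Bochner_Integration.integral_cong[OF refl])
      show "pderiv_at i F (pt i s t) = indicator {-R<..<R} s * pderiv_at i F (pt i s t)" for s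
        using out[OF big, of s] by (cases "\<bar>s\<bar> \<ge> R") (auto simp: indicator_def abs_le_iff not_le abs_less_iff)
    qed
    also have "\<dots> = F (pt i R t) - F (pt i (-R) t)"
      by (rule integral_derivative_Icc)
        (auto simp: R_def intro!: DERIV_pt_line F continuous_on_compose2[OF cont continuous_on_pt_line])
    also have "\<dots> = 0"
    proof -
      have "F x = 0" if "x \<notin> cball 0 r" for x using r that by auto
      from this[OF big[of R]] this[OF big[of "-R"]] show ?thesis by (simp add: R_def)
    qed
    finally show ?thesis .
  qed
  show ?thesis using integral_pt(1)[OF int, of i] zero by simp
qed

text \<open>The inclusion can be strict, for instance where a line runs along the boundary; the
  one-dimensional estimate only asks for a set that contains the frontier.\<close>

lemma frontier_slice:
  assumes "open \<Omega>"
  shows "frontier {s. pt i s t \<in> \<Omega>} \<subseteq> {s. pt i s t \<in> frontier \<Omega>}"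
    and "open {s. pt i s t \<in> \<Omega>}"
proof -
  have eq: "{s. pt i s t \<in> A} = (\<lambda>s. pt i s t) -` A" for A by auto
  show o: "open {s. pt i s t \<in> \<Omega>}"
    unfolding eq using assms continuous_on_pt_line by (metis open_vimage)
  have "closed {s. pt i s t \<in> closure \<Omega>}"
    unfolding eq using continuous_on_pt_line by (metis closed_vimage closed_closure)
  then have "closure {s. pt i s t \<in> \<Omega>} \<subseteq> {s. pt i s t \<in> closure \<Omega>}"
    using closure_subset by (intro closure_minimal) auto
  then show "frontier {s. pt i s t \<in> \<Omega>} \<subseteq> {s. pt i s t \<in> frontier \<Omega>}"
    using o assms by (auto simp: frontier_def interior_open)
qed

lemma bounded_slice:
  assumes "bounded \<Omega>"
  shows "bounded {s. pt i s t \<in> \<Omega>}"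
proof -
  obtain r where "\<And>x. x \<in> \<Omega> \<Longrightarrow> norm x \<le> r" using assms by (auto simp: bounded_iff)
  then have "\<bar>s\<bar> \<le> r" if "pt i s t \<in> \<Omega>" for s
    using that component_le_norm_cart[of "pt i s t" i] by force
  then show ?thesis by (auto simp: bounded_iff)
qed


section \<open>Arc length and the boundary estimate\<close>

lemma is_edge_set_edges_of:
  assumes "\<exists>E. is_edge_set \<Gamma> E"
  shows "is_edge_set \<Gamma> (edges_of \<Gamma>)"
  unfolding edges_of_def using assms by (rule someI_ex)

lemma measurable_linepath [measurable]: "linepath a b \<in> borel_measurable borel"
  by (intro borel_measurable_continuous_onI continuous_on_linepath)

text \<open>Arc length is the sum over all edges of scaled images of Lebesgue measure on the unit
  interval. The measure \<open>M\<close> of a single edge therefore lies below it, and integrals of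
  nonnegative functions are monotone in the measure.\<close>

lemma nn_integral_edge_le:
  assumes e: "(a, b) \<in> edges_of \<Gamma>" "finite (edges_of \<Gamma>)" and [measurable]: "g \<in> borel_measurable borel"
  shows "ennreal (norm (b - a)) * (\<integral>\<^sup>+t. indicator {0..1} t * g (linepath a b t) \<partial>lborel) \<le>
    (\<integral>\<^sup>+x. g x \<partial>arc_measure \<Gamma>)"
proof -
  define M where "M = scale_measure (ennreal (norm (b - a)))
    (distr (density lborel (indicator {0..1})) borel (linepath a b))"
  have sets_M: "sets M = sets (arc_measure \<Gamma>)" by (simp add: M_def)
  have "M \<le> arc_measure \<Gamma>"
  proof (subst le_measure[OF sets_M], rule ballI)
    fix A assume "A \<in> sets M"
    then have A [measurable]: "A \<in> sets borel" by (simp add: M_def)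
    have "linepath a b -` A \<in> sets borel"
      using measurable_sets[OF measurable_linepath A] by simp
    then have [measurable]: "{0..1} \<inter> linepath a b -` A \<in> sets borel" by (intro sets.Int) auto
    have "emeasure M A = ennreal (norm (b - a)) * (\<integral>\<^sup>+t. indicator {0..1} t * indicator (linepath a b -` A) t \<partial>lborel)"
      using \<open>linepath a b -` A \<in> sets borel\<close>
      by (simp add: M_def emeasure_scale_measure emeasure_distr emeasure_density)
    also have "(\<lambda>t. indicator {0..1} t * indicator (linepath a b -` A) t :: ennreal) =
        indicator ({0..1} \<inter> linepath a b -` A)"
      by (simp add: fun_eq_iff indicator_inter_arith)
    also have "(\<integral>\<^sup>+t. indicator ({0..1} \<inter> linepath a b -` A) t \<partial>lborel) =
        emeasure lborel ({0..1} \<inter> linepath a b -` A)"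
      by (rule nn_integral_indicator) simp
    also have "{0..1} \<inter> linepath a b -` A = {t \<in> {0..1}. linepath a b t \<in> A}" by auto
    also have "ennreal (norm (b - a)) * emeasure lborel {t \<in> {0..1}. linepath a b t \<in> A} \<le> arc_length_on \<Gamma> A"
      unfolding arc_length_on_def
      using member_le_sum[OF e(1) _ e(2), of "\<lambda>(a, b). ennreal (norm (b - a)) * emeasure lborel {t \<in> {0..1}. linepath a b t \<in> A}"]
      by simp
    finally show "emeasure M A \<le> emeasure (arc_measure \<Gamma>) A"
      using A by (simp add: emeasure_arc_measure)
  qed
  then have "(\<integral>\<^sup>+x. g x \<partial>M) \<le> (\<integral>\<^sup>+x. g x \<partial>arc_measure \<Gamma>)"
    by (intro nn_integral_mono_measure sets_M)
  moreover have "(\<integral>\<^sup>+x. g x \<partial>M) =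
      ennreal (norm (b - a)) * (\<integral>\<^sup>+t. indicator {0..1} t * g (linepath a b t) \<partial>lborel)"
    unfolding M_def by (simp add: nn_integral_scale_measure nn_integral_distr nn_integral_density)
  ultimately show ?thesis by simp
qed

text \<open>An estimate in place of the divergence theorem. On a line in direction \<open>i\<close>
  the one-dimensional bound leaves twice the sum of \<open>\<bar>F\<bar>\<close> over the crossings
  with edges; integrating over the parallel lines and passing to edge parameters gives arc length
  integrals. The constant is crude, since each edge is charged with the whole boundary integral, but
  the estimate is applied only to boundary values that tend to 0.\<close>

lemma integral_pderiv_le_boundary:
  assumes \<Omega>: "open \<Omega>" "bounded \<Omega>" "\<exists>E. is_edge_set (frontier \<Omega>) E" and F: "smooth F"
  shows "ennreal \<bar>LBINT x. indicator \<Omega> x * pderiv_at i F x\<bar> \<le>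
    of_nat (2 * card (edges_of (frontier \<Omega>))) * (\<integral>\<^sup>+x. ennreal \<bar>F x\<bar> \<partial>arc_measure (frontier \<Omega>))"
proof -
  let ?\<Gamma> = "frontier \<Omega>"
  define E where "E = edges_of ?\<Gamma>"
  have E: "finite E" "(\<Union>(a, b)\<in>E. closed_segment a b) = ?\<Gamma>"
    using is_edge_set_edges_of[OF \<Omega>(3)] by (auto simp: E_def is_edge_set_def)
  \<comment> \<open>Edges parallel to \<open>axis i\<close> lie on lines at finitely many heights
    \<open>t\<close>, which form a null set, so they are discarded.\<close>
  define E' where "E' = {e\<in>E. fst e $ (i + 1) \<noteq> snd e $ (i + 1)}"
  define lp where "lp e = linepath (fst e) (snd e)" for e :: "(real^2) \<times> (real^2)"
  \<comment> \<open>The parameter at which the line through the edge \<open>e\<close> reaches height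
    \<open>t\<close>; the crossing lies on the edge itself if this parameter is in the unit
    interval.\<close>
  define \<tau> where "\<tau> e t = (t - fst e $ (i + 1)) / (snd e $ (i + 1) - fst e $ (i + 1))"
    for e :: "(real^2) \<times> (real^2)" and t
  have finE': "finite E'" using E(1) by (simp add: E'_def)
  have lp_nth: "lp e u $ k = fst e $ k + u * (snd e $ k - fst e $ k)" for e u k
    by (simp add: lp_def linepath_def algebra_simps)
  have lp_\<tau>: "lp e (\<tau> e t) $ (i + 1) = t" if "e \<in> E'" for e t
    using that by (simp add: lp_nth \<tau>_def E'_def)
  have [measurable]: "lp e \<in> borel_measurable borel" "\<tau> e \<in> borel_measurable borel" for e
    unfolding lp_def \<tau>_def by measurable
  have [measurable]: "F \<in> borel_measurable borel" using F by measurable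
  define h where "h t = (\<Sum>e\<in>E'. indicator {0..1} (\<tau> e t) * \<bar>F (lp e (\<tau> e t))\<bar>)" for t
  define G where "G t = (LBINT s. indicator \<Omega> (pt i s t) * pderiv_at i F (pt i s t))" for t
  have cont: "continuous_on UNIV (pderiv_at i F)"
    by (intro continuous_on_smooth smooth_pderiv_at F)
  have slice: "\<bar>G t\<bar> \<le> 2 * h t" if t: "t \<notin> (\<lambda>e. fst e $ (i + 1)) ` E" for t
  proof -
    define I where "I = {e\<in>E'. \<tau> e t \<in> {0..1}}"
    define S where "S = (\<lambda>e. lp e (\<tau> e t) $ i) ` I"
    have finI: "finite I" using finE' by (simp add: I_def)
    have "frontier {s. pt i s t \<in> \<Omega>} \<subseteq> S"
    proof
      fix s assume "s \<in> frontier {s. pt i s t \<in> \<Omega>}"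
      then have "pt i s t \<in> ?\<Gamma>" using frontier_slice(1)[OF \<Omega>(1)] by blast
      then obtain e where e: "e \<in> E" "pt i s t \<in> closed_segment (fst e) (snd e)"
        unfolding E(2)[symmetric] by auto
      then obtain u where u: "u \<in> {0..1}" "pt i s t = lp e u"
        unfolding linepath_image_01[symmetric] lp_def by auto
      from arg_cong[OF u(2), of "\<lambda>x. x $ (i + 1)"]
      have tu: "t = fst e $ (i + 1) + u * (snd e $ (i + 1) - fst e $ (i + 1))"
        by (simp add: lp_nth)
      have ne: "fst e $ (i + 1) \<noteq> snd e $ (i + 1)"
      proof
        assume "fst e $ (i + 1) = snd e $ (i + 1)"
        then have "t = fst e $ (i + 1)" using tu by simp
        then show False using t e(1) by blast
      qed
      then have "\<tau> e t = u" using tu by (simp add: \<tau>_def)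
      moreover from arg_cong[OF u(2), of "\<lambda>x. x $ i"] have "s = lp e u $ i" by simp
      ultimately show "s \<in> S" using u(1) e(1) ne by (auto simp: S_def I_def E'_def)
    qed
    then have "\<bar>LBINT s. indicator {s. pt i s t \<in> \<Omega>} s * pderiv_at i F (pt i s t)\<bar> \<le>
        2 * (\<Sum>s\<in>S. \<bar>F (pt i s t)\<bar>)"
      using finI by (intro integral_derivative_le_frontier frontier_slice(2) bounded_slice \<Omega> DERIV_pt_line F
        continuous_on_compose2[OF cont continuous_on_pt_line]) (auto simp: S_def)
    also have "(\<lambda>s. indicator {s. pt i s t \<in> \<Omega>} s * pderiv_at i F (pt i s t)) =
        (\<lambda>s. indicator \<Omega> (pt i s t) * pderiv_at i F (pt i s t))"
      by (auto simp: indicator_def)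
    \<comment> \<open>Several edges may cross the line in the same point, for instance at a corner,
      so passing from points to edges gives only an inequality.\<close>
    also have "(\<Sum>s\<in>S. \<bar>F (pt i s t)\<bar>) \<le> (\<Sum>e\<in>I. \<bar>F (pt i (lp e (\<tau> e t) $ i) t)\<bar>)"
      unfolding S_def using sum_image_le[OF finI, of "\<lambda>s. \<bar>F (pt i s t)\<bar>" "\<lambda>e. lp e (\<tau> e t) $ i"]
      by (simp add: o_def)
    also have "\<dots> = (\<Sum>e\<in>I. \<bar>F (lp e (\<tau> e t))\<bar>)"
    proof (rule sum.cong[OF refl])
      fix e assume "e \<in> I"
      then have "pt i (lp e (\<tau> e t) $ i) t = lp e (\<tau> e t)"
        using lp_\<tau>[of e t] pt_eta[of i "lp e (\<tau> e t)"] by (simp add: I_def)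
      then show "\<bar>F (pt i (lp e (\<tau> e t) $ i) t)\<bar> = \<bar>F (lp e (\<tau> e t))\<bar>" by simp
    qed
    also have "\<dots> = h t"
      unfolding h_def I_def sum.inter_filter[OF finE'] by (rule sum.cong) (auto simp: indicator_def)
    finally show ?thesis by (simp add: G_def)
  qed
  have int: "integrable lborel (\<lambda>x. indicator \<Omega> x * pderiv_at i F x)"
    using \<Omega> by (intro integrable_indicator_continuous cont) auto
  have G: "(LBINT x. indicator \<Omega> x * pderiv_at i F x) = (LBINT t. G t)" "integrable lborel G"
    unfolding G_def using integral_pt[OF int, of i] by simp_all
  have edge: "(\<integral>\<^sup>+t. indicator {0..1} (\<tau> e t) * ennreal \<bar>F (lp e (\<tau> e t))\<bar> \<partial>lborel) \<le>
      (\<integral>\<^sup>+x. ennreal \<bar>F x\<bar> \<partial>arc_measure ?\<Gamma>)" if e: "e \<in> E'" for e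
  proof -
    \<comment> \<open>The substitution \<open>t = fst e $ (i + 1) + c * u\<close> turns the height
      into the edge parameter. Its factor \<open>\<bar>c\<bar>\<close> is the extent of the edge
      across the lines and is at most the length of the edge.\<close>
    define c where "c = snd e $ (i + 1) - fst e $ (i + 1)"
    have c: "c \<noteq> 0" using e by (simp add: c_def E'_def)
    have \<tau>c: "\<tau> e (fst e $ (i + 1) + c * u) = u" for u
      using c by (simp add: \<tau>_def c_def)
    have "(\<integral>\<^sup>+t. indicator {0..1} (\<tau> e t) * ennreal \<bar>F (lp e (\<tau> e t))\<bar> \<partial>lborel) =
        ennreal \<bar>c\<bar> * (\<integral>\<^sup>+u. indicator {0..1} u * ennreal \<bar>F (lp e u)\<bar> \<partial>lborel)"
      by (subst nn_integral_real_affine[OF _ c, of _ "fst e $ (i + 1)"]) (simp_all add: \<tau>c)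
    also have "\<dots> \<le> ennreal (norm (snd e - fst e)) * (\<integral>\<^sup>+u. indicator {0..1} u * ennreal \<bar>F (lp e u)\<bar> \<partial>lborel)"
      using component_le_norm_cart[of "snd e - fst e" "i + 1"]
      by (intro mult_right_mono) (auto simp: c_def intro: ennreal_leI)
    also have "\<dots> \<le> (\<integral>\<^sup>+x. ennreal \<bar>F x\<bar> \<partial>arc_measure ?\<Gamma>)"
      unfolding lp_def using e E(1) by (intro nn_integral_edge_le) (auto simp: E_def E'_def)
    finally show ?thesis .
  qed
  have "ennreal \<bar>LBINT t. G t\<bar> \<le> (\<integral>\<^sup>+t. ennreal \<bar>G t\<bar> \<partial>lborel)"
    using integral_norm_bound_ennreal[OF G(2)] by simp
  also have "\<dots> \<le> (\<integral>\<^sup>+t. ennreal (2 * h t) \<partial>lborel)"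
  proof (rule nn_integral_mono_AE)
    have "AE t in lborel. t \<notin> (\<lambda>e. fst e $ (i + 1)) ` E"
      using E(1) by (intro AE_not_in finite_imp_null_set_lborel) simp
    then show "AE t in lborel. ennreal \<bar>G t\<bar> \<le> ennreal (2 * h t)"
      by eventually_elim (intro ennreal_leI slice)
  qed
  also have "\<dots> = (\<integral>\<^sup>+t. 2 * (\<Sum>e\<in>E'. indicator {0..1} (\<tau> e t) * ennreal \<bar>F (lp e (\<tau> e t))\<bar>) \<partial>lborel)"
  proof (rule nn_integral_cong)
    fix t
    have "ennreal (h t) = (\<Sum>e\<in>E'. ennreal (indicator {0..1} (\<tau> e t) * \<bar>F (lp e (\<tau> e t))\<bar>))"
      unfolding h_def by (rule sum_ennreal[symmetric]) auto
    also have "\<dots> = (\<Sum>e\<in>E'. indicator {0..1} (\<tau> e t) * ennreal \<bar>F (lp e (\<tau> e t))\<bar>)"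
      by (rule sum.cong[OF refl]) (simp add: indicator_def)
    finally show "ennreal (2 * h t) = 2 * (\<Sum>e\<in>E'. indicator {0..1} (\<tau> e t) * ennreal \<bar>F (lp e (\<tau> e t))\<bar>)"
      by (simp add: ennreal_mult')
  qed
  also have "\<dots> = 2 * (\<Sum>e\<in>E'. \<integral>\<^sup>+t. indicator {0..1} (\<tau> e t) * ennreal \<bar>F (lp e (\<tau> e t))\<bar> \<partial>lborel)"
    by (subst nn_integral_cmult, measurable, subst nn_integral_sum) auto
  also have "\<dots> \<le> 2 * (\<Sum>e\<in>E'. \<integral>\<^sup>+x. ennreal \<bar>F x\<bar> \<partial>arc_measure ?\<Gamma>)"
    by (intro mult_left_mono sum_mono edge) auto
  also have "\<dots> \<le> 2 * (of_nat (card E) * (\<integral>\<^sup>+x. ennreal \<bar>F x\<bar> \<partial>arc_measure ?\<Gamma>))"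
  proof -
    have "card E' \<le> card E" using E(1) by (intro card_mono) (auto simp: E'_def)
    then show ?thesis by (auto intro!: mult_left_mono mult_right_mono)
  qed
  finally show ?thesis by (simp add: G(1) E_def mult.assoc)
qed

section \<open>Weak derivatives\<close>

lemma sq_int_continuous_bounded_support:
  assumes "continuous_on UNIV f" "bounded {x. f x \<noteq> 0}"
  shows "sq_int f"
proof -
  obtain r where r: "{x. f x \<noteq> 0} \<subseteq> cball 0 r"
    using assms(2) unfolding bounded_iff subset_iff mem_cball_0 by blast
  then have "(\<lambda>x. (f x)\<^sup>2) = (\<lambda>x. indicator (cball 0 r) x * (f x)\<^sup>2)"
    by (fastforce simp: fun_eq_iff indicator_def)
  moreover have "integrable lborel (\<lambda>x. indicator (cball 0 r) x * (f x)\<^sup>2)"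
    using assms(1) by (intro integrable_indicator_continuous continuous_intros) auto
  ultimately show ?thesis
    using assms(1) by (simp add: sq_int_def borel_measurable_continuous_onI)
qed

lemma test_functionD:
  assumes "\<phi> \<in> test_functions \<Omega>"
  shows "smooth \<phi>" "bounded {x. \<phi> x \<noteq> 0}" "\<And>x. x \<notin> \<Omega> \<Longrightarrow> \<phi> x = 0" "sq_int \<phi>"
proof -
  show s: "smooth \<phi>" using assms by (simp add: test_functions_def)
  have "bounded (closure {x. \<phi> x \<noteq> 0})"
    using assms by (intro compact_imp_bounded) (simp add: test_functions_def)
  then show b: "bounded {x. \<phi> x \<noteq> 0}" using bounded_subset closure_subset by blast
  show "\<phi> x = 0" if "x \<notin> \<Omega>" for x
    using assms that closure_subset[of "{x. \<phi> x \<noteq> 0}"] unfolding test_functions_def by blast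
  show "sq_int \<phi>" by (intro sq_int_continuous_bounded_support continuous_on_smooth s b)
qed

lemma sq_int_indicator_continuous:
  assumes "continuous_on UNIV f" "bounded \<Omega>" "\<Omega> \<in> sets borel"
  shows "sq_int (\<lambda>x. indicator \<Omega> x * f x)"
proof -
  have "integrable lborel (\<lambda>x. indicator \<Omega> x * (f x)\<^sup>2)"
    using assms by (intro integrable_indicator_continuous continuous_intros) auto
  moreover have "(indicator \<Omega> x * f x)\<^sup>2 = indicator \<Omega> x * (f x)\<^sup>2" for x
    by (simp add: indicator_def)
  moreover have "(\<lambda>x. indicator \<Omega> x * f x) \<in> borel_measurable borel"
    using assms(3) borel_measurable_continuous_onI[OF assms(1)] by measurable
  ultimately show ?thesis by (simp add: sq_int_def)
qed

section \<open>The fundamental lemma of the calculus of variations\<close>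

lemma integral_box_eq_0:
  assumes f: "sq_int f" "\<And>\<phi>. \<phi> \<in> test_functions \<Omega> \<Longrightarrow> (LBINT x. f x * \<phi> x) = 0"
    and ab: "cbox a b \<subseteq> \<Omega>"
  shows "(LBINT x. f x * indicator (box a b) x) = 0"
proof -
  obtain \<phi> where \<phi>: "\<And>n. \<phi> n \<in> test_functions \<Omega>" "\<And>n x. 0 \<le> \<phi> n x"
    "\<And>n x. \<phi> n x \<le> indicator (box a b) x" "\<And>x. (\<lambda>n. \<phi> n x) \<longlonglongrightarrow> indicator (box a b) x"
    using test_functions_approximate_box[OF ab] by blast
  have [measurable]: "f \<in> borel_measurable borel" "\<And>n. \<phi> n \<in> borel_measurable borel"
    using f(1) \<phi>(1) by (auto simp: sq_int_def intro: borel_measurable_smooth test_functionD)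
  have "(\<lambda>n. LBINT x. f x * \<phi> n x) \<longlonglongrightarrow> (LBINT x. f x * indicator (box a b) x)"
  proof (rule integral_dominated_convergence[where w="\<lambda>x. \<bar>f x * indicator (box a b) x\<bar>"])
    have "sq_int (\<lambda>x. indicator (box a b) x * 1)"
      by (intro sq_int_indicator_continuous) auto
    then show "integrable lborel (\<lambda>x. \<bar>f x * indicator (box a b) x\<bar>)"
      using sq_int_mult_integrable[OF f(1)] by (intro integrable_abs) simp
    show "AE x in lborel. (\<lambda>n. f x * \<phi> n x) \<longlonglongrightarrow> f x * indicator (box a b) x"
      by (intro AE_I2 tendsto_intros \<phi>)
    show "AE x in lborel. norm (f x * \<phi> n x) \<le> \<bar>f x * indicator (box a b) x\<bar>" for n
      using \<phi>(2,3)[of n] by (intro AE_I2) (simp add: abs_mult mult_left_mono)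
  qed measurable
  moreover have "(LBINT x. f x * \<phi> n x) = 0" for n by (intro f \<phi>)
  ultimately show ?thesis using LIMSEQ_unique[OF tendsto_const] by fastforce
qed

text \<open>Boxes are stable under intersection and generate the Borel sets, so vanishing box
  integrals extend to all Borel sets by a Dynkin argument, and an integrable function with vanishing
  set integrals is zero. Restricting to one box makes \<open>g\<close> integrable and gives it total
  integral 0, which the step to complements uses.\<close>

lemma AE_zero_on_box:
  fixes f :: "real^2 \<Rightarrow> real"
  assumes f: "sq_int f" "\<And>a b. cbox a b \<subseteq> \<Omega> \<Longrightarrow> (LBINT x. f x * indicator (box a b) x) = 0"
    and cd: "cbox c d \<subseteq> \<Omega>"
  shows "AE x in lborel. x \<in> box c d \<longrightarrow> f x = 0"
proof -
  define g where "g x = f x * indicator (box c d) x" for x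
  have "sq_int (\<lambda>x. indicator (box c d) x * 1)"
    by (intro sq_int_indicator_continuous) auto
  then have g: "integrable lborel g"
    unfolding g_def using sq_int_mult_integrable[OF f(1)] by simp
  then have gA: "integrable lborel (\<lambda>x. indicator A x *\<^sub>R g x)" if "A \<in> sets borel" for A
    using that by (intro integrable_mult_indicator) auto
  have total: "(LBINT x. g x) = 0" unfolding g_def by (rule f(2)[OF cd])
  have stable: "Int_stable (range (\<lambda>(a, b). box a (b::real^2)))" "range (\<lambda>(a, b). box a (b::real^2)) \<subseteq> Pow UNIV"
    by (auto simp: Int_stable_def box_Int_box)
  have "set_lebesgue_integral lborel A g = 0" if "A \<in> sigma_sets UNIV (range (\<lambda>(a, b). box a b))" for A
    using stable that
  proof (induction rule: sigma_sets_induct_disjoint)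
    case (basic A)
    then obtain a b where A: "A = box a b" by auto
    obtain l u where lu: "box a b \<inter> box c d = box l u" by (auto simp: box_Int_box)
    show ?case
    proof (cases "box l u = {}")
      case True
      have "(LBINT x. indicator A x *\<^sub>R g x) = (\<integral>x. 0 \<partial>(lborel :: (real^2) measure))"
        by (intro Bochner_Integration.integral_cong) (use lu A True in \<open>auto simp: g_def indicator_def\<close>)
      then show ?thesis by (simp only: set_lebesgue_integral_def Bochner_Integration.integral_zero)
    next
      case False
      \<comment> \<open>Nonemptiness enters here: it makes the closed box the closure of the open
        one, which then stays inside \<open>cbox c d\<close>.\<close>
      then have "cbox l u = closure (box l u)" by (rule closure_box[symmetric])
      also have "\<dots> \<subseteq> closure (box c d)" using lu by (intro closure_mono) auto
      also have "\<dots> \<subseteq> cbox c d" using box_subset_cbox by (intro closure_minimal) auto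
      finally have "cbox l u \<subseteq> \<Omega>" using cd by auto
      then have "(LBINT x. f x * indicator (box l u) x) = 0" by (rule f(2))
      moreover have "indicator A x *\<^sub>R g x = f x * indicator (box l u) x" for x
        unfolding A lu[symmetric] by (simp add: g_def indicator_def)
      ultimately show ?thesis by (simp add: set_lebesgue_integral_def)
    qed
  next
    case (compl A)
    then have A: "A \<in> sets borel" by (simp add: borel_eq_box)
    have "(LBINT x. indicator (UNIV - A) x *\<^sub>R g x) = (LBINT x. g x - indicator A x *\<^sub>R g x)"
      by (intro Bochner_Integration.integral_cong) (auto simp: indicator_def)
    also have "\<dots> = 0"
      using compl g gA[OF A] total by (simp add: set_lebesgue_integral_def)
    finally show ?case by (simp add: set_lebesgue_integral_def)
  next
    case (union A)
    then have A: "A i \<in> sets lborel" for i by (auto simp: borel_eq_box)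
    have "set_lebesgue_integral lborel (\<Union>i. A i) g = (\<Sum>i. set_lebesgue_integral lborel (A i) g)"
    proof (rule lebesgue_integral_countable_add[OF A])
      show "A i \<inter> A j = {}" if "i \<noteq> j" for i j
        using union(1) that by (auto simp: disjoint_family_on_def)
      show "set_integrable lborel (\<Union>i. A i) g"
        unfolding set_integrable_def using A by (intro gA) auto
    qed
    then show ?case using union by simp
  qed (auto simp: set_lebesgue_integral_def)
  then have "AE x in lborel. g x = 0"
    using g by (intro sigma_finite_measure.density_zero[OF sigma_finite_lborel]) (auto simp: borel_eq_box)
  then show ?thesis by eventually_elim (auto simp: g_def)
qed

text \<open>Open boxes whose closed boxes lie in \<open>\<Omega>\<close> cover
  \<open>\<Omega>\<close>; a countable subcover merges the exceptional null sets of the individual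
  boxes into one.\<close>

lemma AE_zero_if_orthogonal_to_test_functions:
  assumes \<Omega>: "open \<Omega>" and f: "sq_int f" "\<And>\<phi>. \<phi> \<in> test_functions \<Omega> \<Longrightarrow> (LBINT x. f x * \<phi> x) = 0"
  shows "AE x in lborel. x \<in> \<Omega> \<longrightarrow> f x = 0"
proof -
  define \<B> where "\<B> = {box a b | a b :: real^2. cbox a b \<subseteq> \<Omega>}"
  have cover: "\<Omega> \<subseteq> \<Union>\<B>"
  proof
    fix x assume "x \<in> \<Omega>"
    then obtain e where e: "e > 0" "cball x e \<subseteq> \<Omega>"
      using \<Omega> open_contains_cball by blast
    obtain a b where ab: "x \<in> box a b" "box a b \<subseteq> ball x e"
      using rational_boxes[OF e(1), of x] by blast
    have "cbox a b = closure (box a b)" using ab(1) by (metis closure_box empty_iff)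
    also have "\<dots> \<subseteq> cball x e" using ab(2) ball_subset_cball by (intro closure_minimal) auto
    finally show "x \<in> \<Union>\<B>" using ab(1) e(2) unfolding \<B>_def by blast
  qed
  obtain \<B>' where \<B>': "\<B>' \<subseteq> \<B>" "countable \<B>'" "\<Union>\<B>' = \<Union>\<B>"
    using Lindelof[of \<B>] by (force simp: \<B>_def)
  have "AE x in lborel. x \<in> S \<longrightarrow> f x = 0" if S: "S \<in> \<B>'" for S
  proof -
    obtain a b where "S = box a b" "cbox a b \<subseteq> \<Omega>"
      using subsetD[OF \<B>'(1) S] unfolding \<B>_def by blast
    then show ?thesis using AE_zero_on_box[OF f(1) integral_box_eq_0[OF f]] by simp
  qed
  then have "AE x in lborel. \<forall>S\<in>\<B>'. x \<in> S \<longrightarrow> f x = 0"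
    unfolding AE_ball_countable[OF \<B>'(2)] by blast
  then show ?thesis
  proof eventually_elim
    case (elim x)
    show ?case
    proof
      assume "x \<in> \<Omega>"
      then obtain S where "S \<in> \<B>'" "x \<in> S" using cover \<B>'(3) by blast
      then show "f x = 0" using elim by blast
    qed
  qed
qed

lemma ip_add_left_L2:
  assumes "f \<in> L2 \<Omega>" "g \<in> L2 \<Omega>" "h \<in> L2 \<Omega>'"
  shows "ip (f + g) h = ip f h + ip g h"
  by (rule ip_add_left[OF assms[THEN sq_int_rep]])

lemma ip_add_right_L2:
  assumes "f \<in> L2 \<Omega>" "g \<in> L2 \<Omega>" "h \<in> L2 \<Omega>'"
  shows "ip h (f + g) = ip h f + ip h g"
  unfolding ip_commute[of h] by (rule ip_add_left_L2[OF assms])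

lemma ip_scaleR_right: "ip g (c *\<^sub>R f) = c * ip g f"
  unfolding ip_commute[of g] by (rule ip_scaleR_left)

lemma ip_diff_left_L2:
  assumes "f \<in> L2 \<Omega>" "g \<in> L2 \<Omega>" "h \<in> L2 \<Omega>'"
  shows "ip (f - g) h = ip f h - ip g h"
proof -
  have "ip (f + (-1) *\<^sub>R g) h = ip f h + ip ((-1) *\<^sub>R g) h"
    using assms by (intro ip_add_left_L2[of _ \<Omega> _ _ \<Omega>'] subspace_scale[OF subspace_L2])
  then show ?thesis using ip_scaleR_left[of "-1" g h] by simp
qed

lemma test_class_in_L2: "\<phi> \<in> test_functions \<Omega> \<Longrightarrow> ae_class \<phi> \<in> L2 \<Omega>"
  by (rule ae_class_in_L2) (simp_all add: test_functionD(3,4))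

lemma L2_eq_0_if_orthogonal_to_test_functions:
  assumes "open \<Omega>" "f \<in> L2 \<Omega>" "\<And>\<phi>. \<phi> \<in> test_functions \<Omega> \<Longrightarrow> ip f (ae_class \<phi>) = 0"
  shows "f = 0"
proof -
  have "AE x in lborel. x \<in> \<Omega> \<longrightarrow> rep_ae_fun f x = 0"
    using assms(3) by (intro AE_zero_if_orthogonal_to_test_functions assms sq_int_rep[OF assms(2)])
      (simp add: ip_ae_class borel_measurable_smooth test_functionD)
  moreover have "AE x in lborel. x \<notin> \<Omega> \<longrightarrow> rep_ae_fun f x = 0"
    using assms(2) by (simp add: L2_iff)
  ultimately have "AE x in lborel. rep_ae_fun f x = rep_ae_fun 0 x"
    using AE_rep_zero by eventually_elim auto
  then show ?thesis by (rule ae_fun_eqI)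
qed

lemma L2_eq_if_test_functions:
  assumes "open \<Omega>" "f \<in> L2 \<Omega>" "g \<in> L2 \<Omega>"
    "\<And>\<phi>. \<phi> \<in> test_functions \<Omega> \<Longrightarrow> ip f (ae_class \<phi>) = ip g (ae_class \<phi>)"
  shows "f = g"
proof -
  have "f - g = 0"
  proof (rule L2_eq_0_if_orthogonal_to_test_functions[OF assms(1)])
    show "f - g \<in> L2 \<Omega>" using assms by (intro subspace_diff subspace_L2)
    show "ip (f - g) (ae_class \<phi>) = 0" if "\<phi> \<in> test_functions \<Omega>" for \<phi>
      using assms(4)[OF that] by (simp add: ip_diff_left_L2[OF assms(2,3) test_class_in_L2[OF that]])
  qed
  then show ?thesis by simp
qed

text \<open>By the fundamental lemma a weak derivative in \<open>L2 \<Omega>\<close> is unique, so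
  the definite description in \<open>wderiv\<close> denotes whichever one is exhibited.\<close>

lemma wderiv_eqI:
  assumes "open \<Omega>" "g \<in> L2 \<Omega>" "weak_partial \<Omega> i f g"
  shows "wderiv \<Omega> i f = g"
  unfolding wderiv_def
proof (rule the_equality)
  show "g \<in> L2 \<Omega> \<and> weak_partial \<Omega> i f g" using assms by simp
  fix g' assume g': "g' \<in> L2 \<Omega> \<and> weak_partial \<Omega> i f g'"
  show "g' = g"
    using assms(3) g' by (intro L2_eq_if_test_functions[OF assms(1) _ assms(2)]) (auto simp: weak_partial_def)
qed

lemma H1_L2: "f \<in> H1 \<Omega> \<Longrightarrow> f \<in> L2 \<Omega>"
  by (simp add: H1_def)

lemma wderiv_H1:
  assumes "open \<Omega>" "f \<in> H1 \<Omega>"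
  shows "wderiv \<Omega> i f \<in> L2 \<Omega>" "weak_partial \<Omega> i f (wderiv \<Omega> i f)"
proof -
  obtain g where "g \<in> L2 \<Omega>" "weak_partial \<Omega> i f g" using assms(2) by (auto simp: H1_def)
  then show "wderiv \<Omega> i f \<in> L2 \<Omega>" "weak_partial \<Omega> i f (wderiv \<Omega> i f)"
    using wderiv_eqI[OF assms(1)] by auto
qed

lemma weak_partial_add:
  assumes "f \<in> L2 \<Omega>" "f' \<in> L2 \<Omega>" "g \<in> L2 \<Omega>" "g' \<in> L2 \<Omega>"
    "weak_partial \<Omega> i f g" "weak_partial \<Omega> i f' g'"
  shows "weak_partial \<Omega> i (f + f') (g + g')"
  unfolding weak_partial_def
proof
  fix \<phi> assume \<phi>: "\<phi> \<in> test_functions \<Omega>"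
  show "ip (f + f') (ae_class (pderiv_at i \<phi>)) = - ip (g + g') (ae_class \<phi>)"
    using bspec[OF assms(5)[unfolded weak_partial_def] \<phi>] bspec[OF assms(6)[unfolded weak_partial_def] \<phi>]
      ip_add_left_L2[OF assms(1,2) test_class_in_L2[OF pderiv_at_test_function[OF \<phi>]]]
      ip_add_left_L2[OF assms(3,4) test_class_in_L2[OF \<phi>]]
    by simp
qed

lemma weak_partial_scaleR: "weak_partial \<Omega> i f g \<Longrightarrow> weak_partial \<Omega> i (c *\<^sub>R f) (c *\<^sub>R g)"
  unfolding weak_partial_def by (auto simp: ip_scaleR_left)

lemma weak_partial_zero: "weak_partial \<Omega> i 0 0"
  by (simp add: weak_partial_def)

lemma subspace_H1: "open \<Omega> \<Longrightarrow> subspace (H1 \<Omega>)"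
proof (rule subspaceI)
  assume \<Omega>: "open \<Omega>"
  show "0 \<in> H1 \<Omega>"
    using weak_partial_zero subspace_0[OF subspace_L2] by (auto simp: H1_def)
next
  fix f g assume \<Omega>: "open \<Omega>" and fg: "f \<in> H1 \<Omega>" "g \<in> H1 \<Omega>"
  have "weak_partial \<Omega> i (f + g) (wderiv \<Omega> i f + wderiv \<Omega> i g)"
    "wderiv \<Omega> i f + wderiv \<Omega> i g \<in> L2 \<Omega>" for i
    using wderiv_H1[OF \<Omega> fg(1), of i] wderiv_H1[OF \<Omega> fg(2), of i] fg[THEN H1_L2]
    by (simp_all add: weak_partial_add subspace_add[OF subspace_L2])
  moreover have "f + g \<in> L2 \<Omega>" using fg[THEN H1_L2] by (simp add: subspace_add[OF subspace_L2])
  ultimately show "f + g \<in> H1 \<Omega>" unfolding H1_def by blast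
next
  fix c f assume \<Omega>: "open \<Omega>" and f: "f \<in> H1 \<Omega>"
  have "weak_partial \<Omega> i (c *\<^sub>R f) (c *\<^sub>R wderiv \<Omega> i f)" "c *\<^sub>R wderiv \<Omega> i f \<in> L2 \<Omega>" for i
    using wderiv_H1[OF \<Omega> f, of i] by (simp_all add: weak_partial_scaleR subspace_scale[OF subspace_L2])
  moreover have "c *\<^sub>R f \<in> L2 \<Omega>" using f[THEN H1_L2] by (simp add: subspace_scale[OF subspace_L2])
  ultimately show "c *\<^sub>R f \<in> H1 \<Omega>" unfolding H1_def by blast
qed

lemma wderiv_add:
  assumes "open \<Omega>" "f \<in> H1 \<Omega>" "g \<in> H1 \<Omega>"
  shows "wderiv \<Omega> i (f + g) = wderiv \<Omega> i f + wderiv \<Omega> i g"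
  by (rule wderiv_eqI[OF assms(1) subspace_add[OF subspace_L2] weak_partial_add])
    (rule wderiv_H1[OF assms(1,2)] wderiv_H1[OF assms(1,3)] assms(2,3)[THEN H1_L2])+

lemma wderiv_scaleR:
  assumes "open \<Omega>" "f \<in> H1 \<Omega>"
  shows "wderiv \<Omega> i (c *\<^sub>R f) = c *\<^sub>R wderiv \<Omega> i f"
  by (rule wderiv_eqI[OF assms(1) subspace_scale[OF subspace_L2] weak_partial_scaleR])
    (rule wderiv_H1[OF assms])+

lemma wderiv_diff:
  assumes "open \<Omega>" "f \<in> H1 \<Omega>" "g \<in> H1 \<Omega>"
  shows "wderiv \<Omega> i (f - g) = wderiv \<Omega> i f - wderiv \<Omega> i g"
  using wderiv_add[OF assms(1,2), of "(-1) *\<^sub>R g" i] wderiv_scaleR[OF assms(1,3), of i "-1"]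
    subspace_scale[OF subspace_H1[OF assms(1)] assms(3), of "-1"] by simp

lemma wderiv_zero: "open \<Omega> \<Longrightarrow> wderiv \<Omega> i 0 = 0"
  by (intro wderiv_eqI weak_partial_zero subspace_0[OF subspace_L2])

lemma grad_add: "open \<Omega> \<Longrightarrow> f \<in> H1 \<Omega> \<Longrightarrow> g \<in> H1 \<Omega> \<Longrightarrow> grad \<Omega> (f + g) = grad \<Omega> f + grad \<Omega> g"
  by (simp add: grad_def wderiv_add)

lemma grad_scaleR: "open \<Omega> \<Longrightarrow> f \<in> H1 \<Omega> \<Longrightarrow> grad \<Omega> (c *\<^sub>R f) = c *\<^sub>R grad \<Omega> f"
  by (simp add: grad_def wderiv_scaleR)

lemma grad_diff: "open \<Omega> \<Longrightarrow> f \<in> H1 \<Omega> \<Longrightarrow> g \<in> H1 \<Omega> \<Longrightarrow> grad \<Omega> (f - g) = grad \<Omega> f - grad \<Omega> g"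
  by (simp add: grad_def wderiv_diff)

lemma grad_zero: "open \<Omega> \<Longrightarrow> grad \<Omega> 0 = 0"
  by (simp add: grad_def wderiv_zero zero_prod_def)

section \<open>The distributional curl and the space on which it is defined\<close>

definition Hcurl :: "(real^2) set \<Rightarrow> ae_field set" where
  "Hcurl \<Omega> = {\<eta> \<in> L2 \<Omega> \<times> L2 \<Omega>. \<exists>c\<in>L2 \<Omega>. weak_curl \<Omega> \<eta> c}"

lemma curl_eqI:
  assumes "open \<Omega>" "c \<in> L2 \<Omega>" "weak_curl \<Omega> \<eta> c"
  shows "curl \<Omega> \<eta> = c"
  unfolding curl_def
proof (rule the_equality)
  show "c \<in> L2 \<Omega> \<and> weak_curl \<Omega> \<eta> c" using assms by simp
  fix c' assume c': "c' \<in> L2 \<Omega> \<and> weak_curl \<Omega> \<eta> c'"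
  show "c' = c"
    using assms(3) c' by (intro L2_eq_if_test_functions[OF assms(1) _ assms(2)]) (auto simp: weak_curl_def)
qed

lemma curl_Hcurl:
  assumes "open \<Omega>" "\<eta> \<in> Hcurl \<Omega>"
  shows "curl \<Omega> \<eta> \<in> L2 \<Omega>" "weak_curl \<Omega> \<eta> (curl \<Omega> \<eta>)"
proof -
  obtain c where "c \<in> L2 \<Omega>" "weak_curl \<Omega> \<eta> c" using assms(2) by (auto simp: Hcurl_def)
  then show "curl \<Omega> \<eta> \<in> L2 \<Omega>" "weak_curl \<Omega> \<eta> (curl \<Omega> \<eta>)"
    using curl_eqI[OF assms(1)] by auto
qed

lemma Hcurl_L2: "\<eta> \<in> Hcurl \<Omega> \<Longrightarrow> fst \<eta> \<in> L2 \<Omega>" "\<eta> \<in> Hcurl \<Omega> \<Longrightarrow> snd \<eta> \<in> L2 \<Omega>"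
  by (auto simp: Hcurl_def)

lemma weak_curl_add:
  assumes "\<eta> \<in> L2 \<Omega> \<times> L2 \<Omega>" "\<eta>' \<in> L2 \<Omega> \<times> L2 \<Omega>" "c \<in> L2 \<Omega>" "c' \<in> L2 \<Omega>"
    "weak_curl \<Omega> \<eta> c" "weak_curl \<Omega> \<eta>' c'"
  shows "weak_curl \<Omega> (\<eta> + \<eta>') (c + c')"
  unfolding weak_curl_def
proof
  fix \<phi> assume \<phi>: "\<phi> \<in> test_functions \<Omega>"
  have "ip (f + g) (ae_class \<phi>) = ip f (ae_class \<phi>) + ip g (ae_class \<phi>)"
    "ip (f + g) (ae_class (pderiv_at i \<phi>)) = ip f (ae_class (pderiv_at i \<phi>)) + ip g (ae_class (pderiv_at i \<phi>))"
    if "f \<in> L2 \<Omega>" "g \<in> L2 \<Omega>" for f g i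
    using that \<phi> by (auto intro!: ip_add_left_L2 test_class_in_L2 pderiv_at_test_function)
  moreover have "fst \<eta> \<in> L2 \<Omega>" "snd \<eta> \<in> L2 \<Omega>" "fst \<eta>' \<in> L2 \<Omega>" "snd \<eta>' \<in> L2 \<Omega>"
    using assms(1,2) by auto
  ultimately show "ip (snd (\<eta> + \<eta>')) (ae_class (pderiv_at 1 \<phi>)) - ip (fst (\<eta> + \<eta>')) (ae_class (pderiv_at 2 \<phi>)) =
      - ip (c + c') (ae_class \<phi>)"
    using bspec[OF assms(5)[unfolded weak_curl_def] \<phi>] bspec[OF assms(6)[unfolded weak_curl_def] \<phi>] assms(3,4)
    by simp
qed

lemma weak_curl_scaleR: "weak_curl \<Omega> \<eta> c \<Longrightarrow> weak_curl \<Omega> (k *\<^sub>R \<eta>) (k *\<^sub>R c)"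
  unfolding weak_curl_def
proof
  fix \<phi>
  assume "\<forall>\<phi>\<in>test_functions \<Omega>. ip (snd \<eta>) (ae_class (pderiv_at 1 \<phi>)) -
      ip (fst \<eta>) (ae_class (pderiv_at 2 \<phi>)) = - ip c (ae_class \<phi>)" "\<phi> \<in> test_functions \<Omega>"
  then have "k * (ip (snd \<eta>) (ae_class (pderiv_at 1 \<phi>)) - ip (fst \<eta>) (ae_class (pderiv_at 2 \<phi>))) =
      k * - ip c (ae_class \<phi>)" by simp
  then show "ip (snd (k *\<^sub>R \<eta>)) (ae_class (pderiv_at 1 \<phi>)) -
      ip (fst (k *\<^sub>R \<eta>)) (ae_class (pderiv_at 2 \<phi>)) = - ip (k *\<^sub>R c) (ae_class \<phi>)"
    by (simp only: fst_scaleR snd_scaleR ip_scaleR_left right_diff_distrib mult_minus_right)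
qed

lemma subspace_Hcurl: "subspace (Hcurl \<Omega>)"
proof (rule subspaceI)
  have "weak_curl \<Omega> 0 0" by (simp add: weak_curl_def)
  then show "0 \<in> Hcurl \<Omega>" by (auto simp: Hcurl_def zero_prod_def subspace_0[OF subspace_L2])
  show "\<eta> + \<eta>' \<in> Hcurl \<Omega>" if H: "\<eta> \<in> Hcurl \<Omega>" "\<eta>' \<in> Hcurl \<Omega>" for \<eta> \<eta>'
  proof -
    obtain c c' where c: "c \<in> L2 \<Omega>" "c' \<in> L2 \<Omega>" "weak_curl \<Omega> \<eta> c" "weak_curl \<Omega> \<eta>' c'"
      using H unfolding Hcurl_def by blast
    have L: "\<eta> \<in> L2 \<Omega> \<times> L2 \<Omega>" "\<eta>' \<in> L2 \<Omega> \<times> L2 \<Omega>" using H by (auto simp: Hcurl_def)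
    then have "\<eta> + \<eta>' \<in> L2 \<Omega> \<times> L2 \<Omega>"
      by (auto simp: plus_prod_def intro!: subspace_add[OF subspace_L2])
    moreover have "weak_curl \<Omega> (\<eta> + \<eta>') (c + c')" by (rule weak_curl_add[OF L c])
    moreover have "c + c' \<in> L2 \<Omega>" using c by (intro subspace_add[OF subspace_L2])
    ultimately show ?thesis by (auto simp: Hcurl_def)
  qed
  show "k *\<^sub>R \<eta> \<in> Hcurl \<Omega>" if H: "\<eta> \<in> Hcurl \<Omega>" for k \<eta>
  proof -
    obtain c where c: "c \<in> L2 \<Omega>" "weak_curl \<Omega> \<eta> c" using H unfolding Hcurl_def by blast
    moreover have "k *\<^sub>R \<eta> \<in> L2 \<Omega> \<times> L2 \<Omega>"
      using H by (auto simp: Hcurl_def intro!: subspace_scale[OF subspace_L2])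
    ultimately show ?thesis
      using weak_curl_scaleR[OF c(2), of k] subspace_scale[OF subspace_L2 c(1), of k]
      unfolding Hcurl_def by blast
  qed
qed

lemma curl_add:
  assumes "open \<Omega>" "\<eta> \<in> Hcurl \<Omega>" "\<eta>' \<in> Hcurl \<Omega>"
  shows "curl \<Omega> (\<eta> + \<eta>') = curl \<Omega> \<eta> + curl \<Omega> \<eta>'"
  by (rule curl_eqI[OF assms(1) subspace_add[OF subspace_L2] weak_curl_add])
    (simp_all add: curl_Hcurl[OF assms(1,2)] curl_Hcurl[OF assms(1,3)] Hcurl_L2[OF assms(2)] Hcurl_L2[OF assms(3)] mem_Times_iff)

lemma curl_scaleR:
  assumes "open \<Omega>" "\<eta> \<in> Hcurl \<Omega>"
  shows "curl \<Omega> (k *\<^sub>R \<eta>) = k *\<^sub>R curl \<Omega> \<eta>"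
  by (rule curl_eqI[OF assms(1) subspace_scale[OF subspace_L2] weak_curl_scaleR])
    (rule curl_Hcurl[OF assms])+

lemma curl_diff:
  assumes "open \<Omega>" "\<eta> \<in> Hcurl \<Omega>" "\<eta>' \<in> Hcurl \<Omega>"
  shows "curl \<Omega> (\<eta> - \<eta>') = curl \<Omega> \<eta> - curl \<Omega> \<eta>'"
  using curl_add[OF assms(1,2), of "(-1) *\<^sub>R \<eta>'"] curl_scaleR[OF assms(1,3), of "-1"]
    subspace_scale[OF subspace_Hcurl assms(3), of "-1"] by simp

lemma H1_fields_Hcurl:
  assumes "open \<Omega>" "\<psi> \<in> H1 \<Omega> \<times> H1 \<Omega>"
  shows "\<psi> \<in> Hcurl \<Omega>"
proof -
  have \<psi>: "fst \<psi> \<in> H1 \<Omega>" "snd \<psi> \<in> H1 \<Omega>" using assms by auto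
  let ?c = "wderiv \<Omega> 1 (snd \<psi>) - wderiv \<Omega> 2 (fst \<psi>)"
  have L: "wderiv \<Omega> 1 (snd \<psi>) \<in> L2 \<Omega>" "wderiv \<Omega> 2 (fst \<psi>) \<in> L2 \<Omega>"
    using wderiv_H1[OF assms(1)] \<psi> by auto
  have "weak_curl \<Omega> \<psi> ?c"
    using wderiv_H1(2)[OF assms(1) \<psi>(2), of 1] wderiv_H1(2)[OF assms(1) \<psi>(1), of 2]
    by (auto simp: weak_curl_def weak_partial_def ip_diff_left_L2[OF L test_class_in_L2])
  moreover have "?c \<in> L2 \<Omega>" using L by (intro subspace_diff[OF subspace_L2])
  ultimately show ?thesis using \<psi> by (auto simp: Hcurl_def mem_Times_iff intro: H1_L2)
qed

text \<open>In the weak formulation both derivatives end up on the test function, whose mixed second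
  derivatives commute.\<close>

lemma
  assumes "open \<Omega>" "v \<in> H1 \<Omega>"
  shows grad_Hcurl: "grad \<Omega> v \<in> Hcurl \<Omega>" and curl_grad: "curl \<Omega> (grad \<Omega> v) = 0"
proof -
  have w: "weak_curl \<Omega> (grad \<Omega> v) 0"
    unfolding weak_curl_def
  proof
    fix \<phi> assume \<phi>: "\<phi> \<in> test_functions \<Omega>"
    have "ip (wderiv \<Omega> i v) (ae_class (pderiv_at j \<phi>)) = - ip v (ae_class (pderiv_at i (pderiv_at j \<phi>)))" for i j
      using wderiv_H1(2)[OF assms, of i] pderiv_at_test_function[OF \<phi>, of j] by (auto simp: weak_partial_def)
    then show "ip (snd (grad \<Omega> v)) (ae_class (pderiv_at 1 \<phi>)) - ip (fst (grad \<Omega> v)) (ae_class (pderiv_at 2 \<phi>)) =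
        - ip 0 (ae_class \<phi>)"
      using pderiv_at_commute[OF test_functionD(1)[OF \<phi>], of 1 2] by (simp add: grad_def)
  qed
  have z: "0 \<in> L2 \<Omega>" by (rule subspace_0[OF subspace_L2])
  show "grad \<Omega> v \<in> Hcurl \<Omega>"
    using w z wderiv_H1(1)[OF assms] by (auto simp: Hcurl_def grad_def)
  show "curl \<Omega> (grad \<Omega> v) = 0" by (rule curl_eqI[OF assms(1) z w])
qed

section \<open>Smooth functions restricted to the domain\<close>

lemma integral_by_parts_test:
  assumes u: "smooth u" and \<phi>: "smooth \<phi>" "bounded {x. \<phi> x \<noteq> 0}"
  shows "(LBINT x. u x * pderiv_at i \<phi> x) = - (LBINT x. pderiv_at i u x * \<phi> x)"
proof -
  have bd: "bounded {x. u x * \<phi> x \<noteq> 0}" using \<phi>(2) by (rule bounded_subset) auto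
  have "(LBINT x. pderiv_at i (\<lambda>x. u x * \<phi> x) x) = 0"
    by (intro integral_pderiv_compact_support smooth_mult u \<phi> bd)
  moreover have "pderiv_at i (\<lambda>x. u x * \<phi> x) = (\<lambda>x. u x * pderiv_at i \<phi> x + pderiv_at i u x * \<phi> x)"
    by (intro ext pderiv_at_mult smooth_differentiable u \<phi>)
  moreover obtain r where r: "{x. \<phi> x \<noteq> 0} \<subseteq> cball 0 r"
    using \<phi>(2) unfolding bounded_iff subset_iff mem_cball_0 by blast
  have cl: "closure {x. \<phi> x \<noteq> 0} \<subseteq> cball 0 r" using r by (intro closure_minimal) auto
  have "integrable lborel (\<lambda>x. indicator (cball 0 r) x * (u x * pderiv_at i \<phi> x))"
    "integrable lborel (\<lambda>x. indicator (cball 0 r) x * (pderiv_at i u x * \<phi> x))"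
    by (intro integrable_indicator_continuous continuous_on_mult continuous_on_smooth smooth_pderiv_at u \<phi>; simp)+
  moreover have "(\<lambda>x. indicator (cball 0 r) x * (u x * pderiv_at i \<phi> x)) = (\<lambda>x. u x * pderiv_at i \<phi> x)"
    using pderiv_at_eq_0_outside_support[of _ \<phi> i] cl by (fastforce simp: fun_eq_iff indicator_def)
  moreover have "(\<lambda>x. indicator (cball 0 r) x * (pderiv_at i u x * \<phi> x)) = (\<lambda>x. pderiv_at i u x * \<phi> x)"
    using r by (fastforce simp: fun_eq_iff indicator_def)
  ultimately show ?thesis by simp
qed

lemma smooth_restrict_sq_int:
  "open \<Omega> \<Longrightarrow> bounded \<Omega> \<Longrightarrow> smooth u \<Longrightarrow> sq_int (\<lambda>x. indicator \<Omega> x * u x)"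
  by (intro sq_int_indicator_continuous continuous_on_smooth) auto

lemma ae_restrict_L2: "open \<Omega> \<Longrightarrow> bounded \<Omega> \<Longrightarrow> smooth u \<Longrightarrow> ae_restrict \<Omega> u \<in> L2 \<Omega>"
  unfolding ae_restrict_def by (intro ae_class_in_L2 smooth_restrict_sq_int) auto

lemma weak_partial_ae_restrict:
  assumes \<Omega>: "open \<Omega>" "bounded \<Omega>" and u: "smooth u"
  shows "weak_partial \<Omega> i (ae_restrict \<Omega> u) (ae_restrict \<Omega> (pderiv_at i u))"
  unfolding weak_partial_def
proof
  fix \<phi> assume \<phi>: "\<phi> \<in> test_functions \<Omega>"
  have eq: "ip (ae_restrict \<Omega> w) (ae_class \<xi>) = (LBINT x. w x * \<xi> x)"
    if w: "smooth w" and \<xi>: "\<xi> \<in> test_functions \<Omega>" for w \<xi>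
  proof -
    have [measurable]: "(\<lambda>x. indicator \<Omega> x * w x) \<in> borel_measurable borel" "\<xi> \<in> borel_measurable borel"
      using smooth_restrict_sq_int[OF \<Omega> w] test_functionD(4)[OF \<xi>] by (auto simp: sq_int_def)
    have "ip (ae_restrict \<Omega> w) (ae_class \<xi>) = (LBINT x. indicator \<Omega> x * w x * \<xi> x)"
      unfolding ae_restrict_def by (simp add: ip.abs_eq ae_rel_refl)
    also have "\<dots> = (LBINT x. w x * \<xi> x)"
      using test_functionD(3)[OF \<xi>] by (intro Bochner_Integration.integral_cong) (auto simp: indicator_def)
    finally show ?thesis .
  qed
  show "ip (ae_restrict \<Omega> u) (ae_class (pderiv_at i \<phi>)) = - ip (ae_restrict \<Omega> (pderiv_at i u)) (ae_class \<phi>)"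
    using eq[OF u pderiv_at_test_function[OF \<phi>]] eq[OF smooth_pderiv_at[OF u] \<phi>]
      integral_by_parts_test[OF u test_functionD(1,2)[OF \<phi>]] by simp
qed

lemma ae_restrict_H1:
  assumes "open \<Omega>" "bounded \<Omega>" "smooth u"
  shows "ae_restrict \<Omega> u \<in> H1 \<Omega>"
  unfolding H1_def using weak_partial_ae_restrict[OF assms] ae_restrict_L2[OF assms]
    ae_restrict_L2[OF assms(1,2) smooth_pderiv_at[OF assms(3)]] by blast

lemma wderiv_ae_restrict:
  "open \<Omega> \<Longrightarrow> bounded \<Omega> \<Longrightarrow> smooth u \<Longrightarrow> wderiv \<Omega> i (ae_restrict \<Omega> u) = ae_restrict \<Omega> (pderiv_at i u)"
  by (intro wderiv_eqI weak_partial_ae_restrict ae_restrict_L2 smooth_pderiv_at)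

section \<open>Traces\<close>

lemma ip_self_add_le:
  assumes "f \<in> L2 \<Omega>" "g \<in> L2 \<Omega>"
  shows "ip (f + g) (f + g) \<le> 2 * ip f f + 2 * ip g g"
proof -
  have "ip (f + g) (f + g) = (LBINT x. (rep_ae_fun f x + rep_ae_fun g x)\<^sup>2)"
    unfolding ip_self_eq using AE_rep_add[of f g] by (intro integral_cong_AE) (auto elim: AE_mp)
  also have "\<dots> \<le> 2 * ip f f + 2 * ip g g"
    unfolding ip_self_eq by (intro integral_power2_add_le assms[THEN sq_int_rep])
  finally show ?thesis .
qed

lemma norm_H1_power2:
  "(norm_H1 \<Omega> v)\<^sup>2 = ip v v + (ip (wderiv \<Omega> 1 v) (wderiv \<Omega> 1 v) + ip (wderiv \<Omega> 2 v) (wderiv \<Omega> 2 v))"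
  by (simp add: norm_H1_def ip_vec_def grad_def ip_self_nonneg)

text \<open>A quadratic substitute for the triangle inequality, obtained summand by summand from
  \<open>ip_self_add_le\<close>; the factor 2 is harmless for limits at 0.\<close>

lemma norm_H1_add_le:
  assumes "open \<Omega>" "v \<in> H1 \<Omega>" "w \<in> H1 \<Omega>"
  shows "(norm_H1 \<Omega> (v + w))\<^sup>2 \<le> 2 * (norm_H1 \<Omega> v)\<^sup>2 + 2 * (norm_H1 \<Omega> w)\<^sup>2"
  using add_mono[OF ip_self_add_le[OF assms(2,3)[THEN H1_L2]] add_mono[OF
      ip_self_add_le[OF wderiv_H1(1)[OF assms(1,2), of 1] wderiv_H1(1)[OF assms(1,3), of 1]]
      ip_self_add_le[OF wderiv_H1(1)[OF assms(1,2), of 2] wderiv_H1(1)[OF assms(1,3), of 2]]]]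
  unfolding norm_H1_power2 wderiv_add[OF assms] by (simp add: algebra_simps)

lemma norm_H1_scaleR:
  assumes "open \<Omega>" "v \<in> H1 \<Omega>"
  shows "norm_H1 \<Omega> (c *\<^sub>R v) = \<bar>c\<bar> * norm_H1 \<Omega> v"
proof -
  have "norm_H1 \<Omega> (c *\<^sub>R v) = sqrt (c\<^sup>2 * (ip v v + ip_vec (grad \<Omega> v) (grad \<Omega> v)))"
    unfolding norm_H1_def grad_scaleR[OF assms]
    by (simp add: ip_vec_def ip_scaleR_left ip_scaleR_right algebra_simps power2_eq_square)
  then show ?thesis by (simp add: norm_H1_def real_sqrt_mult)
qed

lemma tendsto_0_if_power2_tendsto_0: "(\<lambda>n. (f n)\<^sup>2) \<longlonglongrightarrow> 0 \<Longrightarrow> f \<longlonglongrightarrow> (0::real)"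
  using tendsto_real_sqrt[of "\<lambda>n. (f n)\<^sup>2" 0] by (simp add: tendsto_rabs_zero_iff)

lemma norm_H1_add_tendsto_0:
  assumes "open \<Omega>" "\<And>n. v n \<in> H1 \<Omega>" "\<And>n. w n \<in> H1 \<Omega>"
    "(\<lambda>n. norm_H1 \<Omega> (v n)) \<longlonglongrightarrow> 0" "(\<lambda>n. norm_H1 \<Omega> (w n)) \<longlonglongrightarrow> 0"
  shows "(\<lambda>n. norm_H1 \<Omega> (v n + w n)) \<longlonglongrightarrow> 0"
proof (rule tendsto_0_if_power2_tendsto_0, rule tendsto_sandwich[OF _ _ tendsto_const])
  show "\<forall>\<^sub>F n in sequentially. 0 \<le> (norm_H1 \<Omega> (v n + w n))\<^sup>2" by simp
  show "\<forall>\<^sub>F n in sequentially. (norm_H1 \<Omega> (v n + w n))\<^sup>2 \<le> 2 * (norm_H1 \<Omega> (v n))\<^sup>2 + 2 * (norm_H1 \<Omega> (w n))\<^sup>2"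
    using assms by (intro always_eventually allI norm_H1_add_le)
  have "(\<lambda>n. 2 * (norm_H1 \<Omega> (v n))\<^sup>2 + 2 * (norm_H1 \<Omega> (w n))\<^sup>2) \<longlonglongrightarrow> 2 * 0\<^sup>2 + 2 * 0\<^sup>2"
    by (intro tendsto_intros assms)
  then show "(\<lambda>n. 2 * (norm_H1 \<Omega> (v n))\<^sup>2 + 2 * (norm_H1 \<Omega> (w n))\<^sup>2) \<longlonglongrightarrow> 0" by simp
qed

lemma ae_restrict_add:
  assumes "open \<Omega>" "bounded \<Omega>" "smooth u" "smooth w"
  shows "ae_restrict \<Omega> (\<lambda>x. u x + w x) = ae_restrict \<Omega> u + ae_restrict \<Omega> w"
  using smooth_restrict_sq_int[OF assms(1,2,3)] smooth_restrict_sq_int[OF assms(1,2,4)]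
  unfolding ae_restrict_def by (subst plus_ae_fun.abs_eq) (auto simp: ae_rel_def sq_int_def distrib_left)

lemma ae_restrict_scaleR:
  assumes "open \<Omega>" "bounded \<Omega>" "smooth u"
  shows "ae_restrict \<Omega> (\<lambda>x. c * u x) = c *\<^sub>R ae_restrict \<Omega> u"
  using smooth_restrict_sq_int[OF assms]
  unfolding ae_restrict_def by (subst scaleR_ae_fun.abs_eq) (auto simp: ae_rel_def sq_int_def mult_ac)

section \<open>Linearity of traces and of the boundary conditions\<close>

lemma has_traceE:
  assumes "has_trace \<Omega> v g"
  obtains u where "v \<in> H1 \<Omega>" "g \<in> borel_measurable borel" "\<And>n. smooth (u n)"
    "(\<lambda>n. norm_H1 \<Omega> (ae_restrict \<Omega> (u n) - v)) \<longlonglongrightarrow> 0"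
    "(\<lambda>n. \<integral>\<^sup>+x. ennreal ((u n x - g x)\<^sup>2) \<partial>arc_measure (frontier \<Omega>)) \<longlonglongrightarrow> 0"
  using assms unfolding has_trace_def by blast

text \<open>The sums of the two approximating sequences serve; in the domain and on the boundary the
  squared error of a sum is at most twice the sum of the squared errors.\<close>

lemma has_trace_add:
  assumes \<Omega>: "open \<Omega>" "bounded \<Omega>" and "has_trace \<Omega> v g" "has_trace \<Omega> w h"
  shows "has_trace \<Omega> (v + w) (\<lambda>x. g x + h x)"
proof -
  let ?\<Gamma> = "arc_measure (frontier \<Omega>)"
  obtain u where u: "v \<in> H1 \<Omega>" "g \<in> borel_measurable borel" "\<And>n. smooth (u n)"
    "(\<lambda>n. norm_H1 \<Omega> (ae_restrict \<Omega> (u n) - v)) \<longlonglongrightarrow> 0"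
    "(\<lambda>n. \<integral>\<^sup>+x. ennreal ((u n x - g x)\<^sup>2) \<partial>?\<Gamma>) \<longlonglongrightarrow> 0"
    using assms(3) by (rule has_traceE) (rule that)
  obtain u' where u': "w \<in> H1 \<Omega>" "h \<in> borel_measurable borel" "\<And>n. smooth (u' n)"
    "(\<lambda>n. norm_H1 \<Omega> (ae_restrict \<Omega> (u' n) - w)) \<longlonglongrightarrow> 0"
    "(\<lambda>n. \<integral>\<^sup>+x. ennreal ((u' n x - h x)\<^sup>2) \<partial>?\<Gamma>) \<longlonglongrightarrow> 0"
    using assms(4) by (rule has_traceE) (rule that)
  note [measurable] = u(2) u'(2) borel_measurable_smooth[OF u(3)] borel_measurable_smooth[OF u'(3)]
  show ?thesis
    unfolding has_trace_def
  proof (intro conjI exI[of _ "\<lambda>n x. u n x + u' n x"] allI)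
    show "v + w \<in> H1 \<Omega>" using u(1) u'(1) by (intro subspace_add[OF subspace_H1[OF \<Omega>(1)]])
    show "(\<lambda>x. g x + h x) \<in> borel_measurable borel" by measurable
    show "smooth (\<lambda>x. u n x + u' n x)" for n using u(3) u'(3) by (intro smooth_add)
    have "(\<lambda>n. norm_H1 \<Omega> ((ae_restrict \<Omega> (u n) - v) + (ae_restrict \<Omega> (u' n) - w))) \<longlonglongrightarrow> 0"
      using u u' by (intro norm_H1_add_tendsto_0 \<Omega> subspace_diff[OF subspace_H1[OF \<Omega>(1)]] ae_restrict_H1)
    moreover have "ae_restrict \<Omega> (\<lambda>x. u n x + u' n x) - (v + w) =
        (ae_restrict \<Omega> (u n) - v) + (ae_restrict \<Omega> (u' n) - w)" for n
      unfolding ae_restrict_add[OF \<Omega> u(3) u'(3)] by simp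
    ultimately show "(\<lambda>n. norm_H1 \<Omega> (ae_restrict \<Omega> (\<lambda>x. u n x + u' n x) - (v + w))) \<longlonglongrightarrow> 0"
      by (simp only:)
    show "(\<lambda>n. \<integral>\<^sup>+x. ennreal ((u n x + u' n x - (g x + h x))\<^sup>2) \<partial>?\<Gamma>) \<longlonglongrightarrow> 0"
    proof (rule tendsto_sandwich[OF _ _ tendsto_const])
      show "\<forall>\<^sub>F n in sequentially. 0 \<le> (\<integral>\<^sup>+x. ennreal ((u n x + u' n x - (g x + h x))\<^sup>2) \<partial>?\<Gamma>)" by simp
      show "\<forall>\<^sub>F n in sequentially. (\<integral>\<^sup>+x. ennreal ((u n x + u' n x - (g x + h x))\<^sup>2) \<partial>?\<Gamma>) \<le>
        2 * (\<integral>\<^sup>+x. ennreal ((u n x - g x)\<^sup>2) \<partial>?\<Gamma>) + 2 * (\<integral>\<^sup>+x. ennreal ((u' n x - h x)\<^sup>2) \<partial>?\<Gamma>)"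
      proof (rule always_eventually, rule allI)
        fix n
        have "(\<integral>\<^sup>+x. ennreal ((u n x + u' n x - (g x + h x))\<^sup>2) \<partial>?\<Gamma>) \<le>
            (\<integral>\<^sup>+x. 2 * ennreal ((u n x - g x)\<^sup>2) + 2 * ennreal ((u' n x - h x)\<^sup>2) \<partial>?\<Gamma>)"
        proof (rule nn_integral_mono)
          fix x
          have "(u n x + u' n x - (g x + h x))\<^sup>2 \<le> 2 * (u n x - g x)\<^sup>2 + 2 * (u' n x - h x)\<^sup>2"
            using sum_squares_bound[of "u n x - g x" "u' n x - h x"]
            by (simp add: power2_eq_square algebra_simps)
          then have "ennreal ((u n x + u' n x - (g x + h x))\<^sup>2) \<le> ennreal (2 * (u n x - g x)\<^sup>2 + 2 * (u' n x - h x)\<^sup>2)"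
            by (rule ennreal_leI)
          also have "\<dots> = 2 * ennreal ((u n x - g x)\<^sup>2) + 2 * ennreal ((u' n x - h x)\<^sup>2)"
            by (simp add: ennreal_mult')
          finally show "ennreal ((u n x + u' n x - (g x + h x))\<^sup>2) \<le>
            2 * ennreal ((u n x - g x)\<^sup>2) + 2 * ennreal ((u' n x - h x)\<^sup>2)" .
        qed
        also have "\<dots> = 2 * (\<integral>\<^sup>+x. ennreal ((u n x - g x)\<^sup>2) \<partial>?\<Gamma>) + 2 * (\<integral>\<^sup>+x. ennreal ((u' n x - h x)\<^sup>2) \<partial>?\<Gamma>)"
          by (simp add: nn_integral_add nn_integral_cmult)
        finally show "(\<integral>\<^sup>+x. ennreal ((u n x + u' n x - (g x + h x))\<^sup>2) \<partial>?\<Gamma>) \<le>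
          2 * (\<integral>\<^sup>+x. ennreal ((u n x - g x)\<^sup>2) \<partial>?\<Gamma>) + 2 * (\<integral>\<^sup>+x. ennreal ((u' n x - h x)\<^sup>2) \<partial>?\<Gamma>)" .
      qed
      have "(\<lambda>n. 2 * (\<integral>\<^sup>+x. ennreal ((u n x - g x)\<^sup>2) \<partial>?\<Gamma>) + 2 * (\<integral>\<^sup>+x. ennreal ((u' n x - h x)\<^sup>2) \<partial>?\<Gamma>)) \<longlonglongrightarrow> 2 * 0 + 2 * 0"
        by (intro tendsto_add ennreal_tendsto_cmult u u') auto
      then show "(\<lambda>n. 2 * (\<integral>\<^sup>+x. ennreal ((u n x - g x)\<^sup>2) \<partial>?\<Gamma>) + 2 * (\<integral>\<^sup>+x. ennreal ((u' n x - h x)\<^sup>2) \<partial>?\<Gamma>)) \<longlonglongrightarrow> 0"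
        by simp
    qed
  qed
qed

lemma has_trace_scaleR:
  assumes \<Omega>: "open \<Omega>" "bounded \<Omega>" and "has_trace \<Omega> v g"
  shows "has_trace \<Omega> (c *\<^sub>R v) (\<lambda>x. c * g x)"
proof -
  let ?\<Gamma> = "arc_measure (frontier \<Omega>)"
  obtain u where u: "v \<in> H1 \<Omega>" "g \<in> borel_measurable borel" "\<And>n. smooth (u n)"
    "(\<lambda>n. norm_H1 \<Omega> (ae_restrict \<Omega> (u n) - v)) \<longlonglongrightarrow> 0"
    "(\<lambda>n. \<integral>\<^sup>+x. ennreal ((u n x - g x)\<^sup>2) \<partial>?\<Gamma>) \<longlonglongrightarrow> 0"
    using assms(3) by (rule has_traceE) (rule that)
  note [measurable] = u(2) borel_measurable_smooth[OF u(3)]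
  show ?thesis
    unfolding has_trace_def
  proof (intro conjI exI[of _ "\<lambda>n x. c * u n x"] allI)
    show "c *\<^sub>R v \<in> H1 \<Omega>" using u(1) by (intro subspace_scale[OF subspace_H1[OF \<Omega>(1)]])
    show "(\<lambda>x. c * g x) \<in> borel_measurable borel" by measurable
    show "smooth (\<lambda>x. c * u n x)" for n using u(3) by (intro smooth_cmult)
    have "ae_restrict \<Omega> (\<lambda>x. c * u n x) - c *\<^sub>R v = c *\<^sub>R (ae_restrict \<Omega> (u n) - v)" for n
      by (simp add: ae_restrict_scaleR[OF \<Omega> u(3)] scaleR_diff_right)
    then have "norm_H1 \<Omega> (ae_restrict \<Omega> (\<lambda>x. c * u n x) - c *\<^sub>R v) = \<bar>c\<bar> * norm_H1 \<Omega> (ae_restrict \<Omega> (u n) - v)" for n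
      using norm_H1_scaleR[OF \<Omega>(1) subspace_diff[OF subspace_H1[OF \<Omega>(1)] ae_restrict_H1[OF \<Omega> u(3)] u(1)]]
      by simp
    then show "(\<lambda>n. norm_H1 \<Omega> (ae_restrict \<Omega> (\<lambda>x. c * u n x) - c *\<^sub>R v)) \<longlonglongrightarrow> 0"
      using tendsto_mult_right_zero[OF u(4)] by simp
    have "(\<integral>\<^sup>+x. ennreal ((c * u n x - c * g x)\<^sup>2) \<partial>?\<Gamma>) = ennreal (c\<^sup>2) * (\<integral>\<^sup>+x. ennreal ((u n x - g x)\<^sup>2) \<partial>?\<Gamma>)" for n
    proof -
      have "ennreal ((c * u n x - c * g x)\<^sup>2) = ennreal (c\<^sup>2) * ennreal ((u n x - g x)\<^sup>2)" for x
        by (simp add: power_mult_distrib flip: right_diff_distrib ennreal_mult')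
      then show ?thesis by (simp add: nn_integral_cmult)
    qed
    moreover have "(\<lambda>n. ennreal (c\<^sup>2) * (\<integral>\<^sup>+x. ennreal ((u n x - g x)\<^sup>2) \<partial>?\<Gamma>)) \<longlonglongrightarrow> ennreal (c\<^sup>2) * 0"
      by (intro ennreal_tendsto_cmult u) simp
    ultimately show "(\<lambda>n. \<integral>\<^sup>+x. ennreal ((c * u n x - c * g x)\<^sup>2) \<partial>?\<Gamma>) \<longlonglongrightarrow> 0" by simp
  qed
qed

lemma has_trace_zero:
  assumes "open \<Omega>"
  shows "has_trace \<Omega> 0 (\<lambda>_. 0)"
  unfolding has_trace_def
proof (intro conjI exI[of _ "\<lambda>n x. 0"] allI)
  have "ae_restrict \<Omega> (\<lambda>_. 0) = 0"
    unfolding ae_restrict_def zero_ae_fun.abs_eq by simp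
  moreover have "norm_H1 \<Omega> 0 = 0"
    by (simp add: norm_H1_def grad_zero[OF assms] ip_vec_def)
  ultimately show "(\<lambda>n. norm_H1 \<Omega> (ae_restrict \<Omega> (\<lambda>_. 0) - 0)) \<longlonglongrightarrow> 0" by simp
qed (use subspace_0[OF subspace_H1[OF assms]] in \<open>auto intro: smooth_const\<close>)

lemma has_trace_H1: "has_trace \<Omega> v g \<Longrightarrow> v \<in> H1 \<Omega>"
  by (simp add: has_trace_def)

lemma subspace_H1_bc:
  assumes "open \<Omega>" "bounded \<Omega>"
  shows "subspace (H1_bc \<Omega> \<Gamma>c \<Gamma>s)"
proof (rule subspaceI)
  show "0 \<in> H1_bc \<Omega> \<Gamma>c \<Gamma>s"
    unfolding H1_bc_def using has_trace_zero[OF assms(1)] by (auto dest: has_trace_H1 intro!: exI[of _ "\<lambda>_. 0"])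
next
  fix v w assume vw: "v \<in> H1_bc \<Omega> \<Gamma>c \<Gamma>s" "w \<in> H1_bc \<Omega> \<Gamma>c \<Gamma>s"
  then obtain g h where gh: "has_trace \<Omega> v g" "has_trace \<Omega> w h"
    "AE x in arc_measure (frontier \<Omega>). x \<in> \<Gamma>c \<union> \<Gamma>s \<longrightarrow> g x = 0"
    "AE x in arc_measure (frontier \<Omega>). x \<in> \<Gamma>c \<union> \<Gamma>s \<longrightarrow> h x = 0"
    unfolding H1_bc_def by blast
  have t: "has_trace \<Omega> (v + w) (\<lambda>x. g x + h x)" by (rule has_trace_add[OF assms gh(1,2)])
  moreover have "AE x in arc_measure (frontier \<Omega>). x \<in> \<Gamma>c \<union> \<Gamma>s \<longrightarrow> g x + h x = 0"
    using gh(3,4) by eventually_elim auto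
  ultimately show "v + w \<in> H1_bc \<Omega> \<Gamma>c \<Gamma>s"
    unfolding H1_bc_def using has_trace_H1[OF t] by blast
next
  fix c v assume "v \<in> H1_bc \<Omega> \<Gamma>c \<Gamma>s"
  then obtain g where g: "has_trace \<Omega> v g" "AE x in arc_measure (frontier \<Omega>). x \<in> \<Gamma>c \<union> \<Gamma>s \<longrightarrow> g x = 0"
    unfolding H1_bc_def by blast
  have t: "has_trace \<Omega> (c *\<^sub>R v) (\<lambda>x. c * g x)" by (rule has_trace_scaleR[OF assms g(1)])
  moreover have "AE x in arc_measure (frontier \<Omega>). x \<in> \<Gamma>c \<union> \<Gamma>s \<longrightarrow> c * g x = 0"
    using g(2) by eventually_elim auto
  ultimately show "c *\<^sub>R v \<in> H1_bc \<Omega> \<Gamma>c \<Gamma>s"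
    unfolding H1_bc_def using has_trace_H1[OF t] by blast
qed

lemma has_trace_vec_add:
  assumes "open \<Omega>" "bounded \<Omega>" "has_trace_vec \<Omega> \<psi> g" "has_trace_vec \<Omega> \<phi> h"
  shows "has_trace_vec \<Omega> (\<psi> + \<phi>) (\<lambda>x. g x + h x)"
  using assms(3,4) has_trace_add[OF assms(1,2)] by (simp add: has_trace_vec_def)

lemma has_trace_vec_scaleR:
  assumes "open \<Omega>" "bounded \<Omega>" "has_trace_vec \<Omega> \<psi> g"
  shows "has_trace_vec \<Omega> (c *\<^sub>R \<psi>) (\<lambda>x. c *\<^sub>R g x)"
  using assms(3) has_trace_scaleR[OF assms(1,2)] by (simp add: has_trace_vec_def)

lemma has_trace_vec_zero: "open \<Omega> \<Longrightarrow> has_trace_vec \<Omega> 0 (\<lambda>_. 0)"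
  using has_trace_zero by (simp add: has_trace_vec_def)

lemma has_trace_vec_H1: "has_trace_vec \<Omega> \<psi> g \<Longrightarrow> \<psi> \<in> H1 \<Omega> \<times> H1 \<Omega>"
  using has_trace_H1 by (auto simp: has_trace_vec_def mem_Times_iff)

lemma tangential_proj_add: "tangential_proj n (p + q) = tangential_proj n p + tangential_proj n q"
  by (simp add: tangential_proj_def inner_add_left scaleR_add_left)

lemma tangential_proj_scaleR: "tangential_proj n (c *\<^sub>R p) = c *\<^sub>R tangential_proj n p"
  by (simp add: tangential_proj_def scaleR_diff_right)

text \<open>The conditions on a trace are pointwise linear, because \<open>tangential_proj n\<close>
  is linear for each fixed \<open>n\<close>; whatever value \<open>unit_normal\<close> takes at a
  corner does no harm.\<close>

lemma subspace_G_bc: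
  assumes "open \<Omega>" "bounded \<Omega>"
  shows "subspace (G_bc \<Omega> \<Gamma>c \<Gamma>s)"
proof -
  define P where "P = (\<lambda>g. AE x in arc_measure (frontier \<Omega>).
     (x \<in> \<Gamma>c \<longrightarrow> g x = 0) \<and> (x \<in> \<Gamma>s \<longrightarrow> tangential_proj (unit_normal \<Omega> x) (g x) = 0))"
  have G: "\<psi> \<in> G_bc \<Omega> \<Gamma>c \<Gamma>s \<longleftrightarrow> (\<exists>g. has_trace_vec \<Omega> \<psi> g \<and> P g)" for \<psi>
    unfolding G_bc_def P_def using has_trace_vec_H1 by blast
  show ?thesis
  proof (rule subspaceI)
    have "P (\<lambda>_. 0)" unfolding P_def by (simp add: tangential_proj_def)
    then show "0 \<in> G_bc \<Omega> \<Gamma>c \<Gamma>s" unfolding G using has_trace_vec_zero[OF assms(1)] by blast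
  next
    fix \<psi> \<phi> assume "\<psi> \<in> G_bc \<Omega> \<Gamma>c \<Gamma>s" "\<phi> \<in> G_bc \<Omega> \<Gamma>c \<Gamma>s"
    then obtain g h where gh: "has_trace_vec \<Omega> \<psi> g" "has_trace_vec \<Omega> \<phi> h" "P g" "P h"
      unfolding G by blast
    have "P (\<lambda>x. g x + h x)"
      using gh(3,4) unfolding P_def by eventually_elim (simp add: tangential_proj_add)
    then show "\<psi> + \<phi> \<in> G_bc \<Omega> \<Gamma>c \<Gamma>s" unfolding G using has_trace_vec_add[OF assms gh(1,2)] by blast
  next
    fix c \<psi> assume "\<psi> \<in> G_bc \<Omega> \<Gamma>c \<Gamma>s"
    then obtain g where g: "has_trace_vec \<Omega> \<psi> g" "P g"
      unfolding G by blast
    have "P (\<lambda>x. c *\<^sub>R g x)"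
      using g(2) unfolding P_def by eventually_elim (simp add: tangential_proj_scaleR)
    then show "c *\<^sub>R \<psi> \<in> G_bc \<Omega> \<Gamma>c \<Gamma>s" unfolding G using has_trace_vec_scaleR[OF assms g(1)] by blast
  qed
qed

section \<open>Smooth approximation and convergence on the boundary\<close>

lemma ip_self_ae_class_diff:
  assumes [measurable]: "F \<in> borel_measurable borel"
  shows "ip (ae_class F - f) (ae_class F - f) = (LBINT x. (F x - rep_ae_fun f x)\<^sup>2)"
  unfolding ip_self_eq
proof (rule integral_cong_AE)
  show "AE x in lborel. (rep_ae_fun (ae_class F - f) x)\<^sup>2 = (F x - rep_ae_fun f x)\<^sup>2"
    using AE_rep_diff[of "ae_class F" f] AE_rep_ae_class[OF assms] by eventually_elim simp
qed measurable

text \<open>The sequence from \<open>has_trace\<close> is thinned out until its values also converge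
  almost everywhere. This is needed because it will be inserted into sines and cosines; for the
  derivatives, convergence in the square mean is enough.\<close>

lemma has_trace_approximation:
  assumes \<Omega>: "open \<Omega>" "bounded \<Omega>" and v: "has_trace \<Omega> v g"
  obtains u where "\<And>n. smooth (u n)"
    "\<And>i. L2_tendsto (\<lambda>n x. indicator \<Omega> x * pderiv_at i (u n) x) (rep_ae_fun (wderiv \<Omega> i v))"
    "AE x in lborel. (\<lambda>n. indicator \<Omega> x * u n x) \<longlonglongrightarrow> rep_ae_fun v x"
    "(\<lambda>n. \<integral>\<^sup>+x. ennreal ((u n x - g x)\<^sup>2) \<partial>arc_measure (frontier \<Omega>)) \<longlonglongrightarrow> 0"
proof -
  obtain u where u: "v \<in> H1 \<Omega>" "g \<in> borel_measurable borel" "\<And>n. smooth (u n)"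
    "(\<lambda>n. norm_H1 \<Omega> (ae_restrict \<Omega> (u n) - v)) \<longlonglongrightarrow> 0"
    "(\<lambda>n. \<integral>\<^sup>+x. ennreal ((u n x - g x)\<^sup>2) \<partial>arc_measure (frontier \<Omega>)) \<longlonglongrightarrow> 0"
    using v by (rule has_traceE) (rule that)
  have sq: "sq_int (\<lambda>x. indicator \<Omega> x * u n x)" "sq_int (\<lambda>x. indicator \<Omega> x * pderiv_at i (u n) x)" for n i
    using u(3) by (auto intro!: smooth_restrict_sq_int \<Omega> smooth_pderiv_at)
  have sq': "sq_int (rep_ae_fun v)" "sq_int (rep_ae_fun (wderiv \<Omega> i v))" for i
    using sq_int_rep[OF H1_L2[OF u(1)]] sq_int_rep[OF wderiv_H1(1)[OF \<Omega>(1) u(1)]] by auto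
  let ?e = "\<lambda>n. ae_restrict \<Omega> (u n) - v"
  have lim: "(\<lambda>n. (norm_H1 \<Omega> (?e n))\<^sup>2) \<longlonglongrightarrow> 0"
    using tendsto_power[OF u(4), of 2] by simp
  have wd: "wderiv \<Omega> i (?e n) = ae_restrict \<Omega> (pderiv_at i (u n)) - wderiv \<Omega> i v" for i n
    using wderiv_diff[OF \<Omega>(1) ae_restrict_H1[OF \<Omega> u(3)] u(1)] wderiv_ae_restrict[OF \<Omega> u(3)] by simp
  have nonneg: "0 \<le> ip f f" for f by (rule ip_self_nonneg)
  have 0: "(\<lambda>n. ip (?e n) (?e n)) \<longlonglongrightarrow> 0"
    by (rule tendsto_sandwich[OF _ _ tendsto_const lim]) (auto simp: norm_H1_power2 nonneg)
  have "L2_tendsto (\<lambda>n x. indicator \<Omega> x * u n x) (rep_ae_fun v)"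
    unfolding L2_tendsto_def
    using sq(1) sq'(1) 0 unfolding ae_restrict_def
    by (subst (asm) ip_self_ae_class_diff) (auto simp: sq_int_def)
  from L2_tendsto_AE_subseq[OF this] obtain r where r: "strict_mono r"
    "AE x in lborel. (\<lambda>n. indicator \<Omega> x * u (r n) x) \<longlonglongrightarrow> rep_ae_fun v x" by blast
  have der: "L2_tendsto (\<lambda>n x. indicator \<Omega> x * pderiv_at i (u n) x) (rep_ae_fun (wderiv \<Omega> i v))" for i
  proof -
    have le: "ip (wderiv \<Omega> i f) (wderiv \<Omega> i f) \<le> (norm_H1 \<Omega> f)\<^sup>2" for f
      using exhaust_2[of i] nonneg[of f] nonneg[of "wderiv \<Omega> 1 f"] nonneg[of "wderiv \<Omega> 2 f"]
      by (auto simp: norm_H1_power2)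
    have "(\<lambda>n. ip (wderiv \<Omega> i (?e n)) (wderiv \<Omega> i (?e n))) \<longlonglongrightarrow> 0"
      by (rule tendsto_sandwich[OF _ _ tendsto_const lim]) (auto simp: nonneg le)
    then show ?thesis
      unfolding L2_tendsto_def
      using sq(2) sq'(2) unfolding wd unfolding ae_restrict_def
      by (subst (asm) ip_self_ae_class_diff) (auto simp: sq_int_def)
  qed
  show thesis
    using r L2_tendsto_subseq[OF der r(1)] u(3) LIMSEQ_subseq_LIMSEQ[OF u(5) r(1)]
    by (intro that[of "\<lambda>n. u (r n)"]) (auto simp: o_def)
qed

text \<open>Cauchy-Schwarz against the constant 1, using finite total mass. Traces converge in the
  square mean, while \<open>integral_pderiv_le_boundary\<close> estimates by the first
  power.\<close>

lemma nn_integral_abs_tendsto_0: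
  fixes d :: "nat \<Rightarrow> 'a \<Rightarrow> real"
  assumes [measurable]: "\<And>n. d n \<in> borel_measurable M" and fin: "emeasure M (space M) < \<infinity>"
    and lim: "(\<lambda>n. \<integral>\<^sup>+x. ennreal ((d n x)\<^sup>2) \<partial>M) \<longlonglongrightarrow> 0"
  shows "(\<lambda>n. \<integral>\<^sup>+x. ennreal \<bar>d n x\<bar> \<partial>M) \<longlonglongrightarrow> 0"
proof -
  let ?I = "\<lambda>n. \<integral>\<^sup>+x. ennreal \<bar>d n x\<bar> \<partial>M" and ?J = "\<lambda>n. \<integral>\<^sup>+x. ennreal ((d n x)\<^sup>2) \<partial>M"
  have CS: "(?I n)\<^sup>2 \<le> emeasure M (space M) * ?J n" for n
  proof -
    have "(\<integral>\<^sup>+x. ennreal \<bar>d n x\<bar> * 1 \<partial>M)\<^sup>2 \<le> (\<integral>\<^sup>+x. (ennreal \<bar>d n x\<bar>)\<^sup>2 \<partial>M) * (\<integral>\<^sup>+x. 1\<^sup>2 \<partial>M)"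
      by (rule Cauchy_Schwarz_nn_integral) measurable
    moreover have "(ennreal \<bar>d n x\<bar>)\<^sup>2 = ennreal ((d n x)\<^sup>2)" for x
      by (simp add: ennreal_power)
    ultimately show ?thesis by (simp add: mult.commute)
  qed
  have lim': "(\<lambda>n. emeasure M (space M) * ?J n) \<longlonglongrightarrow> 0"
    using ennreal_tendsto_cmult[OF _ lim, of "emeasure M (space M)"] fin by simp
  show ?thesis
  proof (rule order_tendstoI)
    fix a :: ennreal assume "0 < a"
    then have "0 < a\<^sup>2" by (simp add: power2_eq_square ennreal_zero_less_mult_iff)
    then have "\<forall>\<^sub>F n in sequentially. emeasure M (space M) * ?J n < a\<^sup>2"
      using order_tendstoD(2)[OF lim'] by blast
    then show "\<forall>\<^sub>F n in sequentially. ?I n < a"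
    proof eventually_elim
      case (elim n)
      then have "(?I n)\<^sup>2 < a\<^sup>2" using CS le_less_trans by blast
      then show ?case by (meson not_le power_mono zero_le)
    qed
  qed simp
qed

text \<open>\<open>arc_measure\<close> is a measure on the whole plane; no edge parametrisation
  meets the complement of \<open>\<Gamma>\<close>, which is therefore a null set.\<close>

lemma AE_arc_measure_in_boundary:
  assumes "\<exists>E. is_edge_set \<Gamma> E" "closed \<Gamma>"
  shows "AE x in arc_measure \<Gamma>. x \<in> \<Gamma>"
proof (rule AE_I')
  have E: "finite (edges_of \<Gamma>)" "(\<Union>(a, b)\<in>edges_of \<Gamma>. closed_segment a b) = \<Gamma>"
    using is_edge_set_edges_of[OF assms(1)] by (auto simp: is_edge_set_def)
  have "{t \<in> {0..1}. linepath a b t \<in> - \<Gamma>} = {}" if "(a, b) \<in> edges_of \<Gamma>" for a b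
    using that E(2) linepath_in_path[of _ a b] by fastforce
  then have "arc_length_on \<Gamma> (- \<Gamma>) = 0"
    unfolding arc_length_on_def
    by (intro sum.neutral ballI) (simp only: split_paired_all split emeasure_empty mult_zero_right)
  then show "- \<Gamma> \<in> null_sets (arc_measure \<Gamma>)"
    using assms(2) by (auto simp: null_sets_def emeasure_arc_measure)
qed auto

lemma finite_arc_measure:
  "emeasure (arc_measure \<Gamma>) (space (arc_measure \<Gamma>)) < \<infinity>"
proof -
  have "{t \<in> {0..1::real}. linepath a b t \<in> UNIV} = {0..1}" for a b :: "real^2" by auto
  then have "arc_length_on \<Gamma> UNIV = (\<Sum>(a, b)\<in>edges_of \<Gamma>. ennreal (norm (b - a)))"
    unfolding arc_length_on_def by (simp only:) simp
  also have "\<dots> = ennreal (\<Sum>(a, b)\<in>edges_of \<Gamma>. norm (b - a))"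
    by (subst sum_ennreal[symmetric]) (auto intro!: sum.cong)
  also have "\<dots> < \<infinity>" by simp
  finally show ?thesis by (simp add: emeasure_arc_measure)
qed

section \<open>Tangential traces of gradients\<close>

lemma abs_sin_diff_le: "\<bar>sin a - sin b\<bar> \<le> \<bar>a - b\<bar>" for a b :: real
proof -
  have "\<bar>sin a - sin b\<bar> = 2 * \<bar>sin ((a - b) / 2)\<bar> * \<bar>cos ((a + b) / 2)\<bar>"
    by (simp add: sin_diff_sin abs_mult)
  also have "\<dots> \<le> 2 * \<bar>sin ((a - b) / 2)\<bar> * 1" by (intro mult_left_mono) auto
  also have "\<dots> \<le> \<bar>a - b\<bar>" using abs_sin_x_le_abs_x[of "(a - b) / 2"] by simp
  finally show ?thesis .
qed

lemma abs_cos_diff_le: "\<bar>cos a - cos b\<bar> \<le> \<bar>a - b\<bar>" for a b :: real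
  using abs_sin_diff_le[of "pi / 2 - a" "pi / 2 - b"] by (simp add: sin_diff)

text \<open>One factor is changed at a time while the other is bounded by 2 or by 1, which explains
  the two constants. The bound carries the boundary errors of two approximants over to the composed
  function.\<close>

lemma abs_sin_mult_one_minus_cos_diff_le:
  fixes s k :: real
  assumes "0 \<le> s" "0 \<le> k"
  shows "\<bar>sin (s * a) * (1 - cos (k * b)) - sin (s * a') * (1 - cos (k * b'))\<bar> \<le> 2 * s * \<bar>a - a'\<bar> + k * \<bar>b - b'\<bar>"
proof -
  have c: "\<bar>1 - cos (k * b)\<bar> \<le> 2"
    using cos_le_one[of "k * b"] cos_ge_minus_one[of "k * b"] by linarith
  have "\<bar>sin (s * a) - sin (s * a')\<bar> \<le> s * \<bar>a - a'\<bar>"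
    using abs_sin_diff_le[of "s * a" "s * a'"] assms(1) by (simp add: abs_mult flip: right_diff_distrib)
  then have 1: "\<bar>(sin (s * a) - sin (s * a')) * (1 - cos (k * b))\<bar> \<le> (s * \<bar>a - a'\<bar>) * 2"
    unfolding abs_mult using c assms(1) by (intro mult_mono) auto
  have "\<bar>cos (k * b') - cos (k * b)\<bar> \<le> k * \<bar>b - b'\<bar>"
    using abs_cos_diff_le[of "k * b'" "k * b"] assms(2)
    by (simp add: abs_mult abs_minus_commute flip: right_diff_distrib)
  then have 2: "\<bar>sin (s * a') * (cos (k * b') - cos (k * b))\<bar> \<le> 1 * (k * \<bar>b - b'\<bar>)"
    unfolding abs_mult using assms(2) by (intro mult_mono) auto
  have "sin (s * a) * (1 - cos (k * b)) - sin (s * a') * (1 - cos (k * b')) =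
      (sin (s * a) - sin (s * a')) * (1 - cos (k * b)) + sin (s * a') * (cos (k * b') - cos (k * b))"
    by (simp add: algebra_simps)
  then show ?thesis using 1 2 by linarith
qed

text \<open>
  A Cesaro mean over the frequencies \<open>N + 1, \<dots>, 2 N + 1\<close> only: since all of them are at least \<open>N + 1\<close>,
  estimates that decay like the inverse of the frequency hold for the mean without logarithmic loss.
\<close>

definition cos_mean :: "nat \<Rightarrow> real \<Rightarrow> real" where
  "cos_mean N t = (\<Sum>l<Suc N. cos (2 * pi * real (Suc N + l) * t)) / real (Suc N)"

lemma abs_cos_mean_le: "\<bar>cos_mean N t\<bar> \<le> 1"
proof -
  have "\<bar>\<Sum>l<Suc N. cos (2 * pi * real (Suc N + l) * t)\<bar> \<le> (\<Sum>l<Suc N. \<bar>cos (2 * pi * real (Suc N + l) * t)\<bar>)"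
    by (rule sum_abs)
  also have "\<dots> \<le> (\<Sum>l<Suc N. 1)" by (intro sum_mono) (rule abs_cos_le_one)
  finally show ?thesis by (simp add: cos_mean_def field_simps del: sum.lessThan_Suc)
qed

lemma cos_mean_measurable [measurable]: "cos_mean N \<in> borel_measurable borel"
  unfolding cos_mean_def by measurable

text \<open>At an integer all cosines equal 1. Elsewhere the sum is of Dirichlet kernel type: after
  multiplication by \<open>2 * sin (pi * t)\<close> it telescopes, so it stays bounded while the
  mean divides it by \<open>Suc N\<close>.\<close>

lemma cos_mean_tendsto: "(\<lambda>N. cos_mean N t) \<longlonglongrightarrow> indicator \<int> t"
proof (cases "t \<in> \<int>")
  case True
  have "cos (2 * pi * real m * t) = 1" for m
    using cos_integer_2pi[of "real m * t"] True by (simp add: mult.assoc)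
  then have "cos_mean N t = 1" for N
    unfolding cos_mean_def by (simp only: sum_constant card_lessThan) simp
  then show ?thesis using True by simp
next
  case False
  have sin: "sin (pi * t) \<noteq> 0"
  proof
    assume "sin (pi * t) = 0"
    then obtain i :: int where "pi * t = of_int i * pi" using sin_zero_iff_int2 by blast
    then have "t = of_int i" by simp
    then show False using False by simp
  qed
  define b where "b = \<bar>sin (pi * t)\<bar>"
  have b: "b > 0" using sin by (simp add: b_def)
  have tele: "2 * sin (pi * t) * (\<Sum>l<n. cos (2 * pi * real (M + l) * t)) =
      sin ((2 * real (M + n) - 1) * (pi * t)) - sin ((2 * real M - 1) * (pi * t))" for M n
  proof (induction n)
    case (Suc n)
    have "2 * sin (pi * t) * cos (2 * pi * real (M + n) * t) =
        sin (2 * pi * real (M + n) * t + pi * t) - sin (2 * pi * real (M + n) * t - pi * t)"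
      by (simp add: sin_add sin_diff)
    also have "2 * pi * real (M + n) * t + pi * t = (2 * real (M + Suc n) - 1) * (pi * t)"
      by (simp add: algebra_simps)
    also have "2 * pi * real (M + n) * t - pi * t = (2 * real (M + n) - 1) * (pi * t)"
      by (simp add: algebra_simps)
    finally show ?case using Suc.IH by (simp add: distrib_left)
  qed simp
  have bound: "\<bar>cos_mean N t\<bar> \<le> (1 / b) * (1 / real (Suc N))" for N
  proof -
    let ?S = "\<Sum>l<Suc N. cos (2 * pi * real (Suc N + l) * t)"
    have "2 * b * \<bar>?S\<bar> = \<bar>2 * sin (pi * t) * ?S\<bar>" by (simp only: b_def abs_mult abs_numeral)
    also have "\<dots> \<le> 2"
      unfolding tele
      using abs_sin_le_one[of "(2 * real (Suc N + Suc N) - 1) * (pi * t)"]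
        abs_sin_le_one[of "(2 * real (Suc N) - 1) * (pi * t)"] by linarith
    finally have "\<bar>?S\<bar> \<le> 1 / b" using b by (simp add: field_simps del: sum.lessThan_Suc)
    then have "\<bar>?S\<bar> / real (Suc N) \<le> (1 / b) / real (Suc N)" by (rule divide_right_mono) simp
    then show ?thesis by (simp add: cos_mean_def del: sum.lessThan_Suc)
  qed
  have "(\<lambda>N. 1 / real (Suc N)) \<longlonglongrightarrow> 0"
    using LIMSEQ_inverse_real_of_nat by (simp add: inverse_eq_divide)
  then have "(\<lambda>N. (1 / b) * (1 / real (Suc N))) \<longlonglongrightarrow> 0" by (rule tendsto_mult_right_zero)
  then have "(\<lambda>N. cos_mean N t) \<longlonglongrightarrow> 0"
    by (rule tendsto_0_le[where K=1]) (use bound b in \<open>auto intro!: always_eventually\<close>)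
  then show ?thesis using False by simp
qed

lemma integrable_bounded_mult:
  fixes f A :: "real^2 \<Rightarrow> real"
  assumes "integrable lborel f" "A \<in> borel_measurable borel" "\<And>x. \<bar>A x\<bar> \<le> C"
  shows "integrable lborel (\<lambda>x. A x * f x)"
proof (rule Bochner_Integration.integrable_bound)
  show "integrable lborel (\<lambda>x. C * f x)" using assms(1) by simp
  have [measurable]: "f \<in> borel_measurable borel" "A \<in> borel_measurable borel" using assms by auto
  show "(\<lambda>x. A x * f x) \<in> borel_measurable lborel" by measurable
  show "AE x in lborel. norm (A x * f x) \<le> norm (C * f x)"
    using order_trans[OF assms(3) abs_ge_self] by (intro AE_I2) (simp add: abs_mult mult_right_mono)
qed

lemma bounded_convergence_mult:
  fixes f :: "real^2 \<Rightarrow> real"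
  assumes f: "integrable lborel f" and A: "\<And>n. A n \<in> borel_measurable borel" "A' \<in> borel_measurable borel"
    "\<And>n x. \<bar>A n x\<bar> \<le> C" "AE x in lborel. (\<lambda>n. A n x) \<longlonglongrightarrow> A' x"
  shows "(\<lambda>n. LBINT x. A n x * f x) \<longlonglongrightarrow> (LBINT x. A' x * f x)"
proof (rule integral_dominated_convergence[where w="\<lambda>x. C * \<bar>f x\<bar>"])
  have [measurable]: "f \<in> borel_measurable borel" using f by auto
  note [measurable] = A(1,2)
  show "(\<lambda>x. A' x * f x) \<in> borel_measurable lborel" "(\<lambda>x. A n x * f x) \<in> borel_measurable lborel" for n
    by measurable
  show "integrable lborel (\<lambda>x. C * \<bar>f x\<bar>)" using f by simp
  show "AE x in lborel. (\<lambda>n. A n x * f x) \<longlonglongrightarrow> A' x * f x"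
    using A(4) by eventually_elim (intro tendsto_intros)
  show "AE x in lborel. norm (A n x * f x) \<le> C * \<bar>f x\<bar>" for n
    using A(3) by (intro AE_I2) (simp add: abs_mult mult_right_mono)
qed

text \<open>\<open>cos (k v)\<close> times a derivative of \<open>v\<close> is the derivative of
  \<open>sin (k v) / k\<close>. Moving that derivative to the test function leaves the factor
  \<open>1 / k\<close> and a bound free of the gradient of \<open>v\<close>. The chain rule is
  applied to smooth approximants, and the bound survives the limit.\<close>

lemma cos_wderiv_test_bound:
  assumes \<Omega>: "open \<Omega>" "bounded \<Omega>" and v: "has_trace \<Omega> v g" and \<phi>: "\<phi> \<in> test_functions \<Omega>" and k: "k > 0"
  shows "\<bar>LBINT x. cos (k * rep_ae_fun v x) * (rep_ae_fun (wderiv \<Omega> i v) x * \<phi> x)\<bar> \<le>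
    (LBINT x. \<bar>pderiv_at i \<phi> x\<bar>) / k"
proof -
  obtain u where u: "\<And>n. smooth (u n)"
    "\<And>i. L2_tendsto (\<lambda>n x. indicator \<Omega> x * pderiv_at i (u n) x) (rep_ae_fun (wderiv \<Omega> i v))"
    "AE x in lborel. (\<lambda>n. indicator \<Omega> x * u n x) \<longlonglongrightarrow> rep_ae_fun v x"
    "(\<lambda>n. \<integral>\<^sup>+x. ennreal ((u n x - g x)\<^sup>2) \<partial>arc_measure (frontier \<Omega>)) \<longlonglongrightarrow> 0"
    by (rule has_trace_approximation[OF \<Omega> v]) (rule that)
  note t = test_functionD[OF \<phi>]
  have dt: "pderiv_at i \<phi> \<in> test_functions \<Omega>" by (rule pderiv_at_test_function[OF \<phi>])
  note dt' = test_functionD[OF dt]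
  have [measurable]: "u n \<in> borel_measurable borel" "pderiv_at i \<phi> \<in> borel_measurable borel"
    "\<Omega> \<in> sets borel" for n
    using u(1) dt'(1) \<Omega> by (auto intro: borel_measurable_smooth)
  have "L2_tendsto (\<lambda>n x. cos (k * (indicator \<Omega> x * u n x)) * (indicator \<Omega> x * pderiv_at i (u n) x))
      (\<lambda>x. cos (k * rep_ae_fun v x) * rep_ae_fun (wderiv \<Omega> i v) x)"
  proof (rule L2_tendsto_bounded_mult[OF u(2), where C=1])
    show "AE x in lborel. (\<lambda>n. cos (k * (indicator \<Omega> x * u n x))) \<longlonglongrightarrow> cos (k * rep_ae_fun v x)"
      using u(3) by eventually_elim (intro tendsto_intros)
  qed (auto intro: abs_cos_le_one)
  from L2_tendsto_integral_mult[OF this t(4)]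
  have lim: "(\<lambda>n. LBINT x. cos (k * (indicator \<Omega> x * u n x)) * (indicator \<Omega> x * pderiv_at i (u n) x) * \<phi> x)
      \<longlonglongrightarrow> (LBINT x. cos (k * rep_ae_fun v x) * (rep_ae_fun (wderiv \<Omega> i v) x * \<phi> x))"
    by (simp add: mult.assoc)
  have int: "integrable lborel (pderiv_at i \<phi>)"
  proof -
    have "sq_int (\<lambda>x. indicator \<Omega> x * 1)" using \<Omega> by (intro sq_int_indicator_continuous) auto
    then have "integrable lborel (\<lambda>x. (indicator \<Omega> x * 1) * pderiv_at i \<phi> x)"
      by (intro sq_int_mult_integrable dt')
    moreover have "(\<lambda>x. (indicator \<Omega> x * 1) * pderiv_at i \<phi> x) = pderiv_at i \<phi>"
      using dt'(3) by (auto simp: fun_eq_iff indicator_def)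
    ultimately show ?thesis by simp
  qed
  have bound: "\<bar>LBINT x. cos (k * (indicator \<Omega> x * u n x)) * (indicator \<Omega> x * pderiv_at i (u n) x) * \<phi> x\<bar>
      \<le> (LBINT x. \<bar>pderiv_at i \<phi> x\<bar>) / k" for n
  proof -
    define w where "w = (\<lambda>x. (1 / k) * sin (k * u n x))"
    have w: "smooth w" unfolding w_def by (intro smooth_cmult smooth_sin u)
    have dw: "pderiv_at i w x = cos (k * u n x) * pderiv_at i (u n) x" for x
      unfolding w_def
      by (subst pderiv_at_compose_real[where F="\<lambda>y. (1 / k) * sin (k * y)" and d="cos (k * u n x)"])
        (use k u(1) in \<open>auto intro!: smooth_differentiable derivative_eq_intros\<close>)
    \<comment> \<open>The indicators may be dropped because \<open>\<phi>\<close> vanishes off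
      \<open>\<Omega>\<close>.\<close>
    have "(LBINT x. cos (k * (indicator \<Omega> x * u n x)) * (indicator \<Omega> x * pderiv_at i (u n) x) * \<phi> x) =
        (LBINT x. pderiv_at i w x * \<phi> x)"
      using t(3) by (intro Bochner_Integration.integral_cong) (auto simp: dw indicator_def)
    also have "\<dots> = - (LBINT x. w x * pderiv_at i \<phi> x)"
      using integral_by_parts_test[OF w t(1,2)] by simp
    finally have "\<bar>LBINT x. cos (k * (indicator \<Omega> x * u n x)) * (indicator \<Omega> x * pderiv_at i (u n) x) * \<phi> x\<bar> =
        \<bar>LBINT x. w x * pderiv_at i \<phi> x\<bar>" by simp
    also have "\<dots> \<le> (LBINT x. \<bar>w x * pderiv_at i \<phi> x\<bar>)" by (rule integral_abs_bound)
    also have "\<dots> \<le> (LBINT x. (1 / k) * \<bar>pderiv_at i \<phi> x\<bar>)"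
    proof (rule integral_mono)
      have wb: "\<bar>w x\<bar> \<le> 1 / k" for x
        using abs_sin_le_one[of "k * u n x"] k by (simp add: w_def abs_mult divide_right_mono)
      have [measurable]: "w \<in> borel_measurable borel" using w by (rule borel_measurable_smooth)
      show "integrable lborel (\<lambda>x. \<bar>w x * pderiv_at i \<phi> x\<bar>)"
        using integrable_bounded_mult[OF int _ wb] by simp
      show "integrable lborel (\<lambda>x. (1 / k) * \<bar>pderiv_at i \<phi> x\<bar>)" using int by simp
      show "\<bar>w x * pderiv_at i \<phi> x\<bar> \<le> (1 / k) * \<bar>pderiv_at i \<phi> x\<bar>" for x
        unfolding abs_mult by (intro mult_right_mono wb) simp
    qed
    finally show ?thesis by simp
  qed
  show ?thesis
    by (rule tendsto_le[OF sequentially_bot tendsto_const tendsto_rabs[OF lim]])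
      (use bound in \<open>auto intro!: always_eventually\<close>)
qed

text \<open>A case of Stampacchia's theorem on level sets. Tested with \<open>\<phi>\<close>, every
  frequency in \<open>cos_mean N\<close> gives an integral of size at most
  \<open>K / real (Suc N)\<close>, so the means tend to 0; by dominated convergence they also tend
  to the integral over the set where \<open>v\<close> is an integer.\<close>

lemma wderiv_eq_0_on_integer_level_sets:
  assumes \<Omega>: "open \<Omega>" "bounded \<Omega>" and v: "has_trace \<Omega> v g"
  shows "AE x in lborel. rep_ae_fun v x \<in> \<int> \<longrightarrow> rep_ae_fun (wderiv \<Omega> i v) x = 0"
proof -
  let ?v = "rep_ae_fun v" and ?d = "rep_ae_fun (wderiv \<Omega> i v)"
  have d: "wderiv \<Omega> i v \<in> L2 \<Omega>" by (rule wderiv_H1(1)[OF \<Omega>(1) has_trace_H1[OF v]])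
  have meas [measurable]: "(\<lambda>x. indicator \<int> (?v x) :: real) \<in> borel_measurable borel"
    by (rule measurable_compose[OF rep_ae_fun_measurable borel_measurable_indicator])
      (intro borel_closed closed_Ints)
  have sq: "sq_int (\<lambda>x. indicator \<int> (?v x) * ?d x)"
    by (rule sq_int_bounded_mult[OF sq_int_rep[OF d] meas, where C=1]) (simp add: indicator_def)
  have "AE x in lborel. x \<in> \<Omega> \<longrightarrow> indicator \<int> (?v x) * ?d x = 0"
  proof (rule AE_zero_if_orthogonal_to_test_functions[OF \<Omega>(1) sq])
    fix \<phi> assume \<phi>: "\<phi> \<in> test_functions \<Omega>"
    define K where "K = (LBINT x. \<bar>pderiv_at i \<phi> x\<bar>)"
    have int: "integrable lborel (\<lambda>x. ?d x * \<phi> x)"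
      by (intro sq_int_mult_integrable sq_int_rep[OF d] test_functionD(4)[OF \<phi>])
    have lim: "(\<lambda>N. LBINT x. cos_mean N (?v x) * (?d x * \<phi> x)) \<longlonglongrightarrow>
        (LBINT x. indicator \<int> (?v x) * (?d x * \<phi> x))"
      by (rule bounded_convergence_mult[OF int, where C=1])
        (auto intro: abs_cos_mean_le cos_mean_tendsto)
    have bound: "\<bar>LBINT x. cos_mean N (?v x) * (?d x * \<phi> x)\<bar> \<le> K * (1 / real (Suc N))" for N
    proof -
      let ?I = "\<lambda>l. LBINT x. cos (2 * pi * real (Suc N + l) * ?v x) * (?d x * \<phi> x)"
      have i1: "integrable lborel (\<lambda>x. cos (c * ?v x) * (?d x * \<phi> x))" for c
        by (rule integrable_bounded_mult[OF int, where C=1]) (auto intro: abs_cos_le_one)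
      have "(LBINT x. cos_mean N (?v x) * (?d x * \<phi> x)) =
          (LBINT x. (\<Sum>l<Suc N. cos (2 * pi * real (Suc N + l) * ?v x) * (?d x * \<phi> x)) / real (Suc N))"
        by (simp add: cos_mean_def sum_distrib_right del: sum.lessThan_Suc)
      also have "\<dots> = (\<Sum>l<Suc N. ?I l) / real (Suc N)"
        using i1 by (simp del: sum.lessThan_Suc of_nat_Suc)
      finally have "\<bar>LBINT x. cos_mean N (?v x) * (?d x * \<phi> x)\<bar> = \<bar>\<Sum>l<Suc N. ?I l\<bar> / real (Suc N)"
        by (simp del: sum.lessThan_Suc)
      also have "\<bar>\<Sum>l<Suc N. ?I l\<bar> \<le> (\<Sum>l<Suc N. K / real (Suc N))"
      proof (rule order_trans[OF sum_abs], rule sum_mono)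
        fix l
        have "\<bar>?I l\<bar> \<le> K / (2 * pi * real (Suc N + l))"
          unfolding K_def by (rule cos_wderiv_test_bound[OF \<Omega> v \<phi>]) simp
        also have "\<dots> \<le> K / real (Suc N)"
        proof (rule divide_left_mono)
          have "real (Suc N) \<le> 1 * real (Suc N + l)" by simp
          also have "\<dots> \<le> 2 * pi * real (Suc N + l)"
            using pi_ge_two by (intro mult_right_mono) auto
          finally show "real (Suc N) \<le> 2 * pi * real (Suc N + l)" .
          show "0 \<le> K" by (simp add: K_def)
        qed (simp add: mult_pos_pos)
        finally show "\<bar>?I l\<bar> \<le> K / real (Suc N)" .
      qed
      also have "(\<Sum>l<Suc N. K / real (Suc N)) = K" by simp
      finally show ?thesis by (simp add: divide_right_mono)
    qed
    have "(\<lambda>N. K * (1 / real (Suc N))) \<longlonglongrightarrow> 0"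
      using tendsto_mult_right_zero[OF LIMSEQ_inverse_real_of_nat, of K] by (simp add: inverse_eq_divide)
    then have "(\<lambda>N. LBINT x. cos_mean N (?v x) * (?d x * \<phi> x)) \<longlonglongrightarrow> 0"
      by (rule tendsto_0_le[where K=1])
        (rule always_eventually, rule allI, simp only: real_norm_def mult_1_right, rule order_trans[OF bound abs_ge_self])
    from LIMSEQ_unique[OF lim this]
    show "(LBINT x. indicator \<int> (?v x) * ?d x * \<phi> x) = 0" by (simp add: mult.assoc)
  qed
  moreover have "AE x in lborel. x \<notin> \<Omega> \<longrightarrow> ?d x = 0" using d by (simp add: L2_iff)
  ultimately show ?thesis by eventually_elim (auto simp: indicator_def)
qed

text \<open>The cross product of the gradients of \<open>V\<close> and \<open>w\<close> is the first
  derivative of \<open>V * pderiv_at 2 w\<close> minus the second derivative of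
  \<open>V * pderiv_at 1 w\<close>, meaning partial derivatives in directions 1 and 2, since the
  mixed derivatives of \<open>w\<close> cancel. Both integrals are controlled by boundary values,
  which tend to 0 for \<open>V n\<close>, while the derivatives of the smooth \<open>w\<close> are
  bounded on the compact boundary.\<close>

lemma integral_smooth_cross_boundary:
  assumes \<Omega>: "open \<Omega>" "bounded \<Omega>" "\<exists>E. is_edge_set (frontier \<Omega>) E"
    and V: "\<And>n. smooth (V n)"
      "\<And>i. L2_tendsto (\<lambda>n x. indicator \<Omega> x * pderiv_at i (V n) x) (X i)"
      "(\<lambda>n. \<integral>\<^sup>+x. ennreal \<bar>V n x\<bar> \<partial>arc_measure (frontier \<Omega>)) \<longlonglongrightarrow> 0"
    and w: "smooth w"
  shows "(LBINT x. X 1 x * (indicator \<Omega> x * pderiv_at 2 w x)) =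
    (LBINT x. X 2 x * (indicator \<Omega> x * pderiv_at 1 w x))"
proof -
  let ?\<Gamma> = "arc_measure (frontier \<Omega>)"
  define dw where "dw j = (\<lambda>x. indicator \<Omega> x * pderiv_at j w x)" for j
  have dw: "sq_int (dw j)" for j
    unfolding dw_def by (intro smooth_restrict_sq_int \<Omega> smooth_pderiv_at w)
  have bdry: "(\<lambda>n. LBINT x. indicator \<Omega> x * pderiv_at i (\<lambda>x. V n x * pderiv_at j w x) x) \<longlonglongrightarrow> 0" for i j
  proof -
    let ?I = "\<lambda>n. LBINT x. indicator \<Omega> x * pderiv_at i (\<lambda>x. V n x * pderiv_at j w x) x"
    have "compact (pderiv_at j w ` frontier \<Omega>)"
      by (intro compact_continuous_image continuous_on_smooth smooth_pderiv_at w compact_frontier_bounded \<Omega>)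
    then have "bounded (pderiv_at j w ` frontier \<Omega>)" by (rule compact_imp_bounded)
    then obtain C where C: "\<And>x. x \<in> frontier \<Omega> \<Longrightarrow> \<bar>pderiv_at j w x\<bar> \<le> C"
      by (auto simp: bounded_iff)
    \<comment> \<open>The maximum covers an empty boundary, where \<open>C\<close> could be
      negative, and lets \<open>D\<close> enter \<open>ennreal\<close>.\<close>
    define D where "D = max C 0"
    let ?c = "of_nat (2 * card (edges_of (frontier \<Omega>))) :: ennreal"
    have le: "ennreal \<bar>?I n\<bar> \<le> ?c * (ennreal D * (\<integral>\<^sup>+x. ennreal \<bar>V n x\<bar> \<partial>?\<Gamma>))" for n
    proof -
      have [measurable]: "V n \<in> borel_measurable borel" using V(1) by (rule borel_measurable_smooth)
      have "ennreal \<bar>?I n\<bar> \<le> ?c * (\<integral>\<^sup>+x. ennreal \<bar>V n x * pderiv_at j w x\<bar> \<partial>?\<Gamma>)"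
        by (intro integral_pderiv_le_boundary \<Omega> smooth_mult V smooth_pderiv_at w)
      also have "\<dots> \<le> ?c * (\<integral>\<^sup>+x. ennreal D * ennreal \<bar>V n x\<bar> \<partial>?\<Gamma>)"
      proof (intro mult_left_mono nn_integral_mono_AE)
        show "AE x in ?\<Gamma>. ennreal \<bar>V n x * pderiv_at j w x\<bar> \<le> ennreal D * ennreal \<bar>V n x\<bar>"
          using AE_arc_measure_in_boundary[OF \<Omega>(3) frontier_closed]
        proof eventually_elim
          case (elim x)
          then have "\<bar>pderiv_at j w x\<bar> \<le> D" using C[of x] by (simp add: D_def)
          then have "\<bar>V n x * pderiv_at j w x\<bar> \<le> D * \<bar>V n x\<bar>"
            unfolding abs_mult mult.commute[of D] by (rule mult_left_mono) simp
          then show ?case by (simp add: ennreal_leI D_def flip: ennreal_mult')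
        qed
      qed simp
      also have "\<dots> = ?c * (ennreal D * (\<integral>\<^sup>+x. ennreal \<bar>V n x\<bar> \<partial>?\<Gamma>))"
        by (simp add: nn_integral_cmult)
      finally show ?thesis .
    qed
    have "(\<lambda>n. ?c * (ennreal D * (\<integral>\<^sup>+x. ennreal \<bar>V n x\<bar> \<partial>?\<Gamma>))) \<longlonglongrightarrow> ?c * (ennreal D * 0)"
      by (intro ennreal_tendsto_cmult V) (simp_all only: of_nat_less_top ennreal_less_top)
    then have lim: "(\<lambda>n. ?c * (ennreal D * (\<integral>\<^sup>+x. ennreal \<bar>V n x\<bar> \<partial>?\<Gamma>))) \<longlonglongrightarrow> 0"
      by (simp only: mult_zero_right)
    have "(\<lambda>n. ennreal \<bar>?I n\<bar>) \<longlonglongrightarrow> 0"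
    proof (rule tendsto_sandwich[OF _ _ tendsto_const lim])
      show "\<forall>\<^sub>F n in sequentially. ennreal \<bar>?I n\<bar> \<le> ?c * (ennreal D * (\<integral>\<^sup>+x. ennreal \<bar>V n x\<bar> \<partial>?\<Gamma>))"
        by (intro always_eventually allI le)
    qed simp
    then have "(\<lambda>n. \<bar>?I n\<bar>) \<longlonglongrightarrow> 0"
      by (intro tendsto_ennrealD[where f="\<lambda>n. \<bar>?I n\<bar>"]) simp_all
    then show ?thesis by (rule tendsto_rabs_zero_cancel)
  qed
  have cross: "(LBINT x. (indicator \<Omega> x * pderiv_at 1 (V n) x) * dw 2 x) -
      (LBINT x. (indicator \<Omega> x * pderiv_at 2 (V n) x) * dw 1 x) =
      (LBINT x. indicator \<Omega> x * pderiv_at 1 (\<lambda>x. V n x * pderiv_at 2 w x) x) -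
      (LBINT x. indicator \<Omega> x * pderiv_at 2 (\<lambda>x. V n x * pderiv_at 1 w x) x)" for n
  proof -
    have pd: "pderiv_at i (\<lambda>x. V n x * pderiv_at j w x) x =
        V n x * pderiv_at i (pderiv_at j w) x + pderiv_at i (V n) x * pderiv_at j w x" for i j x
      by (intro pderiv_at_mult smooth_differentiable V smooth_pderiv_at w)
    have int: "integrable lborel (\<lambda>x. indicator \<Omega> x * h x)" if "smooth h" for h
      using \<Omega> that by (intro integrable_indicator_continuous continuous_on_smooth) auto
    have "(LBINT x. indicator \<Omega> x * pderiv_at i (\<lambda>x. V n x * pderiv_at j w x) x) =
      (LBINT x. indicator \<Omega> x * (V n x * pderiv_at i (pderiv_at j w) x)) +
      (LBINT x. indicator \<Omega> x * (pderiv_at i (V n) x * pderiv_at j w x))" for i j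
      unfolding pd distrib_left
      by (intro Bochner_Integration.integral_add int smooth_mult V smooth_pderiv_at w)
    moreover have "(LBINT x. (indicator \<Omega> x * pderiv_at i (V n) x) * dw j x) =
        (LBINT x. indicator \<Omega> x * (pderiv_at i (V n) x * pderiv_at j w x))" for i j
      unfolding dw_def by (intro Bochner_Integration.integral_cong) (auto simp: indicator_def)
    ultimately show ?thesis using pderiv_at_commute[OF w, of 1 2] by simp
  qed
  have "(\<lambda>n. (LBINT x. (indicator \<Omega> x * pderiv_at 1 (V n) x) * dw 2 x) -
      (LBINT x. (indicator \<Omega> x * pderiv_at 2 (V n) x) * dw 1 x)) \<longlonglongrightarrow>
      (LBINT x. X 1 x * dw 2 x) - (LBINT x. X 2 x * dw 1 x)"
    by (intro tendsto_diff L2_tendsto_integral_mult V dw)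
  moreover have "(\<lambda>n. (LBINT x. (indicator \<Omega> x * pderiv_at 1 (V n) x) * dw 2 x) -
      (LBINT x. (indicator \<Omega> x * pderiv_at 2 (V n) x) * dw 1 x)) \<longlonglongrightarrow> 0 - 0"
    unfolding cross by (intro tendsto_diff bdry)
  ultimately show ?thesis
    using LIMSEQ_unique by (fastforce simp: dw_def)
qed

text \<open>The integrand \<open>W\<close> below is the Jacobian determinant of the pair
  \<open>(v, \<rho>)\<close>. The last hypothesis says that at almost every boundary point one of
  the factors \<open>sin (s g)\<close> and \<open>1 - cos (2 pi m h)\<close> is zero; this is all
  that is asked of the two traces.\<close>

lemma ip_wderiv_cross_eq:
  assumes \<Omega>: "open \<Omega>" "bounded \<Omega>" "\<exists>E. is_edge_set (frontier \<Omega>) E"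
    and v: "has_trace \<Omega> v g" and \<rho>: "has_trace \<Omega> \<rho> h"
    and gh: "AE x in arc_measure (frontier \<Omega>). g x = 0 \<or> h x \<in> \<int>"
  shows "ip (wderiv \<Omega> 1 v) (wderiv \<Omega> 2 \<rho>) = ip (wderiv \<Omega> 2 v) (wderiv \<Omega> 1 \<rho>)"
proof -
  let ?\<Gamma> = "arc_measure (frontier \<Omega>)"
  let ?v = "rep_ae_fun v" and ?r = "rep_ae_fun \<rho>"
    and ?dv = "\<lambda>i. rep_ae_fun (wderiv \<Omega> i v)" and ?dr = "\<lambda>i. rep_ae_fun (wderiv \<Omega> i \<rho>)"
  have [measurable]: "g \<in> borel_measurable borel" "h \<in> borel_measurable borel"
    using v \<rho> by (auto simp: has_trace_def)
  obtain u where u: "\<And>n. smooth (u n)"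
    "\<And>i. L2_tendsto (\<lambda>n x. indicator \<Omega> x * pderiv_at i (u n) x) (?dv i)"
    "AE x in lborel. (\<lambda>n. indicator \<Omega> x * u n x) \<longlonglongrightarrow> ?v x"
    "(\<lambda>n. \<integral>\<^sup>+x. ennreal ((u n x - g x)\<^sup>2) \<partial>?\<Gamma>) \<longlonglongrightarrow> 0"
    by (rule has_trace_approximation[OF \<Omega>(1,2) v]) (rule that)
  obtain p where p: "\<And>n. smooth (p n)"
    "\<And>i. L2_tendsto (\<lambda>n x. indicator \<Omega> x * pderiv_at i (p n) x) (?dr i)"
    "AE x in lborel. (\<lambda>n. indicator \<Omega> x * p n x) \<longlonglongrightarrow> ?r x"
    "(\<lambda>n. \<integral>\<^sup>+x. ennreal ((p n x - h x)\<^sup>2) \<partial>?\<Gamma>) \<longlonglongrightarrow> 0"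
    by (rule has_trace_approximation[OF \<Omega>(1,2) \<rho>]) (rule that)
  have [measurable]: "u n \<in> borel_measurable borel" "p n \<in> borel_measurable borel" "\<Omega> \<in> sets borel" for n
    using u(1) p(1) \<Omega> by (auto intro: borel_measurable_smooth)
  have u1: "(\<lambda>n. \<integral>\<^sup>+x. ennreal \<bar>u n x - g x\<bar> \<partial>?\<Gamma>) \<longlonglongrightarrow> 0"
    by (rule nn_integral_abs_tendsto_0[OF _ finite_arc_measure u(4)]) measurable
  have p1: "(\<lambda>n. \<integral>\<^sup>+x. ennreal \<bar>p n x - h x\<bar> \<partial>?\<Gamma>) \<longlonglongrightarrow> 0"
    by (rule nn_integral_abs_tendsto_0[OF _ finite_arc_measure p(4)]) measurable
  have sv: "sq_int (?dv i)" and sr: "sq_int (?dr i)" for i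
    using L2_tendsto_sq_int(2)[OF u(2)] L2_tendsto_sq_int(2)[OF p(2)] by auto
  define W where "W x = ?dv 1 x * ?dr 2 x - ?dv 2 x * ?dr 1 x" for x
  have intW: "integrable lborel W"
    unfolding W_def by (intro Bochner_Integration.integrable_diff sq_int_mult_integrable sv sr)
  have key: "(LBINT x. cos (s * ?v x) * (1 - cos (2 * pi * real m * ?r x)) * W x) = 0" if s: "s > 0" for s m
  proof -
    define k where "k = 2 * pi * real m"
    have k: "k \<ge> 0" by (simp add: k_def)
    define V where "V n = (\<lambda>x. sin (s * u n x) * (1 - cos (k * p n x)))" for n
    \<comment> \<open>The limit of the gradients of \<open>V n\<close>. Its second summand is a
      multiple of the gradient of \<open>\<rho>\<close> and disappears from the cross product with
      that gradient.\<close>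
    define X where "X i = (\<lambda>x. s * cos (s * ?v x) * (1 - cos (k * ?r x)) * ?dv i x
      + k * sin (s * ?v x) * sin (k * ?r x) * ?dr i x)" for i
    have V: "smooth (V n)" for n
      unfolding V_def by (intro smooth_mult smooth_sin smooth_cos smooth_diff smooth_const u p)
    have dV: "pderiv_at i (V n) x = s * cos (s * u n x) * (1 - cos (k * p n x)) * pderiv_at i (u n) x
        + k * sin (s * u n x) * sin (k * p n x) * pderiv_at i (p n) x" for i n x
    proof -
      have 1: "pderiv_at i (\<lambda>x. sin (s * u n x)) x = (s * cos (s * u n x)) * pderiv_at i (u n) x"
        by (rule pderiv_at_compose_real[where F="\<lambda>y. sin (s * y)"])
          (auto intro!: smooth_differentiable u derivative_eq_intros)
      have 2: "pderiv_at i (\<lambda>x. 1 - cos (k * p n x)) x = (k * sin (k * p n x)) * pderiv_at i (p n) x"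
        by (rule pderiv_at_compose_real[where F="\<lambda>y. 1 - cos (k * y)"])
          (auto intro!: smooth_differentiable p derivative_eq_intros)
      have "pderiv_at i (V n) x = sin (s * u n x) * pderiv_at i (\<lambda>x. 1 - cos (k * p n x)) x +
          pderiv_at i (\<lambda>x. sin (s * u n x)) x * (1 - cos (k * p n x))"
        unfolding V_def
        by (rule pderiv_at_mult) (intro smooth_differentiable smooth_sin smooth_cos smooth_diff smooth_const smooth_cmult u p)+
      then show ?thesis unfolding 1 2 by (simp add: algebra_simps)
    qed
    have c2: "\<bar>1 - cos y\<bar> \<le> 2" for y :: real
      using cos_le_one[of y] cos_ge_minus_one[of y] by linarith
    \<comment> \<open>The coefficients of the derivatives contain \<open>u n\<close> and
      \<open>p n\<close> only inside sines and cosines; being bounded, they preserve convergence in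
      the square mean.\<close>
    have XL: "L2_tendsto (\<lambda>n x. indicator \<Omega> x * pderiv_at i (V n) x) (X i)" for i
    proof -
      have b1: "\<bar>s * cos y * (1 - cos z)\<bar> \<le> s * 2" for y z
        using s c2[of z] abs_cos_le_one[of y] mult_mono[OF abs_cos_le_one[of y] c2[of z]]
        by (simp add: abs_mult mult.assoc)
      have b2: "\<bar>k * sin y * sin z\<bar> \<le> k" for y z
        using k mult_mono[OF abs_sin_le_one[of y] abs_sin_le_one[of z]]
        by (simp add: abs_mult mult.assoc mult_left_le)
      have "L2_tendsto (\<lambda>n x. s * cos (s * (indicator \<Omega> x * u n x)) * (1 - cos (k * (indicator \<Omega> x * p n x))) *
            (indicator \<Omega> x * pderiv_at i (u n) x))
          (\<lambda>x. s * cos (s * ?v x) * (1 - cos (k * ?r x)) * ?dv i x)"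
      proof (rule L2_tendsto_bounded_mult[OF u(2), where C="s * 2"])
        show "AE x in lborel. (\<lambda>n. s * cos (s * (indicator \<Omega> x * u n x)) * (1 - cos (k * (indicator \<Omega> x * p n x))))
            \<longlonglongrightarrow> s * cos (s * ?v x) * (1 - cos (k * ?r x))"
          using u(3) p(3) by eventually_elim (intro tendsto_intros)
      qed (measurable, rule b1, rule b1)
      moreover have "L2_tendsto (\<lambda>n x. k * sin (s * (indicator \<Omega> x * u n x)) * sin (k * (indicator \<Omega> x * p n x)) *
            (indicator \<Omega> x * pderiv_at i (p n) x))
          (\<lambda>x. k * sin (s * ?v x) * sin (k * ?r x) * ?dr i x)"
      proof (rule L2_tendsto_bounded_mult[OF p(2), where C=k])
        show "AE x in lborel. (\<lambda>n. k * sin (s * (indicator \<Omega> x * u n x)) * sin (k * (indicator \<Omega> x * p n x)))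
            \<longlonglongrightarrow> k * sin (s * ?v x) * sin (k * ?r x)"
          using u(3) p(3) by eventually_elim (intro tendsto_intros)
      qed (measurable, rule b2, rule b2)
      ultimately have "L2_tendsto (\<lambda>n x. s * cos (s * (indicator \<Omega> x * u n x)) * (1 - cos (k * (indicator \<Omega> x * p n x))) *
            (indicator \<Omega> x * pderiv_at i (u n) x) +
            k * sin (s * (indicator \<Omega> x * u n x)) * sin (k * (indicator \<Omega> x * p n x)) *
            (indicator \<Omega> x * pderiv_at i (p n) x)) (X i)"
        unfolding X_def by (rule L2_tendsto_add)
      also have "(\<lambda>n x. s * cos (s * (indicator \<Omega> x * u n x)) * (1 - cos (k * (indicator \<Omega> x * p n x))) *
            (indicator \<Omega> x * pderiv_at i (u n) x) +
            k * sin (s * (indicator \<Omega> x * u n x)) * sin (k * (indicator \<Omega> x * p n x)) *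
            (indicator \<Omega> x * pderiv_at i (p n) x)) = (\<lambda>n x. indicator \<Omega> x * pderiv_at i (V n) x)"
        unfolding dV by (auto simp: fun_eq_iff indicator_def)
      finally show ?thesis .
    qed
    \<comment> \<open>The composed function is 0 at \<open>(g x, h x)\<close>, so the Lipschitz
      bound measures \<open>V n\<close> by the two trace errors alone.\<close>
    have Vb: "(\<lambda>n. \<integral>\<^sup>+x. ennreal \<bar>V n x\<bar> \<partial>?\<Gamma>) \<longlonglongrightarrow> 0"
    proof (rule tendsto_sandwich[OF _ _ tendsto_const])
      show "\<forall>\<^sub>F n in sequentially. 0 \<le> (\<integral>\<^sup>+x. ennreal \<bar>V n x\<bar> \<partial>?\<Gamma>)" by simp
      show "\<forall>\<^sub>F n in sequentially. (\<integral>\<^sup>+x. ennreal \<bar>V n x\<bar> \<partial>?\<Gamma>) \<le>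
        ennreal (2 * s) * (\<integral>\<^sup>+x. ennreal \<bar>u n x - g x\<bar> \<partial>?\<Gamma>) + ennreal k * (\<integral>\<^sup>+x. ennreal \<bar>p n x - h x\<bar> \<partial>?\<Gamma>)"
      proof (rule always_eventually, rule allI)
        fix n
        have "(\<integral>\<^sup>+x. ennreal \<bar>V n x\<bar> \<partial>?\<Gamma>) \<le>
          (\<integral>\<^sup>+x. ennreal (2 * s) * ennreal \<bar>u n x - g x\<bar> + ennreal k * ennreal \<bar>p n x - h x\<bar> \<partial>?\<Gamma>)"
        proof (rule nn_integral_mono_AE)
          show "AE x in ?\<Gamma>. ennreal \<bar>V n x\<bar> \<le> ennreal (2 * s) * ennreal \<bar>u n x - g x\<bar> + ennreal k * ennreal \<bar>p n x - h x\<bar>"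
            using gh
          proof eventually_elim
            case (elim x)
            have "cos (k * h x) = 1" if "h x \<in> \<int>"
              using cos_integer_2pi[of "real m * h x"] that by (simp add: k_def mult.assoc)
            then have zero: "sin (s * g x) * (1 - cos (k * h x)) = 0" using elim by auto
            have "\<bar>V n x\<bar> \<le> 2 * s * \<bar>u n x - g x\<bar> + k * \<bar>p n x - h x\<bar>"
              using abs_sin_mult_one_minus_cos_diff_le[of s k "u n x" "p n x" "g x" "h x"] s k
              unfolding zero V_def by simp
            then have "ennreal \<bar>V n x\<bar> \<le> ennreal (2 * s * \<bar>u n x - g x\<bar> + k * \<bar>p n x - h x\<bar>)"
              by (rule ennreal_leI)
            also have "\<dots> = ennreal (2 * s) * ennreal \<bar>u n x - g x\<bar> + ennreal k * ennreal \<bar>p n x - h x\<bar>"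
              using s k by (subst ennreal_plus) (auto simp: ennreal_mult')
            finally show ?case .
          qed
        qed
        also have "\<dots> = ennreal (2 * s) * (\<integral>\<^sup>+x. ennreal \<bar>u n x - g x\<bar> \<partial>?\<Gamma>) + ennreal k * (\<integral>\<^sup>+x. ennreal \<bar>p n x - h x\<bar> \<partial>?\<Gamma>)"
          by (simp add: nn_integral_add nn_integral_cmult)
        finally show "(\<integral>\<^sup>+x. ennreal \<bar>V n x\<bar> \<partial>?\<Gamma>) \<le>
          ennreal (2 * s) * (\<integral>\<^sup>+x. ennreal \<bar>u n x - g x\<bar> \<partial>?\<Gamma>) + ennreal k * (\<integral>\<^sup>+x. ennreal \<bar>p n x - h x\<bar> \<partial>?\<Gamma>)" .
      qed
      have "(\<lambda>n. ennreal (2 * s) * (\<integral>\<^sup>+x. ennreal \<bar>u n x - g x\<bar> \<partial>?\<Gamma>) + ennreal k * (\<integral>\<^sup>+x. ennreal \<bar>p n x - h x\<bar> \<partial>?\<Gamma>))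
          \<longlonglongrightarrow> ennreal (2 * s) * 0 + ennreal k * 0"
        by (intro tendsto_add ennreal_tendsto_cmult u1 p1) auto
      then show "(\<lambda>n. ennreal (2 * s) * (\<integral>\<^sup>+x. ennreal \<bar>u n x - g x\<bar> \<partial>?\<Gamma>) + ennreal k * (\<integral>\<^sup>+x. ennreal \<bar>p n x - h x\<bar> \<partial>?\<Gamma>)) \<longlonglongrightarrow> 0"
        by simp
    qed
    have sX: "sq_int (X i)" for i using L2_tendsto_sq_int(2)[OF XL] .
    \<comment> \<open>The two limits are taken one after the other: here \<open>V\<close> has passed
      to its limit with \<open>w = p n\<close> held fixed, and only then does \<open>p n\<close>
      tend to \<open>\<rho>\<close>.\<close>
    have "(LBINT x. X 1 x * (indicator \<Omega> x * pderiv_at 2 (p n) x)) =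
        (LBINT x. X 2 x * (indicator \<Omega> x * pderiv_at 1 (p n) x))" for n
      by (rule integral_smooth_cross_boundary[OF \<Omega> V XL Vb p(1)])
    then have eq: "(\<lambda>n. LBINT x. (indicator \<Omega> x * pderiv_at 2 (p n) x) * X 1 x) =
        (\<lambda>n. LBINT x. (indicator \<Omega> x * pderiv_at 1 (p n) x) * X 2 x)"
      by (simp add: mult.commute)
    have lim: "(\<lambda>n. LBINT x. (indicator \<Omega> x * pderiv_at i (p n) x) * X j x) \<longlonglongrightarrow>
        (LBINT x. ?dr i x * X j x)" for i j
      by (rule L2_tendsto_integral_mult[OF p(2) sX])
    have "(LBINT x. ?dr 2 x * X 1 x) = (LBINT x. ?dr 1 x * X 2 x)"
      by (rule LIMSEQ_unique[OF lim[of 2 1, unfolded eq] lim[of 1 2]])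
    then have "(LBINT x. ?dr 2 x * X 1 x - ?dr 1 x * X 2 x) = 0"
      by (simp add: Bochner_Integration.integral_diff[OF sq_int_mult_integrable[OF sr sX] sq_int_mult_integrable[OF sr sX]])
    also have "(\<lambda>x. ?dr 2 x * X 1 x - ?dr 1 x * X 2 x) = (\<lambda>x. s * (cos (s * ?v x) * (1 - cos (k * ?r x)) * W x))"
      by (simp add: fun_eq_iff X_def W_def algebra_simps)
    finally show ?thesis using s by (simp add: k_def)
  qed
  \<comment> \<open>Division by \<open>s\<close> has left the factor \<open>cos (s v)\<close>, which
    tends to 1 boundedly along \<open>s = 1 / real (Suc n)\<close>.\<close>
  have key2: "(LBINT x. (1 - cos (2 * pi * real m * ?r x)) * W x) = 0" for m
  proof -
    have c2: "\<bar>1 - cos y\<bar> \<le> 2" for y :: real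
      using cos_le_one[of y] cos_ge_minus_one[of y] by linarith
    have i: "integrable lborel (\<lambda>x. (1 - cos (2 * pi * real m * ?r x)) * W x)"
      by (rule integrable_bounded_mult[OF intW _ c2]) measurable
    have "(\<lambda>n. LBINT x. cos ((1 / real (Suc n)) * ?v x) * ((1 - cos (2 * pi * real m * ?r x)) * W x)) \<longlonglongrightarrow>
        (LBINT x. 1 * ((1 - cos (2 * pi * real m * ?r x)) * W x))"
    proof (rule bounded_convergence_mult[OF i, where C=1])
      have "(\<lambda>n. 1 / real (Suc n)) \<longlonglongrightarrow> 0"
        using LIMSEQ_inverse_real_of_nat by (simp add: inverse_eq_divide)
      then have "(\<lambda>n. cos ((1 / real (Suc n)) * ?v x)) \<longlonglongrightarrow> cos (0 * ?v x)" for x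
        by (intro tendsto_intros)
      then show "AE x in lborel. (\<lambda>n. cos ((1 / real (Suc n)) * ?v x)) \<longlonglongrightarrow> 1" by simp
    qed (auto intro: abs_cos_le_one)
    moreover have "(LBINT x. cos ((1 / real (Suc n)) * ?v x) * ((1 - cos (2 * pi * real m * ?r x)) * W x)) = 0" for n
      using key[of "1 / real (Suc n)" m] by (simp add: mult.assoc)
    ultimately show ?thesis using LIMSEQ_unique[OF tendsto_const] by fastforce
  qed
  have key3: "(LBINT x. cos (2 * pi * real m * ?r x) * W x) = (LBINT x. W x)" for m
  proof -
    have i: "integrable lborel (\<lambda>x. cos (2 * pi * real m * ?r x) * W x)"
      by (rule integrable_bounded_mult[OF intW _ abs_cos_le_one]) measurable
    have "(LBINT x. W x - cos (2 * pi * real m * ?r x) * W x) = 0"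
      using key2[of m] by (simp add: left_diff_distrib)
    then show ?thesis using Bochner_Integration.integral_diff[OF intW i] by simp
  qed
  have mean: "(LBINT x. cos_mean N (?r x) * W x) = (LBINT x. W x)" for N
  proof -
    have i1: "integrable lborel (\<lambda>x. cos (2 * pi * real m * ?r x) * W x)" for m
      by (rule integrable_bounded_mult[OF intW _ abs_cos_le_one]) measurable
    have "(LBINT x. cos_mean N (?r x) * W x) =
        (LBINT x. (\<Sum>l<Suc N. cos (2 * pi * real (Suc N + l) * ?r x) * W x) / real (Suc N))"
      by (simp add: cos_mean_def sum_distrib_right del: sum.lessThan_Suc)
    also have "\<dots> = (\<Sum>l<Suc N. LBINT x. cos (2 * pi * real (Suc N + l) * ?r x) * W x) / real (Suc N)"
      using i1 by (simp del: sum.lessThan_Suc of_nat_Suc of_nat_add)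
    also have "\<dots> = (LBINT x. W x)" unfolding key3 by simp
    finally show ?thesis .
  qed
  have meas [measurable]: "(\<lambda>x. indicator \<int> (?r x) :: real) \<in> borel_measurable borel"
    by (rule measurable_compose[OF rep_ae_fun_measurable borel_measurable_indicator])
      (intro borel_closed closed_Ints)
  have "(\<lambda>N. LBINT x. cos_mean N (?r x) * W x) \<longlonglongrightarrow> (LBINT x. indicator \<int> (?r x) * W x)"
    by (rule bounded_convergence_mult[OF intW, where C=1]) (auto intro: abs_cos_mean_le cos_mean_tendsto)
  then have "(LBINT x. W x) = (LBINT x. indicator \<int> (?r x) * W x)"
    unfolding mean using LIMSEQ_unique[OF tendsto_const] by blast
  also have "\<dots> = (\<integral>x. 0 \<partial>(lborel :: (real^2) measure))"
  proof (rule integral_cong_AE)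
    show "AE x in lborel. indicator \<int> (?r x) * W x = 0"
      using wderiv_eq_0_on_integer_level_sets[OF \<Omega>(1,2) \<rho>, of 1] wderiv_eq_0_on_integer_level_sets[OF \<Omega>(1,2) \<rho>, of 2]
      by eventually_elim (auto simp: indicator_def W_def)
  qed (use intW in measurable)
  finally have "(LBINT x. W x) = 0" by simp
  moreover have "(LBINT x. W x) = (LBINT x. ?dv 1 x * ?dr 2 x) - (LBINT x. ?dv 2 x * ?dr 1 x)"
    unfolding W_def by (intro Bochner_Integration.integral_diff sq_int_mult_integrable sv sr)
  ultimately show ?thesis by (simp add: ip.rep_eq)
qed

section \<open>The decoupled problem\<close>

lemma linear_functionals_mono: "F \<in> linear_functionals V \<Longrightarrow> U \<subseteq> V \<Longrightarrow> F \<in> linear_functionals U"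
  unfolding linear_functionals_def by blast

lemma linear_functionals_add:
  "F \<in> linear_functionals V \<Longrightarrow> F' \<in> linear_functionals V \<Longrightarrow> (\<lambda>x. F x + F' x) \<in> linear_functionals V"
  by (auto simp: linear_functionals_def algebra_simps)

lemma linear_functionals_diff:
  "F \<in> linear_functionals V \<Longrightarrow> F' \<in> linear_functionals V \<Longrightarrow> (\<lambda>x. F x - F' x) \<in> linear_functionals V"
  by (auto simp: linear_functionals_def algebra_simps)

lemma linear_functionals_cmult:
  "F \<in> linear_functionals V \<Longrightarrow> (\<lambda>x. c * F x) \<in> linear_functionals V"
  by (auto simp: linear_functionals_def algebra_simps)

lemma linear_functionals_zero: "(\<lambda>x. 0) \<in> linear_functionals V"
  by (simp add: linear_functionals_def)

lemma linear_functionals_sum: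
  "(\<And>i. i \<in> I \<Longrightarrow> F i \<in> linear_functionals V) \<Longrightarrow> (\<lambda>x. \<Sum>i\<in>I. F i x) \<in> linear_functionals V"
  by (induction I rule: infinite_finite_induct)
    (auto intro: linear_functionals_add linear_functionals_zero)

lemma linear_functional_0:
  assumes "F \<in> linear_functionals V" "subspace V"
  shows "F 0 = 0"
  using linear_functionalsD(2)[OF assms(1) subspace_0[OF assms(2)], of 0] by simp

lemma linear_functional_sum:
  assumes "F \<in> linear_functionals V" "subspace V"
  shows "(\<And>i. i \<in> I \<Longrightarrow> v i \<in> V) \<Longrightarrow> F (\<Sum>i\<in>I. c i *\<^sub>R v i) = (\<Sum>i\<in>I. c i * F (v i))"
proof (induction I rule: infinite_finite_induct)
  case (insert i I)
  have "(\<Sum>i\<in>I. c i *\<^sub>R v i) \<in> V" "c i *\<^sub>R v i \<in> V"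
    using insert.prems by (auto intro!: subspace_sum subspace_scale assms(2))
  then show ?case
    using insert linear_functionalsD[OF assms(1)] by simp
qed (simp_all add: linear_functional_0[OF assms])

lemma linear_functional_compose_grad:
  assumes "open \<Omega>" "W \<subseteq> H1 \<Omega>" "grad \<Omega> ` W \<subseteq> U" "F \<in> linear_functionals U"
  shows "(\<lambda>v. F (grad \<Omega> v)) \<in> linear_functionals W"
proof -
  have U: "grad \<Omega> v \<in> U" "v \<in> H1 \<Omega>" if "v \<in> W" for v using that assms(2,3) by blast+
  show ?thesis
    unfolding linear_functionals_def
  proof (intro CollectI conjI ballI allI)
    show "F (grad \<Omega> (u + v)) = F (grad \<Omega> u) + F (grad \<Omega> v)" if "u \<in> W" "v \<in> W" for u v
      unfolding grad_add[OF assms(1) U(2)[OF that(1)] U(2)[OF that(2)]]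
      by (rule linear_functionalsD(1)[OF assms(4) U(1)[OF that(1)] U(1)[OF that(2)]])
    show "F (grad \<Omega> (c *\<^sub>R v)) = c * F (grad \<Omega> v)" if "v \<in> W" for c v
      unfolding grad_scaleR[OF assms(1) U(2)[OF that]]
      by (rule linear_functionalsD(2)[OF assms(4) U(1)[OF that]])
  qed
qed

lemma ip_vec_commute: "ip_vec \<theta> \<eta> = ip_vec \<eta> \<theta>"
  by (simp add: ip_vec_def ip_commute)

lemma ip_vec_linear:
  assumes "\<theta> \<in> L2 \<Omega> \<times> L2 \<Omega>"
  shows "ip_vec \<theta> \<in> linear_functionals (L2 \<Omega> \<times> L2 \<Omega>)"
    and "(\<lambda>\<eta>. ip_vec \<eta> \<theta>) \<in> linear_functionals (L2 \<Omega> \<times> L2 \<Omega>)"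
proof -
  have L: "fst \<eta> \<in> L2 \<Omega>" "snd \<eta> \<in> L2 \<Omega>" if "\<eta> \<in> L2 \<Omega> \<times> L2 \<Omega>" for \<eta>
    using that by (auto simp: mem_Times_iff)
  show 1: "ip_vec \<theta> \<in> linear_functionals (L2 \<Omega> \<times> L2 \<Omega>)"
    unfolding linear_functionals_def
  proof (intro CollectI conjI ballI allI)
    show "ip_vec \<theta> (u + v) = ip_vec \<theta> u + ip_vec \<theta> v" if u: "u \<in> L2 \<Omega> \<times> L2 \<Omega>" and v: "v \<in> L2 \<Omega> \<times> L2 \<Omega>" for u v
      unfolding ip_vec_def fst_add snd_add ip_add_right_L2[OF L(1)[OF u] L(1)[OF v] L(1)[OF assms]]
        ip_add_right_L2[OF L(2)[OF u] L(2)[OF v] L(2)[OF assms]] by simp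
    show "ip_vec \<theta> (c *\<^sub>R u) = c * ip_vec \<theta> u" for c u
      unfolding ip_vec_def fst_scaleR snd_scaleR ip_scaleR_right by (simp add: distrib_left)
  qed
  have "(\<lambda>\<eta>. ip_vec \<eta> \<theta>) = ip_vec \<theta>" by (rule ext, rule ip_vec_commute)
  with 1 show "(\<lambda>\<eta>. ip_vec \<eta> \<theta>) \<in> linear_functionals (L2 \<Omega> \<times> L2 \<Omega>)" by simp
qed

lemma ip_vec_self_eq_0D:
  assumes "\<eta> \<in> L2 \<Omega> \<times> L2 \<Omega>" "ip_vec \<eta> \<eta> = 0"
  shows "\<eta> = 0"
proof -
  have "ip (fst \<eta>) (fst \<eta>) = 0" "ip (snd \<eta>) (snd \<eta>) = 0"
    using assms(2) ip_self_nonneg[of "fst \<eta>"] ip_self_nonneg[of "snd \<eta>"] by (simp_all add: ip_vec_def)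
  then have "fst \<eta> = 0" "snd \<eta> = 0"
    using assms(1) ip_self_eq_0D by (auto simp: mem_Times_iff)
  then show ?thesis by (simp add: prod_eq_iff)
qed

lemma Hcurl_subset_L2: "Hcurl \<Omega> \<subseteq> L2 \<Omega> \<times> L2 \<Omega>"
  by (auto simp: Hcurl_def)

lemma ip_curl_linear:
  assumes \<Omega>: "open \<Omega>" and c: "c \<in> L2 \<Omega>"
  shows "(\<lambda>\<eta>. ip c (curl \<Omega> \<eta>)) \<in> linear_functionals (Hcurl \<Omega>)"
  unfolding linear_functionals_def
proof (intro CollectI conjI ballI allI)
  show "ip c (curl \<Omega> (u + v)) = ip c (curl \<Omega> u) + ip c (curl \<Omega> v)" if "u \<in> Hcurl \<Omega>" "v \<in> Hcurl \<Omega>" for u v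
    unfolding curl_add[OF \<Omega> that]
    by (rule ip_add_right_L2[OF curl_Hcurl(1)[OF \<Omega> that(1)] curl_Hcurl(1)[OF \<Omega> that(2)] c])
  show "ip c (curl \<Omega> (k *\<^sub>R u)) = k * ip c (curl \<Omega> u)" if "u \<in> Hcurl \<Omega>" for k u
    unfolding curl_scaleR[OF \<Omega> that] by (rule ip_scaleR_right)
qed

lemma ip_curl_commute: "ip_curl \<Omega> \<theta> \<eta> = ip_curl \<Omega> \<eta> \<theta>"
  by (simp add: ip_curl_def ip_vec_commute ip_commute)

lemma bilinear_ip_curl: 
  assumes "open \<Omega>"
  shows "bilinear_form_on (Hcurl \<Omega>) (ip_curl \<Omega>)"
proof -
  have "ip_curl \<Omega> \<theta> \<in> linear_functionals (Hcurl \<Omega>)" if "\<theta> \<in> Hcurl \<Omega>" for \<theta>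
    unfolding ip_curl_def[abs_def]
    using that Hcurl_subset_L2
    by (intro linear_functionals_add ip_curl_linear[OF assms curl_Hcurl(1)[OF assms that]]
      linear_functionals_mono[OF ip_vec_linear(1) Hcurl_subset_L2]) auto
  then show ?thesis
    unfolding bilinear_form_on_def using ip_curl_commute[of \<Omega>] by auto
qed

lemma ip_curl_self_eq_0D:
  assumes "\<eta> \<in> Hcurl \<Omega>" "ip_curl \<Omega> \<eta> \<eta> = 0"
  shows "\<eta> = 0"
proof (rule ip_vec_self_eq_0D)
  show "\<eta> \<in> L2 \<Omega> \<times> L2 \<Omega>" using assms(1) Hcurl_subset_L2 by blast
  have "0 \<le> ip_vec \<eta> \<eta>" by (simp add: ip_vec_def ip_self_nonneg)
  then show "ip_vec \<eta> \<eta> = 0"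
    using assms(2) ip_self_nonneg[of "curl \<Omega> \<eta>"] unfolding ip_curl_def by linarith
qed

lemma bilinear_form_on_mono: "bilinear_form_on V B \<Longrightarrow> U \<subseteq> V \<Longrightarrow> bilinear_form_on U B"
  unfolding bilinear_form_on_def by (auto intro: linear_functionals_mono)

lemma tangential_pairing_linear:
  assumes \<Omega>: "open \<Omega>" and \<rho>: "\<rho> \<in> H1 \<Omega>"
  shows "(\<lambda>\<eta>. tangential_pairing \<Omega> \<eta> \<rho>) \<in> linear_functionals (Hcurl \<Omega>)"
proof -
  have fs: "(\<lambda>\<eta>. ip (snd \<eta>) c) \<in> linear_functionals (Hcurl \<Omega>)" "(\<lambda>\<eta>. ip (fst \<eta>) c) \<in> linear_functionals (Hcurl \<Omega>)"
    if "c \<in> L2 \<Omega>" for c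
    using that Hcurl_L2 unfolding linear_functionals_def
    by (auto simp: ip_scaleR_left intro!: ip_add_left_L2)
  show ?thesis
    unfolding tangential_pairing_def ip_commute[of "curl \<Omega> _"]
    by (intro linear_functionals_add linear_functionals_diff ip_curl_linear \<Omega> H1_L2 \<rho> fs wderiv_H1(1))
qed

lemma b_tilde_linear:
  assumes "open \<Omega>" "r \<in> L2 \<Omega>" "\<And>i. i \<in> {1..N - 1} \<Longrightarrow> \<rho> i \<in> H1 \<Omega>"
  shows "(\<lambda>\<eta>. b_tilde \<Omega> N \<rho> \<eta> r \<kappa>) \<in> linear_functionals (Hcurl \<Omega>)"
  unfolding b_tilde_def
  by (intro linear_functionals_add linear_functionals_sum linear_functionals_cmult ip_curl_linear
      tangential_pairing_linear assms)

lemma restrict_in_vecs: "restrict f {1..N - 1} \<in> vecs N"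
  by (simp add: vecs_def)

text \<open>The algebraic core, with \<open>W\<close> for \<open>Wt\<^sub>\<Gamma>\<close> and
  \<open>V\<close> for \<open>W\<^sub>\<Gamma>\<close>. The form \<open>B\<close> is replaced by
  \<open>a\<close> on gradients; the continuous and the discrete inf-sup condition survive as
  \<open>grad_injective\<close> and \<open>nondegenerate\<close>, and the argument about traces
  survives as \<open>pairing_grad\<close>.\<close>

locale decoupled_spaces =
  fixes \<Omega> :: "(real^2) set" and N :: nat and \<rho> :: "nat \<Rightarrow> ae_fun"
    and a :: "ae_field \<Rightarrow> ae_field \<Rightarrow> real"
    and W V :: "ae_fun set" and G Q :: "ae_field set"
  assumes open_\<Omega>: "open \<Omega>"
    and W: "fin_dim_subspace W" "W \<subseteq> H1 \<Omega>"
    and G: "fin_dim_subspace G" "G \<subseteq> H1 \<Omega> \<times> H1 \<Omega>"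
    and bilinear_a: "bilinear_form_on (H1 \<Omega> \<times> H1 \<Omega>) a"
    and grad_injective: "\<And>v. v \<in> W \<Longrightarrow> grad \<Omega> v = 0 \<Longrightarrow> v = 0"
    and V_eq: "V = {v \<in> W. grad \<Omega> v \<in> G}"
    and nondegenerate: "\<And>u. u \<in> V \<Longrightarrow> (\<And>v. v \<in> V \<Longrightarrow> a (grad \<Omega> u) (grad \<Omega> v) = 0) \<Longrightarrow> u = 0"
    and \<rho>: "\<And>i. i \<in> {1..N - 1} \<Longrightarrow> \<rho> i \<in> H1 \<Omega>"
    and curl_free_surjective: "\<And>\<kappa>. \<kappa> \<in> vecs N \<Longrightarrow>
      \<exists>\<psi>\<in>G. curl \<Omega> \<psi> = 0 \<and> (\<forall>i\<in>{1..N - 1}. tangential_pairing \<Omega> \<psi> (\<rho> i) = \<kappa> i)"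
    and grad_V: "grad \<Omega> ` V = {\<gamma> \<in> G. curl \<Omega> \<gamma> = 0 \<and> (\<forall>i\<in>{1..N - 1}. tangential_pairing \<Omega> \<gamma> (\<rho> i) = 0)}"
    and pairing_grad: "\<And>v i. v \<in> W \<Longrightarrow> i \<in> {1..N - 1} \<Longrightarrow> tangential_pairing \<Omega> (grad \<Omega> v) (\<rho> i) = 0"
    and Q_eq: "Q = (\<lambda>(v, \<psi>). Xi \<Omega> v \<psi>) ` (W \<times> G)"
begin

abbreviation "\<tau> \<eta> i \<equiv> tangential_pairing \<Omega> \<eta> (\<rho> i)"
abbreviation "b \<eta> r \<kappa> \<equiv> b_tilde \<Omega> N \<rho> \<eta> r \<kappa>"

lemma subspaces: "subspace W" "subspace G"
  using W(1) G(1) by (auto intro: subspace_if_fin_dim)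

lemma W_H1: "v \<in> W \<Longrightarrow> v \<in> H1 \<Omega>" and G_H1: "\<psi> \<in> G \<Longrightarrow> \<psi> \<in> H1 \<Omega> \<times> H1 \<Omega>"
  using W(2) G(2) by auto

lemma G_Hcurl: "G \<subseteq> Hcurl \<Omega>"
  using H1_fields_Hcurl[OF open_\<Omega>] G(2) by blast

lemma V_W: "v \<in> V \<Longrightarrow> v \<in> W" and grad_V_G: "v \<in> V \<Longrightarrow> grad \<Omega> v \<in> G"
  by (auto simp: V_eq)

lemma grad_W_Hcurl: "v \<in> W \<Longrightarrow> grad \<Omega> v \<in> Hcurl \<Omega>" and curl_grad_W: "v \<in> W \<Longrightarrow> curl \<Omega> (grad \<Omega> v) = 0"
  using grad_Hcurl[OF open_\<Omega>] curl_grad[OF open_\<Omega>] W_H1 by auto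

lemma grad_L2: "v \<in> W \<Longrightarrow> grad \<Omega> v \<in> L2 \<Omega> \<times> L2 \<Omega>" and G_L2: "\<psi> \<in> G \<Longrightarrow> \<psi> \<in> L2 \<Omega> \<times> L2 \<Omega>"
  using grad_W_Hcurl G_Hcurl Hcurl_subset_L2 by blast+

lemma linear_\<tau>: "i \<in> {1..N - 1} \<Longrightarrow> (\<lambda>\<eta>. \<tau> \<eta> i) \<in> linear_functionals G"
  by (rule linear_functionals_mono[OF tangential_pairing_linear[OF open_\<Omega> \<rho>] G_Hcurl])

lemma fin_dim_V: "fin_dim_subspace V"
proof (rule fin_dim_subspace_mono[OF W(1)])
  show "subspace V"
    unfolding V_eq
  proof (rule subspaceI)
    show "0 \<in> {v \<in> W. grad \<Omega> v \<in> G}"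
      using subspaces by (simp add: subspace_0 grad_zero[OF open_\<Omega>])
    show "x + y \<in> {v \<in> W. grad \<Omega> v \<in> G}" if "x \<in> {v \<in> W. grad \<Omega> v \<in> G}" "y \<in> {v \<in> W. grad \<Omega> v \<in> G}" for x y
      using that subspaces by (simp add: subspace_add grad_add[OF open_\<Omega>] W_H1)
    show "c *\<^sub>R x \<in> {v \<in> W. grad \<Omega> v \<in> G}" if "x \<in> {v \<in> W. grad \<Omega> v \<in> G}" for c x
      using that subspaces by (simp add: subspace_scale grad_scaleR[OF open_\<Omega>] W_H1)
  qed
qed (auto simp: V_eq)

lemma fin_dim_curl_G: "fin_dim_subspace (curl \<Omega> ` G)"
  using G_Hcurl by (intro fin_dim_subspace_image[OF G(1)] curl_add[OF open_\<Omega>] curl_scaleR[OF open_\<Omega>]) auto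

lemma curl_G_L2: "r \<in> curl \<Omega> ` G \<Longrightarrow> r \<in> L2 \<Omega>"
  using curl_Hcurl(1)[OF open_\<Omega>] G_Hcurl by auto

text \<open>\<open>Q\<close> is the image of \<open>W \<times> G\<close> under a map that is linear
  there, and a product of two spans is spanned by the generators of each factor, padded with
  0.\<close>

lemma fin_dim_Q: "fin_dim_subspace Q" and Q_Hcurl: "Q \<subseteq> Hcurl \<Omega>"
proof -
  obtain S T where S: "finite S" "W = span S" and T: "finite T" "G = span T"
    using W(1) G(1) by (auto simp: fin_dim_subspace_def)
  have "span (S \<times> {0} \<union> {0} \<times> T) = W \<times> G"
    unfolding S T
  proof
    show "span (S \<times> {0} \<union> {0} \<times> T) \<subseteq> span S \<times> span T"
      by (intro span_minimal subspace_Times subspace_span) (auto intro: span_base span_zero)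
    show "span S \<times> span T \<subseteq> span (S \<times> {0} \<union> {0} \<times> T)"
    proof clarify
      fix x y assume xy: "x \<in> span S" "y \<in> span T"
      have lin: "linear (\<lambda>x::ae_fun. (x, 0::ae_field))" "linear (\<lambda>y::ae_field. (0::ae_fun, y))"
        by (auto intro!: linearI)
      have "(x, 0) \<in> span ((\<lambda>x. (x, 0::ae_field)) ` S)"
        unfolding linear_span_image[OF lin(1)] by (rule imageI[OF xy(1)])
      moreover have "span ((\<lambda>x. (x, 0::ae_field)) ` S) \<subseteq> span (S \<times> {0} \<union> {0} \<times> T)" by (rule span_mono) auto
      moreover have "(0, y) \<in> span ((\<lambda>y. (0::ae_fun, y)) ` T)"
        unfolding linear_span_image[OF lin(2)] by (rule imageI[OF xy(2)])
      moreover have "span ((\<lambda>y. (0::ae_fun, y)) ` T) \<subseteq> span (S \<times> {0} \<union> {0} \<times> T)" by (rule span_mono) auto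
      ultimately have "(x, 0) + (0, y) \<in> span (S \<times> {0} \<union> {0} \<times> T)"
        by (intro span_add) blast+
      then show "(x, y) \<in> span (S \<times> {0} \<union> {0} \<times> T)" by simp
    qed
  qed
  moreover have "finite (S \<times> {0} \<union> {0} \<times> T)" using S T by simp
  ultimately have "fin_dim_subspace (W \<times> G)" unfolding fin_dim_subspace_def by metis
  then show "fin_dim_subspace Q"
    unfolding Q_eq case_prod_unfold
    by (rule fin_dim_subspace_image)
      (simp_all add: Xi_def grad_add[OF open_\<Omega>] grad_scaleR[OF open_\<Omega>] W_H1 scaleR_diff_right mem_Times_iff)
  show "Q \<subseteq> Hcurl \<Omega>"
  proof
    fix q assume "q \<in> Q"
    then obtain p where p: "p \<in> W \<times> G" "q = Xi \<Omega> (fst p) (snd p)"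
      unfolding Q_eq case_prod_unfold by blast
    then have "grad \<Omega> (fst p) \<in> Hcurl \<Omega>" "snd p \<in> Hcurl \<Omega>"
      using grad_W_Hcurl[of "fst p"] subsetD[OF G_Hcurl, of "snd p"] by (simp_all add: mem_Times_iff)
    then show "q \<in> Hcurl \<Omega>"
      unfolding p(2) Xi_def by (rule subspace_diff[OF subspace_Hcurl])
  qed
qed

lemma Xi_in_Q: "v \<in> W \<Longrightarrow> \<psi> \<in> G \<Longrightarrow> Xi \<Omega> v \<psi> \<in> Q"
  unfolding Q_eq by (rule image_eqI[of _ _ "(v, \<psi>)"]) simp_all

lemma grad_in_Q: "v \<in> W \<Longrightarrow> grad \<Omega> v \<in> Q"
  using Xi_in_Q[of v 0] subspace_0[OF subspaces(2)] by (simp add: Xi_def)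

lemma linear_b: "r \<in> L2 \<Omega> \<Longrightarrow> (\<lambda>\<eta>. b \<eta> r \<kappa>) \<in> linear_functionals (Hcurl \<Omega>)"
  by (rule b_tilde_linear[OF open_\<Omega> _ \<rho>])

text \<open>The place where the vanishing tangential pairings of gradients enter. The form
  \<open>b\<close> becomes blind to gradients of all of \<open>W\<close>, not merely of
  \<open>V\<close>, as the orthogonality of \<open>\<zeta>\<close> requires.\<close>

lemma b_grad: "v \<in> W \<Longrightarrow> b (grad \<Omega> v) r \<kappa> = 0"
  by (simp add: b_tilde_def curl_grad_W pairing_grad)

lemma b_grad_V: "\<gamma> \<in> grad \<Omega> ` V \<Longrightarrow> b \<gamma> r \<kappa> = 0"
  using b_grad V_W by auto

text \<open>Curl-free fields see only \<open>\<kappa>\<close>: by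
  \<open>curl_free_surjective\<close> one of them has the differences of the two vectors as its
  pairings, and the resulting sum of squares is 0. With equal vectors, a field whose curl is
  \<open>r - r'\<close> produces the squared norm of \<open>r - r'\<close>.\<close>

lemma multiplier_unique:
  assumes r: "r \<in> curl \<Omega> ` G" "r' \<in> curl \<Omega> ` G" and \<kappa>: "\<kappa> \<in> vecs N" "\<kappa>' \<in> vecs N"
    and eq: "\<And>\<psi>. \<psi> \<in> G \<Longrightarrow> b \<psi> r \<kappa> = b \<psi> r' \<kappa>'"
  shows "r = r' \<and> \<kappa> = \<kappa>'"
proof
  obtain \<psi> where \<psi>: "\<psi> \<in> G" "curl \<Omega> \<psi> = 0" "\<forall>i\<in>{1..N - 1}. \<tau> \<psi> i = (\<lambda>i\<in>{1..N - 1}. \<kappa> i - \<kappa>' i) i"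
    using curl_free_surjective[OF restrict_in_vecs] by blast
  have "(\<Sum>i = 1..N - 1. (\<kappa> i - \<kappa>' i)\<^sup>2) = b \<psi> r \<kappa> - b \<psi> r' \<kappa>'"
    using \<psi>(2,3) by (simp add: b_tilde_def power2_eq_square left_diff_distrib sum_subtractf)
  then have "(\<Sum>i = 1..N - 1. (\<kappa> i - \<kappa>' i)\<^sup>2) = 0" using eq[OF \<psi>(1)] by simp
  then have "\<forall>i\<in>{1..N - 1}. (\<kappa> i - \<kappa>' i)\<^sup>2 = 0"
    by (subst (asm) sum_nonneg_eq_0_iff) auto
  \<comment> \<open>Equality as functions, beyond the index range, comes from extensionality in
    \<open>vecs N\<close>.\<close>
  then show eq\<kappa>: "\<kappa> = \<kappa>'"
    using \<kappa> unfolding vecs_def by (intro PiE_ext) auto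
  have "r - r' \<in> curl \<Omega> ` G"
    using r fin_dim_curl_G by (intro subspace_diff subspace_if_fin_dim)
  then obtain \<phi> where \<phi>: "\<phi> \<in> G" "r - r' = curl \<Omega> \<phi>" by auto
  have L: "r \<in> L2 \<Omega>" "r' \<in> L2 \<Omega>" "r - r' \<in> L2 \<Omega>"
    using curl_G_L2 r \<open>r - r' \<in> curl \<Omega> ` G\<close> by auto
  have "ip r (r - r') = ip r' (r - r')"
    using eq[OF \<phi>(1)] by (simp add: b_tilde_def eq\<kappa> \<phi>(2))
  then have "ip (r - r') (r - r') = 0" using ip_diff_left_L2[OF L(1,2,3)] by simp
  then show "r = r'" using ip_self_eq_0D[OF L(3)] by simp
qed

lemma multiplier_exists:
  assumes L: "L \<in> linear_functionals G" and L0: "\<And>v. v \<in> V \<Longrightarrow> L (grad \<Omega> v) = 0"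
  shows "\<exists>r\<in>curl \<Omega> ` G. \<exists>\<kappa>\<in>vecs N. \<forall>\<psi>\<in>G. b \<psi> r \<kappa> = L \<psi>"
proof -
  \<comment> \<open>Curl-free fields dual to the pairings; they force the \<open>i\<close>-th
    multiplier to be the value of \<open>L\<close> on \<open>e i\<close>.\<close>
  have "\<exists>e. e \<in> G \<and> curl \<Omega> e = 0 \<and> (\<forall>j\<in>{1..N - 1}. \<tau> e j = (if j = i then 1 else 0))" for i
  proof -
    obtain \<psi> where "\<psi> \<in> G" "curl \<Omega> \<psi> = 0"
      "\<forall>j\<in>{1..N - 1}. \<tau> \<psi> j = (\<lambda>j\<in>{1..N - 1}. if j = i then 1 else 0) j"
      using curl_free_surjective[OF restrict_in_vecs] by blast
    then show ?thesis by (intro exI[of _ \<psi>]) simp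
  qed
  then obtain e where e: "\<And>i. e i \<in> G" "\<And>i. curl \<Omega> (e i) = 0"
    "\<And>i j. j \<in> {1..N - 1} \<Longrightarrow> \<tau> (e i) j = (if j = i then 1 else 0)" by metis
  define \<kappa> where "\<kappa> = (\<lambda>i\<in>{1..N - 1}. L (e i))"
  define L' where "L' \<psi> = L \<psi> - (\<Sum>i = 1..N - 1. \<kappa> i * \<tau> \<psi> i)" for \<psi>
  have L': "L' \<in> linear_functionals G"
    unfolding L'_def
    by (intro linear_functionals_diff L linear_functionals_sum linear_functionals_cmult linear_\<tau>)
  \<comment> \<open>Subtracting from a curl-free \<open>\<psi>\<close> its expansion
    \<open>\<xi>\<close> in the dual fields leaves zero curl and zero pairings, hence by
    \<open>grad_V\<close> the gradient of an element of \<open>V\<close>, on which \<open>L\<close>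
    vanishes.\<close>
  have L'0: "L' \<psi> = 0" if \<psi>: "\<psi> \<in> G" "curl \<Omega> \<psi> = 0" for \<psi>
  proof -
    define \<xi> where "\<xi> = (\<Sum>i = 1..N - 1. \<tau> \<psi> i *\<^sub>R e i)"
    have \<xi>G: "\<xi> \<in> G" unfolding \<xi>_def using e(1) by (intro subspace_sum subspace_scale subspaces)
    have "curl \<Omega> \<xi> = 0 \<and> \<xi> \<in> Hcurl \<Omega>"
    proof -
      have "(\<Sum>i\<in>I. \<tau> \<psi> i *\<^sub>R e i) \<in> Hcurl \<Omega> \<and> curl \<Omega> (\<Sum>i\<in>I. \<tau> \<psi> i *\<^sub>R e i) = 0" for I :: "nat set"
      proof (induction I rule: infinite_finite_induct)
        case (insert i I)
        have eH: "e i \<in> Hcurl \<Omega>" "\<tau> \<psi> i *\<^sub>R e i \<in> Hcurl \<Omega>"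
          using subsetD[OF G_Hcurl e(1)] subspace_scale[OF subspace_Hcurl] by blast+
        then show ?case
          using insert by (simp add: subspace_add[OF subspace_Hcurl] curl_add[OF open_\<Omega>] curl_scaleR[OF open_\<Omega>] e(2))
      \<comment> \<open>That the curl of 0 is 0 is read off from \<open>curl_grad\<close>, the zero
        field being the gradient of 0.\<close>
      qed (use subspace_0[OF subspace_Hcurl] curl_grad[OF open_\<Omega> subspace_0[OF subspace_H1[OF open_\<Omega>]]]
          in \<open>simp_all add: grad_zero[OF open_\<Omega>]\<close>)
      then show ?thesis unfolding \<xi>_def by blast
    qed
    then have "curl \<Omega> (\<psi> - \<xi>) = 0"
      using \<psi> G_Hcurl by (subst curl_diff[OF open_\<Omega>]) auto
    moreover have "\<tau> (\<psi> - \<xi>) j = 0" if j: "j \<in> {1..N - 1}" for j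
    proof -
      have "\<tau> \<xi> j = (\<Sum>i = 1..N - 1. \<tau> \<psi> i * \<tau> (e i) j)"
        unfolding \<xi>_def by (rule linear_functional_sum[OF linear_\<tau>[OF j] subspaces(2) e(1)])
      also have "\<dots> = (\<Sum>i = 1..N - 1. if j = i then \<tau> \<psi> i else 0)"
        by (rule sum.cong) (auto simp: e(3)[OF j])
      also have "\<dots> = \<tau> \<psi> j" using j by (subst sum.delta') auto
      finally show ?thesis using linear_functional_diff[OF linear_\<tau>[OF j] subspaces(2) \<psi>(1) \<xi>G] by simp
    qed
    moreover have "\<psi> - \<xi> \<in> G" by (intro subspace_diff subspaces \<psi> \<xi>G)
    ultimately have "\<psi> - \<xi> \<in> grad \<Omega> ` V" unfolding grad_V by blast
    then have "L (\<psi> - \<xi>) = 0" using L0 by auto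
    then have "L \<psi> = L \<xi>" using linear_functional_diff[OF L subspaces(2) \<psi>(1) \<xi>G] by simp
    also have "\<dots> = (\<Sum>i = 1..N - 1. \<tau> \<psi> i * L (e i))"
      unfolding \<xi>_def by (rule linear_functional_sum[OF L subspaces(2) e(1)])
    also have "\<dots> = (\<Sum>i = 1..N - 1. \<kappa> i * \<tau> \<psi> i)"
      by (rule sum.cong) (auto simp: \<kappa>_def)
    finally show ?thesis by (simp add: L'_def)
  qed
  \<comment> \<open>\<open>L'\<close> descends to curls: the choice is immaterial because two fields
    with the same curl differ by a curl-free one. Representing \<open>\<Phi>\<close> by the inner
    product on the space of curls yields \<open>r\<close>.\<close>
  define \<Phi> where "\<Phi> c = L' (SOME \<psi>. \<psi> \<in> G \<and> curl \<Omega> \<psi> = c)" for c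
  have \<Phi>: "\<Phi> (curl \<Omega> \<psi>) = L' \<psi>" if \<psi>: "\<psi> \<in> G" for \<psi>
  proof -
    let ?\<phi> = "SOME \<phi>. \<phi> \<in> G \<and> curl \<Omega> \<phi> = curl \<Omega> \<psi>"
    have \<phi>: "?\<phi> \<in> G \<and> curl \<Omega> ?\<phi> = curl \<Omega> \<psi>"
      by (rule someI[of "\<lambda>\<phi>. \<phi> \<in> G \<and> curl \<Omega> \<phi> = curl \<Omega> \<psi>" \<psi>]) (simp add: \<psi>)
    have "curl \<Omega> (?\<phi> - \<psi>) = 0"
      using \<phi> \<psi> G_Hcurl by (subst curl_diff[OF open_\<Omega>]) auto
    then have "L' (?\<phi> - \<psi>) = 0"
      using \<phi> \<psi> by (intro L'0 subspace_diff subspaces) auto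
    then show ?thesis
      using linear_functional_diff[OF L' subspaces(2), of ?\<phi> \<psi>] \<phi> \<psi> by (simp add: \<Phi>_def)
  qed
  have \<Phi>_linear: "\<Phi> \<in> linear_functionals (curl \<Omega> ` G)"
    unfolding linear_functionals_def
  proof (intro CollectI conjI ballI allI)
    fix c c' assume "c \<in> curl \<Omega> ` G" "c' \<in> curl \<Omega> ` G"
    then obtain \<psi> \<psi>' where \<psi>: "\<psi> \<in> G" "\<psi>' \<in> G" "c = curl \<Omega> \<psi>" "c' = curl \<Omega> \<psi>'" by auto
    then have "c + c' = curl \<Omega> (\<psi> + \<psi>')" using G_Hcurl by (subst curl_add[OF open_\<Omega>]) auto
    then show "\<Phi> (c + c') = \<Phi> c + \<Phi> c'"
      using \<psi> subspace_add[OF subspaces(2)] linear_functionalsD(1)[OF L'] by (simp add: \<Phi>)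
  next
    fix k c assume "c \<in> curl \<Omega> ` G"
    then obtain \<psi> where \<psi>: "\<psi> \<in> G" "c = curl \<Omega> \<psi>" by auto
    then have "k *\<^sub>R c = curl \<Omega> (k *\<^sub>R \<psi>)" using G_Hcurl by (subst curl_scaleR[OF open_\<Omega>]) auto
    then show "\<Phi> (k *\<^sub>R c) = k * \<Phi> c"
      using \<psi> subspace_scale[OF subspaces(2)] linear_functionalsD(2)[OF L'] by (simp add: \<Phi>)
  qed
  have ip_bilinear: "bilinear_form_on (curl \<Omega> ` G) ip"
    unfolding bilinear_form_on_def linear_functionals_def
    by (auto simp: ip_scaleR_left ip_scaleR_right
        intro!: ip_add_left_L2 ip_add_right_L2 curl_G_L2)
  have "u = 0" if "u \<in> curl \<Omega> ` G" "\<And>v. v \<in> curl \<Omega> ` G \<Longrightarrow> ip u v = 0" for u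
    using that ip_self_eq_0D[OF curl_G_L2[OF that(1)]] by blast
  from nondegenerate_form_solvable[OF fin_dim_curl_G ip_bilinear this \<Phi>_linear]
  have "\<exists>!r. r \<in> curl \<Omega> ` G \<and> (\<forall>c\<in>curl \<Omega> ` G. ip r c = \<Phi> c)" by blast
  then obtain r where r: "r \<in> curl \<Omega> ` G" "\<And>c. c \<in> curl \<Omega> ` G \<Longrightarrow> ip r c = \<Phi> c" by blast
  have "b \<psi> r \<kappa> = L \<psi>" if "\<psi> \<in> G" for \<psi>
    using r(2)[of "curl \<Omega> \<psi>"] \<Phi>[OF that] that by (simp add: b_tilde_def L'_def)
  moreover have "\<kappa> \<in> vecs N" unfolding \<kappa>_def by (rule restrict_in_vecs)
  ultimately show ?thesis using r(1) by blast
qed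

text \<open>The test pair \<open>(curl \<Omega> \<gamma>, 0)\<close> produces the squared norm of
  the curl. Once that vanishes, unit vectors isolate the pairings, and \<open>grad_V\<close>
  recognises a gradient.\<close>

lemma eq_iii_iff: "\<gamma> \<in> G \<Longrightarrow> eq_iii \<Omega> N \<rho> G \<gamma> \<longleftrightarrow> \<gamma> \<in> grad \<Omega> ` V"
proof
  assume \<gamma>: "\<gamma> \<in> G" and iii: "eq_iii \<Omega> N \<rho> G \<gamma>"
  have "b \<gamma> (curl \<Omega> \<gamma>) (\<lambda>i\<in>{1..N - 1}. 0) = 0"
    using iii \<gamma> restrict_in_vecs[of "\<lambda>_. 0"] unfolding eq_iii_def by blast
  then have c: "curl \<Omega> \<gamma> = 0"
    using ip_self_eq_0D[OF curl_G_L2[of "curl \<Omega> \<gamma>"]] \<gamma> by (simp add: b_tilde_def)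
  have "\<tau> \<gamma> j = 0" if j: "j \<in> {1..N - 1}" for j
  proof -
    have "b \<gamma> (curl \<Omega> \<gamma>) (\<lambda>i\<in>{1..N - 1}. if j = i then 1 else 0) = 0"
      using iii \<gamma> restrict_in_vecs[of "\<lambda>i. if j = i then 1 else 0" N] unfolding eq_iii_def by blast
    then have "(\<Sum>i = 1..N - 1. if j = i then \<tau> \<gamma> i else 0) = 0"
      by (simp add: b_tilde_def c if_distrib[of "\<lambda>x. x * _"] cong: if_cong)
    then show ?thesis using j by (simp add: sum.delta')
  qed
  then show "\<gamma> \<in> grad \<Omega> ` V" using \<gamma> c unfolding grad_V by blast
next
  assume "\<gamma> \<in> grad \<Omega> ` V"
  then show "eq_iii \<Omega> N \<rho> G \<gamma>" by (simp add: eq_iii_def b_grad_V)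
qed

lemma a_linear: "\<theta> \<in> H1 \<Omega> \<times> H1 \<Omega> \<Longrightarrow> a \<theta> \<in> linear_functionals (H1 \<Omega> \<times> H1 \<Omega>)"
  "\<theta> \<in> H1 \<Omega> \<times> H1 \<Omega> \<Longrightarrow> (\<lambda>\<eta>. a \<eta> \<theta>) \<in> linear_functionals (H1 \<Omega> \<times> H1 \<Omega>)"
  using bilinear_a by (auto simp: bilinear_form_on_def)

lemma V_problem:
  assumes "L \<in> linear_functionals G"
  shows "\<exists>!w. w \<in> V \<and> (\<forall>v\<in>V. a (grad \<Omega> w) (grad \<Omega> v) = L (grad \<Omega> v))"
proof (rule nondegenerate_form_solvable[OF fin_dim_V _ nondegenerate])
  have V: "V \<subseteq> H1 \<Omega>" "grad \<Omega> ` V \<subseteq> G" "grad \<Omega> ` V \<subseteq> H1 \<Omega> \<times> H1 \<Omega>"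
    using V_W W_H1 grad_V_G G(2) by blast+
  show "bilinear_form_on V (\<lambda>u v. a (grad \<Omega> u) (grad \<Omega> v))"
    unfolding bilinear_form_on_def
    using V(3) by (auto intro!: linear_functional_compose_grad[OF open_\<Omega> V(1,3)] a_linear)
  show "(\<lambda>v. L (grad \<Omega> v)) \<in> linear_functionals V"
    by (rule linear_functional_compose_grad[OF open_\<Omega> V(1,2) assms])
qed

lemma W_problem:
  assumes "F \<in> linear_functionals W"
  shows "\<exists>!w. w \<in> W \<and> (\<forall>v\<in>W. ip_vec (grad \<Omega> w) (grad \<Omega> v) = F v)"
proof (rule nondegenerate_form_solvable[OF W(1) _ _ assms])
  have g: "grad \<Omega> ` W \<subseteq> L2 \<Omega> \<times> L2 \<Omega>" using grad_L2 by blast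
  show "bilinear_form_on W (\<lambda>u v. ip_vec (grad \<Omega> u) (grad \<Omega> v))"
    unfolding bilinear_form_on_def
    using g by (auto intro!: linear_functional_compose_grad[OF open_\<Omega> W(2) g] ip_vec_linear)
  show "u = 0" if "u \<in> W" "\<And>v. v \<in> W \<Longrightarrow> ip_vec (grad \<Omega> u) (grad \<Omega> v) = 0" for u
    using grad_injective[OF that(1)] ip_vec_self_eq_0D[OF grad_L2[OF that(1)] that(2)[OF that(1)]] by simp
qed

lemma load_linear:
  assumes "z \<in> W" "F1 \<in> linear_functionals G"
  shows "(\<lambda>\<psi>. ip_vec (grad \<Omega> z) \<psi> + F1 \<psi>) \<in> linear_functionals G"
proof -
  have "G \<subseteq> L2 \<Omega> \<times> L2 \<Omega>" using G_L2 by blast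
  from linear_functionals_mono[OF ip_vec_linear(1)[OF grad_L2[OF assms(1)]] this]
  show ?thesis by (rule linear_functionals_add[OF _ assms(2)])
qed

lemma multiplier_problem:
  assumes z: "z \<in> W" and F1: "F1 \<in> linear_functionals G" and w: "w \<in> V"
    and eq: "\<And>v. v \<in> V \<Longrightarrow> a (grad \<Omega> w) (grad \<Omega> v) = ip_vec (grad \<Omega> z) (grad \<Omega> v) + F1 (grad \<Omega> v)"
  shows "\<exists>!r\<kappa>. case r\<kappa> of (r, \<kappa>) \<Rightarrow> r \<in> curl \<Omega> ` G \<and> \<kappa> \<in> vecs N \<and>
    eq_ii \<Omega> N \<rho> a G F1 z (grad \<Omega> w) r \<kappa> \<and> eq_iii \<Omega> N \<rho> G (grad \<Omega> w)"
proof -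
  let ?\<gamma> = "grad \<Omega> w"
  let ?L = "\<lambda>\<psi>. ip_vec (grad \<Omega> z) \<psi> + F1 \<psi> - a ?\<gamma> \<psi>"
  have \<gamma>: "?\<gamma> \<in> G" using w by (rule grad_V_G)
  have "?L \<in> linear_functionals G"
    by (intro linear_functionals_diff load_linear z F1 linear_functionals_mono[OF a_linear(1) G(2)] G_H1 \<gamma>)
  then obtain r \<kappa> where r: "r \<in> curl \<Omega> ` G" "\<kappa> \<in> vecs N" "\<And>\<psi>. \<psi> \<in> G \<Longrightarrow> b \<psi> r \<kappa> = ?L \<psi>"
    using multiplier_exists[of ?L] eq by auto
  have iii: "eq_iii \<Omega> N \<rho> G ?\<gamma>" using eq_iii_iff[OF \<gamma>] w by blast
  \<comment> \<open>The pair \<open>(r, \<kappa>)\<close> already found turns (ii) for any other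
    pair into equality of two values of \<open>b\<close> on all of \<open>G\<close>, the situation
    of \<open>multiplier_unique\<close>.\<close>
  have ii: "eq_ii \<Omega> N \<rho> a G F1 z ?\<gamma> r' \<kappa>' \<longleftrightarrow> (\<forall>\<psi>\<in>G. b \<psi> r' \<kappa>' = b \<psi> r \<kappa>)" for r' \<kappa>'
  proof -
    have "a ?\<gamma> \<psi> + b \<psi> r' \<kappa>' = ip_vec (grad \<Omega> z) \<psi> + F1 \<psi> \<longleftrightarrow> b \<psi> r' \<kappa>' = b \<psi> r \<kappa>" if "\<psi> \<in> G" for \<psi>
      unfolding r(3)[OF that] by linarith
    then show ?thesis unfolding eq_ii_def by blast
  qed
  show ?thesis
  proof (rule ex1I[of _ "(r, \<kappa>)"])
    show "case (r, \<kappa>) of (r, \<kappa>) \<Rightarrow> r \<in> curl \<Omega> ` G \<and> \<kappa> \<in> vecs N \<and>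
      eq_ii \<Omega> N \<rho> a G F1 z ?\<gamma> r \<kappa> \<and> eq_iii \<Omega> N \<rho> G ?\<gamma>"
      using r iii ii by simp
    fix r\<kappa> assume "case r\<kappa> of (r, \<kappa>) \<Rightarrow> r \<in> curl \<Omega> ` G \<and> \<kappa> \<in> vecs N \<and>
      eq_ii \<Omega> N \<rho> a G F1 z ?\<gamma> r \<kappa> \<and> eq_iii \<Omega> N \<rho> G ?\<gamma>"
    then obtain r' \<kappa>' where r': "r\<kappa> = (r', \<kappa>')" "r' \<in> curl \<Omega> ` G" "\<kappa>' \<in> vecs N"
      "\<forall>\<psi>\<in>G. b \<psi> r' \<kappa>' = b \<psi> r \<kappa>"
      using ii by (cases r\<kappa>) auto
    then show "r\<kappa> = (r, \<kappa>)" using multiplier_unique[OF r'(2) r(1) r'(3) r(2)] by simp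
  qed
qed

section \<open>Solutions of the mixed problem\<close>

lemma Xi_eq_0_if_orthogonal:
  assumes "w \<in> W" "\<gamma> \<in> G" "\<forall>\<eta>\<in>Q. ip_curl \<Omega> (Xi \<Omega> w \<gamma>) \<eta> = 0"
  shows "\<gamma> = grad \<Omega> w \<and> w \<in> V"
proof -
  have Q: "Xi \<Omega> w \<gamma> \<in> Q" by (rule Xi_in_Q[OF assms(1,2)])
  then have "Xi \<Omega> w \<gamma> = 0" using assms(3) Q_Hcurl by (intro ip_curl_self_eq_0D[of _ \<Omega>]) auto
  then have "\<gamma> = grad \<Omega> w" by (simp add: Xi_def)
  then show ?thesis using assms(1,2) by (simp add: V_eq)
qed

lemma mixed_solution_test_gradient:
  assumes "mixed_solution \<Omega> a W G Q F1 F2 (w, \<gamma>, q)" "v \<in> V"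
  shows "a \<gamma> (grad \<Omega> v) = F1 (grad \<Omega> v) + F2 v"
proof -
  have "a \<gamma> (grad \<Omega> v) + ip_curl \<Omega> (Xi \<Omega> v (grad \<Omega> v)) q = F1 (grad \<Omega> v) + F2 v"
    using assms V_W grad_V_G unfolding mixed_solution_def by blast
  moreover have "q \<in> Hcurl \<Omega>" using assms(1) Q_Hcurl unfolding mixed_solution_def by blast
  then have "(\<lambda>\<eta>. ip_curl \<Omega> \<eta> q) \<in> linear_functionals (Hcurl \<Omega>)"
    using bilinear_ip_curl[OF open_\<Omega>] by (simp add: bilinear_form_on_def)
  from linear_functional_0[OF this subspace_Hcurl] have "ip_curl \<Omega> (Xi \<Omega> v (grad \<Omega> v)) q = 0"
    by (simp add: Xi_def)
  ultimately show ?thesis by simp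
qed

lemma mixed_solution_decouples:
  assumes F1: "F1 \<in> linear_functionals G" and mixed: "mixed_solution \<Omega> a W G Q F1 F2 (w, \<gamma>, q)"
    and z: "z \<in> W" "eq_i \<Omega> W F2 z"
  shows "(\<exists>!r\<kappa>. case r\<kappa> of (r, \<kappa>) \<Rightarrow> r \<in> curl \<Omega> ` G \<and> \<kappa> \<in> vecs N \<and>
    eq_ii \<Omega> N \<rho> a G F1 z \<gamma> r \<kappa> \<and> eq_iii \<Omega> N \<rho> G \<gamma>) \<and> eq_iv \<Omega> W \<gamma> w"
proof -
  have \<gamma>: "\<gamma> = grad \<Omega> w" "w \<in> V"
    using Xi_eq_0_if_orthogonal[of w \<gamma>] mixed unfolding mixed_solution_def by auto
  have "a (grad \<Omega> w) (grad \<Omega> v) = ip_vec (grad \<Omega> z) (grad \<Omega> v) + F1 (grad \<Omega> v)" if "v \<in> V" for v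
    using mixed_solution_test_gradient[OF mixed that] z(2) V_W[OF that] by (simp add: \<gamma>(1) eq_i_def)
  from multiplier_problem[OF z(1) F1 \<gamma>(2) this] show ?thesis
    by (simp add: \<gamma>(1) eq_iv_def)
qed

text \<open>\<open>w' - w\<close> solves the homogeneous problem on \<open>V\<close> and falls to
  \<open>nondegenerate\<close>. As \<open>q' - q\<close> lies in \<open>Q\<close>, it is itself some
  \<open>Xi \<Omega> v \<psi>\<close>, and the first equation with this test pair gives it squared
  norm 0.\<close>

lemma mixed_solution_unique:
  assumes s: "mixed_solution \<Omega> a W G Q F1 F2 (w, \<gamma>, q)" and s': "mixed_solution \<Omega> a W G Q F1 F2 (w', \<gamma>', q')"
  shows "(w', \<gamma>', q') = (w, \<gamma>, q)"
proof -
  have \<gamma>: "\<gamma> = grad \<Omega> w" "w \<in> V" and \<gamma>': "\<gamma>' = grad \<Omega> w'" "w' \<in> V"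
    using Xi_eq_0_if_orthogonal[of w \<gamma>] Xi_eq_0_if_orthogonal[of w' \<gamma>'] s s'
    unfolding mixed_solution_def by auto
  have H: "\<gamma> \<in> H1 \<Omega> \<times> H1 \<Omega>" "\<gamma>' \<in> H1 \<Omega> \<times> H1 \<Omega>"
    using \<gamma> \<gamma>' grad_V_G G_H1 by auto
  have "w' - w = 0"
  proof (rule nondegenerate)
    show "w' - w \<in> V" using \<gamma>(2) \<gamma>'(2) by (intro subspace_diff subspace_if_fin_dim fin_dim_V)
    fix v assume v: "v \<in> V"
    have "grad \<Omega> (w' - w) = \<gamma>' - \<gamma>"
      using \<gamma> \<gamma>' V_W W_H1 by (simp add: grad_diff[OF open_\<Omega>])
    moreover have "a (\<gamma>' - \<gamma>) (grad \<Omega> v) = a \<gamma>' (grad \<Omega> v) - a \<gamma> (grad \<Omega> v)"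
      by (rule linear_functional_diff[OF a_linear(2)[OF G_H1[OF grad_V_G[OF v]]] _ H(2,1)])
        (intro subspace_Times subspace_H1 open_\<Omega>)
    ultimately show "a (grad \<Omega> (w' - w)) (grad \<Omega> v) = 0"
      using mixed_solution_test_gradient[OF s v] mixed_solution_test_gradient[OF s' v] by simp
  qed
  then have w: "w' = w" "\<gamma>' = \<gamma>" using \<gamma>(1) \<gamma>'(1) by auto
  have q: "q \<in> Q" "q' \<in> Q" using s s' by (auto simp: mixed_solution_def)
  then have qH: "q \<in> Hcurl \<Omega>" "q' \<in> Hcurl \<Omega>" using Q_Hcurl by auto
  have "q' - q = 0"
  proof (rule ip_curl_self_eq_0D)
    show "q' - q \<in> Hcurl \<Omega>" using qH by (intro subspace_diff subspace_Hcurl)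
    have "q' - q \<in> Q" using q by (intro subspace_diff subspace_if_fin_dim fin_dim_Q)
    then obtain v \<psi> where v: "v \<in> W" "\<psi> \<in> G" "q' - q = Xi \<Omega> v \<psi>" 
      unfolding Q_eq by (elim imageE SigmaE) (rule that, assumption, assumption, simp)
    have "ip_curl \<Omega> (Xi \<Omega> v \<psi>) q' = ip_curl \<Omega> (Xi \<Omega> v \<psi>) q"
      using s s' v(1,2) unfolding mixed_solution_def w by fastforce
    moreover have "ip_curl \<Omega> (Xi \<Omega> v \<psi>) \<in> linear_functionals (Hcurl \<Omega>)"
      using bilinear_ip_curl[OF open_\<Omega>] Xi_in_Q[OF v(1,2)] Q_Hcurl by (auto simp: bilinear_form_on_def)
    from linear_functional_diff[OF this subspace_Hcurl qH(2,1)]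
    have "ip_curl \<Omega> (Xi \<Omega> v \<psi>) (q' - q) = ip_curl \<Omega> (Xi \<Omega> v \<psi>) q' - ip_curl \<Omega> (Xi \<Omega> v \<psi>) q" .
    ultimately show "ip_curl \<Omega> (q' - q) (q' - q) = 0" by (simp add: v(3))
  qed
  then show ?thesis using w by simp
qed

text \<open>(iii) gives \<open>\<gamma> = grad \<Omega> w0\<close> with \<open>w0 \<in> V\<close>;
  then (iv) is a gradient problem on \<open>W\<close> solved by both \<open>w\<close> and
  \<open>w0\<close>, so they agree. Thus (iii) and (iv) are traded for membership in
  \<open>V\<close>.\<close>

lemma decoupled_solution_iff:
  assumes "F1 \<in> linear_functionals G"
  shows "decoupled_solution \<Omega> N \<rho> a W G F1 F2 (z, \<gamma>, r, \<kappa>, w) \<longleftrightarrow>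
    z \<in> W \<and> eq_i \<Omega> W F2 z \<and> w \<in> V \<and> \<gamma> = grad \<Omega> w \<and>
    r \<in> curl \<Omega> ` G \<and> \<kappa> \<in> vecs N \<and> eq_ii \<Omega> N \<rho> a G F1 z \<gamma> r \<kappa>" (is "?l \<longleftrightarrow> ?r")
proof
  assume l: ?l
  then have \<gamma>: "\<gamma> \<in> G" "w \<in> W" "eq_iv \<Omega> W \<gamma> w" "eq_iii \<Omega> N \<rho> G \<gamma>"
    by (auto simp: decoupled_solution_def)
  from \<gamma>(4) obtain w0 where w0: "w0 \<in> V" "\<gamma> = grad \<Omega> w0"
    using eq_iii_iff[OF \<gamma>(1)] by blast
  let ?F = "\<lambda>u. ip_vec \<gamma> (grad \<Omega> u)"
  have g: "grad \<Omega> ` W \<subseteq> L2 \<Omega> \<times> L2 \<Omega>" using grad_L2 by blast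
  have "?F \<in> linear_functionals W"
    by (rule linear_functional_compose_grad[OF open_\<Omega> W(2) g ip_vec_linear(1)[OF G_L2[OF \<gamma>(1)]]])
  from W_problem[OF this] have "w = w0"
    using \<gamma>(2,3) w0 V_W unfolding eq_iv_def by blast
  then show ?r using l w0 by (auto simp: decoupled_solution_def)
next
  assume r: ?r
  then have "\<gamma> \<in> G" "w \<in> W" using grad_V_G V_W by auto
  then show ?l using r eq_iii_iff by (auto simp: decoupled_solution_def eq_iv_def)
qed

lemma decoupled_solution_gradient:
  assumes "F1 \<in> linear_functionals G" "decoupled_solution \<Omega> N \<rho> a W G F1 F2 (z, \<gamma>, r, \<kappa>, w)" "v \<in> V"
  shows "a (grad \<Omega> w) (grad \<Omega> v) = ip_vec (grad \<Omega> z) (grad \<Omega> v) + F1 (grad \<Omega> v)"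
proof -
  have "eq_ii \<Omega> N \<rho> a G F1 z (grad \<Omega> w) r \<kappa>"
    using assms(2) unfolding decoupled_solution_iff[OF assms(1)] by blast
  then have "a (grad \<Omega> w) (grad \<Omega> v) + b (grad \<Omega> v) r \<kappa> = ip_vec (grad \<Omega> z) (grad \<Omega> v) + F1 (grad \<Omega> v)"
    using grad_V_G[OF assms(3)] unfolding eq_ii_def by blast
  then show ?thesis by (simp add: b_grad[OF V_W[OF assms(3)]])
qed

text \<open>The system is triangular: (i) determines \<open>z\<close>, then (ii) tested with
  gradients determines \<open>w\<close> because \<open>b\<close> vanishes there, and the residual of
  (ii) determines the multipliers. Uniqueness follows the same order.\<close>

lemma decoupled_solution_ex1:
  assumes F1: "F1 \<in> linear_functionals G" and F2: "F2 \<in> linear_functionals W"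
  shows "\<exists>!s. decoupled_solution \<Omega> N \<rho> a W G F1 F2 s"
proof -
  note iff = decoupled_solution_iff[OF F1]
  obtain z where z: "z \<in> W" "eq_i \<Omega> W F2 z" "\<And>z'. z' \<in> W \<Longrightarrow> eq_i \<Omega> W F2 z' \<Longrightarrow> z' = z"
    using W_problem[OF F2] unfolding eq_i_def by blast
  let ?L = "\<lambda>\<psi>. ip_vec (grad \<Omega> z) \<psi> + F1 \<psi>"
  obtain w where w: "w \<in> V" "\<And>v. v \<in> V \<Longrightarrow> a (grad \<Omega> w) (grad \<Omega> v) = ?L (grad \<Omega> v)"
    "\<And>w'. w' \<in> V \<Longrightarrow> (\<And>v. v \<in> V \<Longrightarrow> a (grad \<Omega> w') (grad \<Omega> v) = ?L (grad \<Omega> v)) \<Longrightarrow> w' = w"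
    using V_problem[OF load_linear[OF z(1) F1]] by blast
  have iii: "eq_iii \<Omega> N \<rho> G (grad \<Omega> w)" using eq_iii_iff grad_V_G w(1) by blast
  let ?P = "\<lambda>r\<kappa>. case r\<kappa> of (r, \<kappa>) \<Rightarrow> r \<in> curl \<Omega> ` G \<and> \<kappa> \<in> vecs N \<and>
    eq_ii \<Omega> N \<rho> a G F1 z (grad \<Omega> w) r \<kappa> \<and> eq_iii \<Omega> N \<rho> G (grad \<Omega> w)"
  have "\<exists>!r\<kappa>. ?P r\<kappa>" by (rule multiplier_problem[OF z(1) F1 w(1,2)])
  then obtain p where p_solves: "?P p" and p_unique: "\<forall>q. ?P q \<longrightarrow> q = p" by (rule ex1E)
  obtain r \<kappa> where p: "p = (r, \<kappa>)" by (cases p)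
  have r\<kappa>: "?P (r, \<kappa>)" using p_solves unfolding p .
  have r: "r \<in> curl \<Omega> ` G" "\<kappa> \<in> vecs N" "eq_ii \<Omega> N \<rho> a G F1 z (grad \<Omega> w) r \<kappa>"
    using r\<kappa> by simp_all
  have r_unique: "r' = r \<and> \<kappa>' = \<kappa>"
    if "r' \<in> curl \<Omega> ` G" "\<kappa>' \<in> vecs N" "eq_ii \<Omega> N \<rho> a G F1 z (grad \<Omega> w) r' \<kappa>'" for r' \<kappa>'
  proof -
    have "?P (r', \<kappa>')" using that iii by simp
    with p_unique have "(r', \<kappa>') = p" by blast
    then show ?thesis by (simp add: p)
  qed
  show ?thesis
  proof (rule ex1I[of _ "(z, grad \<Omega> w, r, \<kappa>, w)"])
    show "decoupled_solution \<Omega> N \<rho> a W G F1 F2 (z, grad \<Omega> w, r, \<kappa>, w)"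
      unfolding iff using z w r by blast
    fix s assume s: "decoupled_solution \<Omega> N \<rho> a W G F1 F2 s"
    obtain z' \<gamma>' r' \<kappa>' w' where s_eq: "s = (z', \<gamma>', r', \<kappa>', w')" by (cases s) auto
    note s' = s[unfolded s_eq iff]
    have z': "z' = z" using s' z(3) by blast
    have w': "w' = w"
      using w(3)[of w'] s' decoupled_solution_gradient[OF F1 s[unfolded s_eq z']] by blast
    have "r' = r \<and> \<kappa>' = \<kappa>" using s' r_unique[of r' \<kappa>'] unfolding z' w' by blast
    then show "s = (z, grad \<Omega> w, r, \<kappa>, w)" using s' by (simp add: s_eq z' w')
  qed
qed

text \<open>Representation is carried out in all of \<open>Q\<close>, from which uniqueness is
  inherited; the solution lands in \<open>grad_perp\<close> because gradients belong to
  \<open>Q\<close> and \<open>b\<close> vanishes on them.\<close>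

lemma multiplier_representative_ex1:
  assumes r: "r \<in> curl \<Omega> ` G"
  shows "\<exists>!\<zeta>. \<zeta> \<in> grad_perp \<Omega> W Q \<and> (\<forall>\<eta>\<in>Q. ip_curl \<Omega> \<zeta> \<eta> = - b \<eta> r \<kappa>)"
proof -
  have bl: "(\<lambda>\<eta>. - b \<eta> r \<kappa>) \<in> linear_functionals Q"
    using linear_functionals_cmult[OF linear_functionals_mono[OF linear_b[OF curl_G_L2[OF r]] Q_Hcurl], of "-1"]
    by simp
  have "\<exists>!\<zeta>. \<zeta> \<in> Q \<and> (\<forall>\<eta>\<in>Q. ip_curl \<Omega> \<zeta> \<eta> = - b \<eta> r \<kappa>)"
    using Q_Hcurl
    by (intro nondegenerate_form_solvable[OF fin_dim_Q bilinear_form_on_mono[OF bilinear_ip_curl[OF open_\<Omega>] Q_Hcurl] _ bl]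
       ip_curl_self_eq_0D[of _ \<Omega>]) auto
  moreover have "\<zeta> \<in> grad_perp \<Omega> W Q" if "\<zeta> \<in> Q" "\<forall>\<eta>\<in>Q. ip_curl \<Omega> \<zeta> \<eta> = - b \<eta> r \<kappa>" for \<zeta>
    using that grad_in_Q b_grad by (auto simp: grad_perp_def)
  moreover have "grad_perp \<Omega> W Q \<subseteq> Q" by (auto simp: grad_perp_def)
  ultimately show ?thesis by blast
qed

text \<open>Along \<open>Xi \<Omega> v \<psi> = grad \<Omega> v - \<psi>\<close> the field
  \<open>\<zeta>\<close> contributes \<open>b \<psi> r \<kappa>\<close>, while
  \<open>grad \<Omega> z\<close> contributes \<open>F2 v\<close> by (i) minus its product with
  \<open>\<psi>\<close>. Adding (ii) leaves \<open>F1 \<psi> + F2 v\<close>.\<close>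

lemma mixed_solution_from_decoupled:
  assumes F1: "F1 \<in> linear_functionals G"
    and s: "decoupled_solution \<Omega> N \<rho> a W G F1 F2 (z, \<gamma>, r, \<kappa>, w)"
    and \<zeta>: "\<zeta> \<in> grad_perp \<Omega> W Q" "\<forall>\<eta>\<in>Q. ip_curl \<Omega> \<zeta> \<eta> = - b \<eta> r \<kappa>"
  shows "mixed_solution \<Omega> a W G Q F1 F2 (w, \<gamma>, \<zeta> + grad \<Omega> z)"
proof -
  note s' = s[unfolded decoupled_solution_iff[OF F1]]
  have z: "z \<in> W" and w: "w \<in> V" and \<gamma>: "\<gamma> = grad \<Omega> w" using s' by auto
  have \<zeta>Q: "\<zeta> \<in> Q" using \<zeta>(1) by (simp add: grad_perp_def)
  have gz: "grad \<Omega> z \<in> Q" by (rule grad_in_Q[OF z])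
  have lin: "(\<lambda>\<eta>. ip_curl \<Omega> \<eta> q) \<in> linear_functionals (Hcurl \<Omega>)" "ip_curl \<Omega> q \<in> linear_functionals (Hcurl \<Omega>)"
    if "q \<in> Hcurl \<Omega>" for q
    using bilinear_ip_curl[OF open_\<Omega>] that by (auto simp: bilinear_form_on_def)
  have "a \<gamma> \<psi> + ip_curl \<Omega> (Xi \<Omega> v \<psi>) (\<zeta> + grad \<Omega> z) = F1 \<psi> + F2 v" if v: "v \<in> W" and \<psi>: "\<psi> \<in> G" for v \<psi>
  proof -
    have X: "Xi \<Omega> v \<psi> \<in> Q" by (rule Xi_in_Q[OF v \<psi>])
    have H: "\<psi> \<in> Hcurl \<Omega>" "grad \<Omega> v \<in> Hcurl \<Omega>" "\<zeta> \<in> Hcurl \<Omega>" "grad \<Omega> z \<in> Hcurl \<Omega>" "Xi \<Omega> v \<psi> \<in> Hcurl \<Omega>"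
      using G_Hcurl \<psi> grad_W_Hcurl v z \<zeta>Q Q_Hcurl X by auto
    have 1: "ip_curl \<Omega> (Xi \<Omega> v \<psi>) (\<zeta> + grad \<Omega> z) = ip_curl \<Omega> (Xi \<Omega> v \<psi>) \<zeta> + ip_curl \<Omega> (Xi \<Omega> v \<psi>) (grad \<Omega> z)"
      by (rule linear_functionalsD(1)[OF lin(2)[OF H(5)] H(3,4)])
    have 2: "ip_curl \<Omega> (Xi \<Omega> v \<psi>) \<zeta> = - b (Xi \<Omega> v \<psi>) r \<kappa>"
      using \<zeta>(2) X by (simp add: ip_curl_commute[of \<Omega> "Xi \<Omega> v \<psi>"])
    have "r \<in> L2 \<Omega>" using s' curl_G_L2 by blast
    from linear_functional_diff[OF linear_b[OF this] subspace_Hcurl H(2,1)]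
    have 3: "b (Xi \<Omega> v \<psi>) r \<kappa> = - b \<psi> r \<kappa>"
      using b_grad[OF v] by (simp add: Xi_def)
    have 4: "ip_curl \<Omega> (Xi \<Omega> v \<psi>) (grad \<Omega> z) = ip_vec (Xi \<Omega> v \<psi>) (grad \<Omega> z)"
      by (simp add: ip_curl_def curl_grad_W[OF z])
    have 5: "ip_vec (Xi \<Omega> v \<psi>) (grad \<Omega> z) = ip_vec (grad \<Omega> v) (grad \<Omega> z) - ip_vec \<psi> (grad \<Omega> z)"
      unfolding Xi_def
      by (rule linear_functional_diff[OF ip_vec_linear(2)[OF grad_L2[OF z]] subspace_Times[OF subspace_L2 subspace_L2]
          grad_L2[OF v] G_L2[OF \<psi>]])
    have 6: "ip_vec (grad \<Omega> z) (grad \<Omega> v) = F2 v" using s' v by (simp add: eq_i_def)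
    have 7: "a \<gamma> \<psi> + b \<psi> r \<kappa> = ip_vec (grad \<Omega> z) \<psi> + F1 \<psi>" using s' \<psi> unfolding eq_ii_def by blast
    show ?thesis
      using 1 2 3 4 5 6 7 ip_vec_commute[of "grad \<Omega> v" "grad \<Omega> z"] ip_vec_commute[of \<psi> "grad \<Omega> z"] by linarith
  qed
  moreover have "ip_curl \<Omega> (Xi \<Omega> w \<gamma>) \<eta> = 0" if "\<eta> \<in> Q" for \<eta>
  proof -
    have "\<eta> \<in> Hcurl \<Omega>" using Q_Hcurl that by blast
    from linear_functional_0[OF lin(1)[OF this] subspace_Hcurl] show ?thesis by (simp add: Xi_def \<gamma>)
  qed
  moreover have "\<zeta> + grad \<Omega> z \<in> Q" by (intro subspace_add subspace_if_fin_dim fin_dim_Q \<zeta>Q gz)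
  ultimately show ?thesis
    using V_W[OF w] grad_V_G[OF w] by (simp add: mixed_solution_def \<gamma>)
qed

end

text \<open>Gradients are curl-free, so the pairing is up to sign the integral of the Jacobian
  determinant of \<open>v\<close> and \<open>\<rho>\<close>. The cutoff prescribes 0 or 1 on all
  \<open>N\<close> components, including the one with index \<open>N\<close>, which does not occur
  in \<open>b_tilde\<close>; hence the alternative in \<open>ip_wderiv_cross_eq\<close> holds all
  along the boundary.\<close>

lemma tangential_pairing_grad_eq_0:
  assumes \<Omega>: "open \<Omega>" "bounded \<Omega>" "\<exists>E. is_edge_set (frontier \<Omega>) E"
    and v: "v \<in> H1_bc \<Omega> \<Gamma>c \<Gamma>s" and \<Gamma>: "\<Gamma>c \<union> \<Gamma>s \<union> \<Gamma>f = frontier \<Omega>"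
    and comp: "bij_betw \<Gamma>fi {1..N} (components \<Gamma>f)" and \<rho>: "component_cutoff \<Omega> N \<Gamma>fi i \<rho>"
  shows "tangential_pairing \<Omega> (grad \<Omega> v) \<rho> = 0"
proof -
  obtain g where g: "has_trace \<Omega> v g" "AE x in arc_measure (frontier \<Omega>). x \<in> \<Gamma>c \<union> \<Gamma>s \<longrightarrow> g x = 0"
    using v by (auto simp: H1_bc_def)
  obtain h where h: "has_trace \<Omega> \<rho> h" "AE x in arc_measure (frontier \<Omega>).
      (x \<in> \<Gamma>fi i \<longrightarrow> h x = 1) \<and> (\<forall>j\<in>{1..N} - {i}. x \<in> \<Gamma>fi j \<longrightarrow> h x = 0)"
    using \<rho> by (auto simp: component_cutoff_def)
  have cover: "\<Gamma>f = (\<Union>j\<in>{1..N}. \<Gamma>fi j)"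
    using comp Union_components[of \<Gamma>f] by (simp add: bij_betw_def)
  have "AE x in arc_measure (frontier \<Omega>). g x = 0 \<or> h x \<in> \<int>"
    using g(2) h(2) AE_arc_measure_in_boundary[OF \<Omega>(3) frontier_closed]
  proof eventually_elim
    case (elim x)
    show ?case
    proof (cases "x \<in> \<Gamma>c \<union> \<Gamma>s")
      case False
      then obtain j where "j \<in> {1..N}" "x \<in> \<Gamma>fi j" using elim(3) \<Gamma> cover by auto
      then have "h x = 0 \<or> h x = 1" using elim(2) by (cases "j = i") auto
      then show ?thesis by auto
    qed (use elim(1) in simp)
  qed
  then have "ip (wderiv \<Omega> 1 v) (wderiv \<Omega> 2 \<rho>) = ip (wderiv \<Omega> 2 v) (wderiv \<Omega> 1 \<rho>)"
    by (rule ip_wderiv_cross_eq[OF \<Omega> g(1) h(1)])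
  then show ?thesis
    using curl_grad[OF \<Omega>(1) has_trace_H1[OF g(1)]] by (simp add: tangential_pairing_def grad_def)
qed

text \<open>
  This replaces the Poincare inequality, which fails if the essential boundary is negligible. In that
  case the inf-sup condition is violated by the constant functions.
\<close>

lemma grad_eq_0D_if_inf_sup:
  assumes \<Omega>: "open \<Omega>" and a: "bilinear_form_on (H1 \<Omega> \<times> H1 \<Omega>) a"
    and B: "\<forall>w\<in>H2 \<Omega>. \<forall>v\<in>H2 \<Omega>. B w v = a (grad \<Omega> w) (grad \<Omega> v)"
    and inf_sup: "inf_sup (H2_bc \<Omega> \<Gamma>c \<Gamma>s) (norm_H2 \<Omega>) B > 0"
    and v: "v \<in> H1_bc \<Omega> \<Gamma>c \<Gamma>s" "grad \<Omega> v = 0"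
  shows "v = 0"
proof (rule ccontr)
  assume "v \<noteq> 0"
  let ?H = "H2_bc \<Omega> \<Gamma>c \<Gamma>s"
  \<comment> \<open>A zero gradient is weakly differentiable and has zero trace, so \<open>v\<close>
    belongs to the space on which the inf-sup condition is posed.\<close>
  have "wderiv \<Omega> i v = 0" for i
    using v(2) exhaust_2[of i] by (auto simp: grad_def zero_prod_def)
  then have H2: "v \<in> H2 \<Omega>"
    using v(1) subspace_0[OF subspace_H1[OF \<Omega>]] by (auto simp: H2_def H1_bc_def)
  have "has_trace_vec \<Omega> (grad \<Omega> v) (\<lambda>_. 0)" using has_trace_vec_zero[OF \<Omega>] v(2) by simp
  then have "v \<in> ?H"
    using H2 v(1) unfolding H2_bc_def H1_bc_def by (auto intro!: exI[of _ "\<lambda>_. 0"])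
  have "B v u = 0" if "u \<in> ?H" for u
  proof -
    have u: "u \<in> H2 \<Omega>" using that by (simp add: H2_bc_def)
    then have "grad \<Omega> u \<in> H1 \<Omega> \<times> H1 \<Omega>" by (simp add: H2_def grad_def)
    then have "(\<lambda>\<eta>. a \<eta> (grad \<Omega> u)) \<in> linear_functionals (H1 \<Omega> \<times> H1 \<Omega>)"
      using a by (auto simp: bilinear_form_on_def)
    from linear_functional_0[OF this] show ?thesis
      using B H2 u v(2) subspace_Times[OF subspace_H1[OF \<Omega>] subspace_H1[OF \<Omega>]] by simp
  qed
  then have "(SUP u\<in>?H - {0}. ereal (B v u / (norm_H2 \<Omega> v * norm_H2 \<Omega> u))) \<le> 0"
    by (intro SUP_least) simp
  moreover have "inf_sup ?H (norm_H2 \<Omega>) B \<le> (SUP u\<in>?H - {0}. ereal (B v u / (norm_H2 \<Omega> v * norm_H2 \<Omega> u)))"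
    unfolding inf_sup_def using \<open>v \<in> ?H\<close> \<open>v \<noteq> 0\<close> by (intro INF_lower) simp
  ultimately show False using inf_sup by (meson leD order_trans)
qed

text \<open>A positive supremum supplies one positive quotient, and a quotient with numerator 0 is 0
  whatever the norms are.\<close>

lemma inf_sup_pos_nondegenerate:
  assumes "inf_sup V nrm B > 0" "u \<in> V" "u \<noteq> 0"
  obtains v where "v \<in> V" "B u v \<noteq> 0"
proof -
  have "inf_sup V nrm B \<le> (SUP v\<in>V - {0}. ereal (B u v / (nrm u * nrm v)))"
    unfolding inf_sup_def using assms(2,3) by (intro INF_lower) simp
  then have "0 < (SUP v\<in>V - {0}. ereal (B u v / (nrm u * nrm v)))" using assms(1) by (rule less_le_trans[rotated])
  then obtain v where "v \<in> V" "0 < ereal (B u v / (nrm u * nrm v))"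
    unfolding less_SUP_iff by blast
  then show thesis using that[of v] by fastforce
qed

text \<open>What is left is to supply the assumptions of \<open>decoupled_spaces\<close>. The
  cutoffs \<open>\<rho>\<close> are an arbitrary but fixed choice of functions realising the
  pairings with the constant 1.\<close>

theorem theorem9p1:
  fixes \<Omega> :: "(real^2) set"
    and N\<^sub>H :: nat
    and \<Omega>j :: "nat \<Rightarrow> (real^2) set"
    and \<Gamma>\<^sub>c \<Gamma>\<^sub>s \<Gamma>\<^sub>f :: "(real^2) set"
    and N\<^sub>f :: nat
    and \<Gamma>fi :: "nat \<Rightarrow> (real^2) set"
    and \<rho> :: "nat \<Rightarrow> ae_fun"
    and B :: "ae_fun \<Rightarrow> ae_fun \<Rightarrow> real"
    and a :: "ae_field \<Rightarrow> ae_field \<Rightarrow> real"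
    and M\<^sub>B M \<alpha> :: real
    and Wt Wt\<^sub>\<Gamma> W\<^sub>\<Gamma> :: "ae_fun set"
    and G G\<^sub>\<Gamma> Q\<^sub>\<Gamma> :: "ae_field set"
  assumes domain: "lipschitz_polygon \<Omega>" "connected \<Omega>"
      "\<Omega> = \<Omega>j 0 - (\<Union>j\<in>{1..N\<^sub>H}. closure (\<Omega>j j))"
      "\<forall>j\<in>{0..N\<^sub>H}. lipschitz_polygon (\<Omega>j j) \<and> simply_connected (\<Omega>j j)"
      "\<forall>j\<in>{1..N\<^sub>H}. closure (\<Omega>j j) \<subset> \<Omega>j 0"
      "\<forall>i\<in>{1..N\<^sub>H}. \<forall>j\<in>{1..N\<^sub>H}. i \<noteq> j \<longrightarrow> closure (\<Omega>j i) \<inter> closure (\<Omega>j j) = {}"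
    and boundary: "\<Gamma>\<^sub>c \<union> \<Gamma>\<^sub>s \<union> \<Gamma>\<^sub>f = frontier \<Omega>"
      "\<Gamma>\<^sub>c \<inter> \<Gamma>\<^sub>s = {}" "\<Gamma>\<^sub>c \<inter> \<Gamma>\<^sub>f = {}" "\<Gamma>\<^sub>s \<inter> \<Gamma>\<^sub>f = {}"
    and free_components: "bij_betw \<Gamma>fi {1..N\<^sub>f} (components \<Gamma>\<^sub>f)"
    and cutoffs: "\<forall>i\<in>{1..N\<^sub>f - 1}. component_cutoff \<Omega> N\<^sub>f \<Gamma>fi i (\<rho> i)"
    and B_bilinear: "bilinear_form_on (H2 \<Omega>) B"
    and B_bounded: "\<forall>u\<in>H2 \<Omega>. \<forall>v\<in>H2 \<Omega>. \<bar>B u v\<bar> \<le> M\<^sub>B * norm_H2 \<Omega> u * norm_H2 \<Omega> v"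
    and B_inf_sup: "\<alpha> > 0" "inf_sup (H2_bc \<Omega> \<Gamma>\<^sub>c \<Gamma>\<^sub>s) (norm_H2 \<Omega>) B \<ge> ereal \<alpha>"
    and B_nondegenerate:
      "\<forall>v\<in>H2_bc \<Omega> \<Gamma>\<^sub>c \<Gamma>\<^sub>s. v \<noteq> 0 \<longrightarrow> (SUP u\<in>H2_bc \<Omega> \<Gamma>\<^sub>c \<Gamma>\<^sub>s. ereal (B u v)) > 0"
    and a_bilinear: "bilinear_form_on (H1 \<Omega> \<times> H1 \<Omega>) a"
    and a_bounded: "M > 0" "\<forall>\<theta>\<in>H1 \<Omega> \<times> H1 \<Omega>. \<forall>\<psi>\<in>H1 \<Omega> \<times> H1 \<Omega>.
      \<bar>a \<theta> \<psi>\<bar> \<le> M * norm_H1_vec \<Omega> \<theta> * norm_H1_vec \<Omega> \<psi>"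
    and B_eq_a: "\<forall>w\<in>H2 \<Omega>. \<forall>v\<in>H2 \<Omega>. B w v = a (grad \<Omega> w) (grad \<Omega> v)"
    and A1: "fin_dim_subspace Wt" "Wt \<subseteq> H1 \<Omega>"
      "fin_dim_subspace G" "G \<subseteq> H1 \<Omega> \<times> H1 \<Omega>"
      "Wt\<^sub>\<Gamma> = Wt \<inter> H1_bc \<Omega> \<Gamma>\<^sub>c \<Gamma>\<^sub>s" "G\<^sub>\<Gamma> = G \<inter> G_bc \<Omega> \<Gamma>\<^sub>c \<Gamma>\<^sub>s"
    and A2: "Q\<^sub>\<Gamma> = (\<lambda>(v, \<psi>). Xi \<Omega> v \<psi>) ` (Wt\<^sub>\<Gamma> \<times> G\<^sub>\<Gamma>)"
    and A3: "W\<^sub>\<Gamma> = {v\<in>Wt\<^sub>\<Gamma>. grad \<Omega> v \<in> G\<^sub>\<Gamma>}" "inf_sup W\<^sub>\<Gamma> (norm_H2 \<Omega>) B > 0"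
    and B1: "\<forall>\<kappa>\<in>vecs N\<^sub>f. \<exists>\<psi>\<in>G\<^sub>\<Gamma>. curl \<Omega> \<psi> = 0 \<and>
      (\<forall>i\<in>{1..N\<^sub>f - 1}. tangential_pairing \<Omega> \<psi> (\<rho> i) = \<kappa> i)"
    and B2: "grad \<Omega> ` W\<^sub>\<Gamma> = {\<gamma>\<in>G\<^sub>\<Gamma>. curl \<Omega> \<gamma> = 0 \<and>
      (\<forall>i\<in>{1..N\<^sub>f - 1}. tangential_pairing \<Omega> \<gamma> (\<rho> i) = 0)}"
  shows "(\<forall>F\<^sub>1\<in>linear_functionals G\<^sub>\<Gamma>. \<forall>F\<^sub>2\<in>linear_functionals Wt\<^sub>\<Gamma>. \<forall>w \<gamma> q. \<forall>z\<in>Wt\<^sub>\<Gamma>.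
        mixed_solution \<Omega> a Wt\<^sub>\<Gamma> G\<^sub>\<Gamma> Q\<^sub>\<Gamma> F\<^sub>1 F\<^sub>2 (w, \<gamma>, q) \<and> eq_i \<Omega> Wt\<^sub>\<Gamma> F\<^sub>2 z \<longrightarrow>
        (\<exists>!r\<kappa>. case r\<kappa> of (r, \<kappa>) \<Rightarrow> r \<in> curl \<Omega> ` G\<^sub>\<Gamma> \<and> \<kappa> \<in> vecs N\<^sub>f \<and>
           eq_ii \<Omega> N\<^sub>f \<rho> a G\<^sub>\<Gamma> F\<^sub>1 z \<gamma> r \<kappa> \<and> eq_iii \<Omega> N\<^sub>f \<rho> G\<^sub>\<Gamma> \<gamma>) \<and>
        eq_iv \<Omega> Wt\<^sub>\<Gamma> \<gamma> w)
    \<and> (\<forall>F\<^sub>1\<in>linear_functionals G\<^sub>\<Gamma>. \<forall>F\<^sub>2\<in>linear_functionals Wt\<^sub>\<Gamma>.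
        (\<exists>!s. decoupled_solution \<Omega> N\<^sub>f \<rho> a Wt\<^sub>\<Gamma> G\<^sub>\<Gamma> F\<^sub>1 F\<^sub>2 s) \<and>
        (\<forall>z \<gamma> r \<kappa> w. decoupled_solution \<Omega> N\<^sub>f \<rho> a Wt\<^sub>\<Gamma> G\<^sub>\<Gamma> F\<^sub>1 F\<^sub>2 (z, \<gamma>, r, \<kappa>, w) \<longrightarrow>
          (\<exists>!\<zeta>. \<zeta> \<in> grad_perp \<Omega> Wt\<^sub>\<Gamma> Q\<^sub>\<Gamma> \<and>
             (\<forall>\<eta>\<in>Q\<^sub>\<Gamma>. ip_curl \<Omega> \<zeta> \<eta> = - b_tilde \<Omega> N\<^sub>f \<rho> \<eta> r \<kappa>)) \<and>
          (\<forall>\<zeta>. \<zeta> \<in> grad_perp \<Omega> Wt\<^sub>\<Gamma> Q\<^sub>\<Gamma> \<and>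
             (\<forall>\<eta>\<in>Q\<^sub>\<Gamma>. ip_curl \<Omega> \<zeta> \<eta> = - b_tilde \<Omega> N\<^sub>f \<rho> \<eta> r \<kappa>) \<longrightarrow>
             mixed_solution \<Omega> a Wt\<^sub>\<Gamma> G\<^sub>\<Gamma> Q\<^sub>\<Gamma> F\<^sub>1 F\<^sub>2 (w, \<gamma>, \<zeta> + grad \<Omega> z) \<and>
             (\<forall>T. mixed_solution \<Omega> a Wt\<^sub>\<Gamma> G\<^sub>\<Gamma> Q\<^sub>\<Gamma> F\<^sub>1 F\<^sub>2 T \<longrightarrow> T = (w, \<gamma>, \<zeta> + grad \<Omega> z)))))"
proof -
  have \<Omega>: "open \<Omega>" "bounded \<Omega>" "\<exists>E. is_edge_set (frontier \<Omega>) E"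
    using domain(1) by (auto simp: lipschitz_polygon_def lipschitz_domain_def)
  have Wt\<Gamma>: "Wt\<^sub>\<Gamma> \<subseteq> H1_bc \<Omega> \<Gamma>\<^sub>c \<Gamma>\<^sub>s" "Wt\<^sub>\<Gamma> \<subseteq> H1 \<Omega>" and G\<Gamma>: "G\<^sub>\<Gamma> \<subseteq> H1 \<Omega> \<times> H1 \<Omega>"
    using A1 by auto
  \<comment> \<open>\<open>B\<close> and \<open>a\<close> are identified only on
    \<open>H2 \<Omega>\<close>; elements of \<open>W\<^sub>\<Gamma>\<close> are there because their
    gradients lie in \<open>G\<^sub>\<Gamma>\<close>, hence in
    \<open>H1 \<Omega> \<times> H1 \<Omega>\<close>.\<close>
  have V_H2: "v \<in> H2 \<Omega>" if "v \<in> W\<^sub>\<Gamma>" for v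
  proof -
    have "grad \<Omega> v \<in> H1 \<Omega> \<times> H1 \<Omega>" using that A3(1) G\<Gamma> by auto
    then have "wderiv \<Omega> i v \<in> H1 \<Omega>" for i using exhaust_2[of i] by (auto simp: grad_def)
    then show ?thesis using that A3(1) Wt\<Gamma>(2) by (auto simp: H2_def)
  qed
  interpret decoupled_spaces \<Omega> N\<^sub>f \<rho> a Wt\<^sub>\<Gamma> W\<^sub>\<Gamma> G\<^sub>\<Gamma> Q\<^sub>\<Gamma>
  proof
    show "open \<Omega>" by (rule \<Omega>(1))
    show "fin_dim_subspace Wt\<^sub>\<Gamma>"
      unfolding A1(5)
      by (intro fin_dim_subspace_mono[OF A1(1)] subspace_inter subspace_if_fin_dim[OF A1(1)] subspace_H1_bc \<Omega>) auto
    show "fin_dim_subspace G\<^sub>\<Gamma>"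
      unfolding A1(6)
      by (intro fin_dim_subspace_mono[OF A1(3)] subspace_inter subspace_if_fin_dim[OF A1(3)] subspace_G_bc \<Omega>) auto
    \<comment> \<open>Members of \<open>Wt\<^sub>\<Gamma>\<close> need not be in
      \<open>H2 \<Omega>\<close>, but those with zero gradient are, so the continuous inf-sup
      condition applies to them.\<close>
    show "v = 0" if "v \<in> Wt\<^sub>\<Gamma>" "grad \<Omega> v = 0" for v
    proof (rule grad_eq_0D_if_inf_sup[OF \<Omega>(1) a_bilinear B_eq_a _ _ that(2)])
      show "inf_sup (H2_bc \<Omega> \<Gamma>\<^sub>c \<Gamma>\<^sub>s) (norm_H2 \<Omega>) B > 0"
        using B_inf_sup by (metis ereal_less(2) less_le_trans)
      show "v \<in> H1_bc \<Omega> \<Gamma>\<^sub>c \<Gamma>\<^sub>s" using that(1) Wt\<Gamma>(1) by blast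
    qed
    show "u = 0" if u: "u \<in> W\<^sub>\<Gamma>" "\<And>v. v \<in> W\<^sub>\<Gamma> \<Longrightarrow> a (grad \<Omega> u) (grad \<Omega> v) = 0" for u
    proof (rule ccontr)
      assume "u \<noteq> 0"
      then obtain v where "v \<in> W\<^sub>\<Gamma>" "B u v \<noteq> 0"
        by (rule inf_sup_pos_nondegenerate[OF A3(2) u(1)])
      then show False using u V_H2 B_eq_a by force
    qed
    show "\<rho> i \<in> H1 \<Omega>" if "i \<in> {1..N\<^sub>f - 1}" for i
      using cutoffs that by (auto simp: component_cutoff_def)
    show "tangential_pairing \<Omega> (grad \<Omega> v) (\<rho> i) = 0" if "v \<in> Wt\<^sub>\<Gamma>" "i \<in> {1..N\<^sub>f - 1}" for v i
      using tangential_pairing_grad_eq_0[OF \<Omega> _ boundary(1) free_components] cutoffs that Wt\<Gamma>(1) by blast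
  qed (use Wt\<Gamma>(2) G\<Gamma> a_bilinear A3(1) B1 B2 A2 in simp_all)
  show ?thesis
  proof (intro conjI ballI allI impI)
    fix F\<^sub>1 F\<^sub>2 w \<gamma> q z
    assume *: "F\<^sub>1 \<in> linear_functionals G\<^sub>\<Gamma>" "z \<in> Wt\<^sub>\<Gamma>"
      "mixed_solution \<Omega> a Wt\<^sub>\<Gamma> G\<^sub>\<Gamma> Q\<^sub>\<Gamma> F\<^sub>1 F\<^sub>2 (w, \<gamma>, q) \<and> eq_i \<Omega> Wt\<^sub>\<Gamma> F\<^sub>2 z"
    note sol = mixed_solution_decouples[OF *(1) conjunct1[OF *(3)] *(2) conjunct2[OF *(3)]]
    show "\<exists>!r\<kappa>. case r\<kappa> of (r, \<kappa>) \<Rightarrow> r \<in> curl \<Omega> ` G\<^sub>\<Gamma> \<and> \<kappa> \<in> vecs N\<^sub>f \<and>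
        eq_ii \<Omega> N\<^sub>f \<rho> a G\<^sub>\<Gamma> F\<^sub>1 z \<gamma> r \<kappa> \<and> eq_iii \<Omega> N\<^sub>f \<rho> G\<^sub>\<Gamma> \<gamma>"
      by (rule conjunct1[OF sol])
    show "eq_iv \<Omega> Wt\<^sub>\<Gamma> \<gamma> w" by (rule conjunct2[OF sol])
  next
    fix F\<^sub>1 F\<^sub>2 assume "F\<^sub>1 \<in> linear_functionals G\<^sub>\<Gamma>" "F\<^sub>2 \<in> linear_functionals Wt\<^sub>\<Gamma>"
    then show "\<exists>!s. decoupled_solution \<Omega> N\<^sub>f \<rho> a Wt\<^sub>\<Gamma> G\<^sub>\<Gamma> F\<^sub>1 F\<^sub>2 s"
      by (rule decoupled_solution_ex1)
  next
    fix F\<^sub>1 F\<^sub>2 z \<gamma> r \<kappa> w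
    assume "decoupled_solution \<Omega> N\<^sub>f \<rho> a Wt\<^sub>\<Gamma> G\<^sub>\<Gamma> F\<^sub>1 F\<^sub>2 (z, \<gamma>, r, \<kappa>, w)"
    then have "r \<in> curl \<Omega> ` G\<^sub>\<Gamma>" by (simp add: decoupled_solution_def)
    then show "\<exists>!\<zeta>. \<zeta> \<in> grad_perp \<Omega> Wt\<^sub>\<Gamma> Q\<^sub>\<Gamma> \<and> (\<forall>\<eta>\<in>Q\<^sub>\<Gamma>. ip_curl \<Omega> \<zeta> \<eta> = - b_tilde \<Omega> N\<^sub>f \<rho> \<eta> r \<kappa>)"
      by (rule multiplier_representative_ex1)
  next
    fix F\<^sub>1 F\<^sub>2 z \<gamma> r \<kappa> w \<zeta>
    assume "F\<^sub>1 \<in> linear_functionals G\<^sub>\<Gamma>" "decoupled_solution \<Omega> N\<^sub>f \<rho> a Wt\<^sub>\<Gamma> G\<^sub>\<Gamma> F\<^sub>1 F\<^sub>2 (z, \<gamma>, r, \<kappa>, w)"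
      "\<zeta> \<in> grad_perp \<Omega> Wt\<^sub>\<Gamma> Q\<^sub>\<Gamma> \<and> (\<forall>\<eta>\<in>Q\<^sub>\<Gamma>. ip_curl \<Omega> \<zeta> \<eta> = - b_tilde \<Omega> N\<^sub>f \<rho> \<eta> r \<kappa>)"
    then show sol: "mixed_solution \<Omega> a Wt\<^sub>\<Gamma> G\<^sub>\<Gamma> Q\<^sub>\<Gamma> F\<^sub>1 F\<^sub>2 (w, \<gamma>, \<zeta> + grad \<Omega> z)"
      using mixed_solution_from_decoupled by blast
    fix T assume "mixed_solution \<Omega> a Wt\<^sub>\<Gamma> G\<^sub>\<Gamma> Q\<^sub>\<Gamma> F\<^sub>1 F\<^sub>2 T"
    then show "T = (w, \<gamma>, \<zeta> + grad \<Omega> z)"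
      using mixed_solution_unique[OF sol] by (cases T) auto
  qed
qed

end
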